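(* Let $n\ge1$ and let $M$ be one of $\imath\mathrm{o}(2n)$ ($\nu=-1/2$), $\imath\mathrm{o}(2n+1)$ ($\nu=+1/2$), $\imath\mathrm{usp}(2n)$ ($\nu=+1/2$), $M_\nu$ ($\nu\in\mathbb N_0$). Let $X_1\in M$ be drawn from the P\'olya ensemble on $M$ associated to the weight $\omega\in L^1_\nu(\mathbb R_+)$ and let $X_2\in M$ be a random matrix, independent of $X_1$, drawn from a polynomial ensemble on $M$ associated with the weights $w_1,\ldots,w_n$. Suppose the polynomial ensemble of $X_2$ can be described by the bi-orthonormal functions $\{\tilde p_j,w_{j+1}\}_{j=0,\ldots,n-1}$ with kernel $\tilde K_n(y',y)=\sum_{j=0}^{n-1}\tilde p_j(y')w_{j+1}(y)$. Consider the joint probability density $$p_A^{(w)}(y)=\frac{C_n[w]}{n!(\mathcal H_\nu\omega(0))^n}\Delta_n(y)\det[\omega\ast_\nu w_b(y_a)]_{a,b=1,\ldots,n},\qquad y\in\mathbb R_+^n,$$ of the squared singular values of $Y=X_1+X_2$. Then the pair of bi-orthonormal functions on $\mathbb R_+$ corresponding to $Y$ (i.e. describing this density) is $$p_j(y')=\int_0^\infty dr\,e^{-r}\left.\frac{(r-\partial_t\,{y'}^{-\nu}\partial_{y'}{y'}^{\nu+1}\partial_{y'})^{n-1}}{(n-1)!}\frac{\tilde p_j(y')}{\mathcal H_\nu\omega(t)}\right|_{t=0},\qquad q_j(y)=\omega\ast_\nu w_{j+1}(y),\qquad j=0,\ldots,n-1,$$ and the corresponding kernel is, for $\nu>-1/2$,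 $$K_n(y',y)=y^\nu\int_0^\infty dx\int_0^\infty dr\,e^{-r}\left(\frac{\Gamma[\nu+1]}{\sqrt\pi\,\Gamma[\nu+1/2]}\int_{-1}^1\frac{\omega(x+y-2\sqrt{xy}\,t)}{(x+y-2\sqrt{xy}\,t)^\nu}(1-t^2)^{\nu-1/2}dt\right)\left.\frac{(r-\partial_t\,{y'}^{-\nu}\partial_{y'}{y'}^{\nu+1}\partial_{y'})^{n-1}}{(n-1)!}\frac{\tilde K_n(y',x)}{\mathcal H_\nu\omega(t)}\right|_{t=0}$$ and, for $\nu=-1/2$, $$K_n(y',y)=\frac{1}{2\sqrt y}\int_0^\infty dx\int_0^\infty dr\,e^{-r}\left[|\sqrt x-\sqrt y|\,\omega((\sqrt x-\sqrt y)^2)+|\sqrt x+\sqrt y|\,\omega((\sqrt x+\sqrt y)^2)\right]\left.\frac{(r-\partial_t\,{y'}^{-\nu}\partial_{y'}{y'}^{\nu+1}\partial_{y'})^{n-1}}{(n-1)!}\frac{\tilde K_n(y',x)}{\mathcal H_\nu\omega(t)}\right|_{t=0}.$$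
   Context: Matrix spaces: $\imath\mathrm o(m)$ is the space of Hermitian antisymmetric $m\times m$ matrices, with group $\mathcal K=\mathrm O(m)$; $\imath\mathrm{usp}(2n)$ is the space of Hermitian anti-self-dual $2n\times2n$ matrices ($\imath$ times the Lie algebra of $\mathcal K=\mathrm{USp}(2n)$); $M_\nu$ is the space of matrices $\begin{bmatrix}0 & W \\ W^* & 0\end{bmatrix}$ with $W\in\mathbb C^{n\times(n+\nu)}$, with $\mathcal K=\mathrm U(n)\times\mathrm U(n+\nu)$. $\mathcal K$ acts by $m\mapsto kmk^*$. The non-trivial eigenvalues of $X\in M$ are $\pm\sqrt{a_1},\ldots,\pm\sqrt{a_n}$ (in addition there is one forced zero for $\imath\mathrm o(2n+1)$ and $\nu$ forced zeros for $M_\nu$); $a=(a_1,\ldots,a_n)$ are called the squared singular values of $X$. Notation: $\Delta_n(x)=\prod_{1\le b<c\le n}(x_c-x_b)$; $\mathcal H_\nu f(s)=\Gamma[\nu+1]\int_0^\infty f(x)\frac{J_\nu(2\sqrt{xs})}{(sx)^{\nu/2}}dx$ with $J_\nu$ the Bessel function (at $s=0$ by continuity); derivatives of $\mathcal H_\nu\omega(t)$ at $t=0$ are taken from $t\ge0$ where necessary. The convolution $\ast_\nu$ of functions on $\mathbb R_+$ is $$\omega\ast_\nu\sigma(x)=\frac{\Gamma[\nu+1]}{\sqrt\pi\,\Gamma[\nu+1/2]}x^\nu\int_0^\infty\omega(y)\left(\int_{-1}^1\frac{\sigma(x+y-2\sqrt{xy}\,t)}{(x+y-2\sqrt{xy}\,t)^\nu}(1-t^2)^{\nu-1/2}dt\right)dy\quad(\nu>-1/2),$$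 $$\omega\ast_\nu\sigma(x)=\frac{1}{2\sqrt x}\int_0^\infty\omega(y)\left[|\sqrt y-\sqrt x|\,\sigma((\sqrt y-\sqrt x)^2)+|\sqrt y+\sqrt x|\,\sigma((\sqrt y+\sqrt x)^2)\right]dy\quad(\nu=-1/2).$$ $L^1_{[1,n]}(\mathbb R_+)$ is the set of $f\in L^1(\mathbb R_+)$ with $\int_0^\infty|x^{\kappa-1}f(x)|dx<\infty$ for all $\kappa\in[1,n]$. $L^1_\nu(\mathbb R_+)$ is the set of $f\in L^1(\mathbb R_+)$ that are non-negative, $2(n-1)$-times differentiable, satisfy $\int_0^\infty\left|x^{\kappa-1}\left(x^\nu\partial_x x^{1-\nu}\partial_x\right)^jf(x)\right|dx<\infty$ for all $\kappa\in[1,n]$, $j=0,\ldots,n-1$, and $\lim_{x\to0}x^{\nu+1}\partial_x x^{-\nu}\left(\partial_xx^{\nu+1}\partial_xx^{-\nu}\right)^lf(x)=0$ for $l=0,\ldots,n-2$. Polynomial ensemble on $M$ associated with weights $w_1,\ldots,w_n\in L^1_{[1,n]}(\mathbb R_+)$: a random matrix in $M$ whose law has a $\mathcal K$-invariant density (with respect to Lebesgue measure) and whose unordered squared singular values have joint probability density $\frac{C_n[w]}{n!}\Delta_n(a)\det[w_b(a_c)]_{b,c=1}^n\ge0$ on $\mathbb R_+^n$, with normalization constant $C_n[w]>0$. A P\'olya ensemble on $M$ with associated weight $\omega\in L^1_\nu(\mathbb R_+)$ is a polynomial ensemble with $w_j=(x^\nu\partial_xx^{1-\nu}\partial_x)^{j-1}\omega$.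 Description by bi-orthonormal functions: a polynomial ensemble with weights $v_1,\ldots,v_n$ is described by $\{p_j,q_j\}_{j=0,\ldots,n-1}$ if $\int_0^\infty p_l(y)q_m(y)dy=\delta_{lm}$ for $l,m=0,\ldots,n-1$, the linear span of $\{p_j\}$ equals that of $\{y^j\}_{j=0,\ldots,n-1}$, and the linear span of $\{q_j\}$ equals that of $\{v_{j+1}\}_{j=0,\ldots,n-1}$. The corresponding kernel is $\sum_{j=0}^{n-1}p_j(y')q_j(y)$. In the formulas, $\partial_t$ acts on $1/\mathcal H_\nu\omega(t)$ and the differential operator in $y'$ acts on $\tilde p_j(y')$ or $\tilde K_n(y',x)$. *)

theory Defs
  imports
    "HOL-Probability.Probability"
    "Jordan_Normal_Form.Schur_Decomposition"
begin

section \<open>The matrix spaces\<close>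

text \<open>
  \<open>IO_even\<close>, \<open>IO_odd\<close>, \<open>IUSp\<close> and \<open>Chiral m\<close> stand for i o(2n), i o(2n+1), i usp(2n)
  and the space of block matrices built from complex n x (n+m) matrices; the parameter n is
  passed separately.
\<close>

datatype matrix_space = IO_even | IO_odd | IUSp | Chiral nat

fun msp_nu :: "matrix_space \<Rightarrow> real" where
  "msp_nu IO_even = - 1 / 2"
| "msp_nu IO_odd = 1 / 2"
| "msp_nu IUSp = 1 / 2"
| "msp_nu (Chiral m) = real m"

fun msp_zeros :: "matrix_space \<Rightarrow> nat" where
  "msp_zeros IO_even = 0"
| "msp_zeros IO_odd = 1"
| "msp_zeros IUSp = 0"
| "msp_zeros (Chiral m) = m"

definition msp_dim :: "nat \<Rightarrow> matrix_space \<Rightarrow> nat" where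
  "msp_dim n M = 2 * n + msp_zeros M"

definition unitary_mats :: "nat \<Rightarrow> complex mat set" where
  "unitary_mats m = {k \<in> carrier_mat m m. k * mat_adjoint k = 1\<^sub>m m}"

definition symplectic_unit :: "nat \<Rightarrow> complex mat" where
  "symplectic_unit n = four_block_mat (0\<^sub>m n n) (1\<^sub>m n) (- 1\<^sub>m n) (0\<^sub>m n n)"

text \<open>The quaternionic dual \<open>J X\<^sup>T J\<^sup>-\<^sup>1\<close>, where \<open>J\<^sup>-\<^sup>1 = - J\<close>.\<close>

definition mat_dual :: "nat \<Rightarrow> complex mat \<Rightarrow> complex mat" where
  "mat_dual n X = symplectic_unit n * transpose_mat X * (- symplectic_unit n)"

fun msp_carrier :: "nat \<Rightarrow> matrix_space \<Rightarrow> complex mat set" where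
  "msp_carrier n IO_even =
     {X \<in> carrier_mat (2 * n) (2 * n). mat_adjoint X = X \<and> transpose_mat X = - X}"
| "msp_carrier n IO_odd =
     {X \<in> carrier_mat (2 * n + 1) (2 * n + 1). mat_adjoint X = X \<and> transpose_mat X = - X}"
| "msp_carrier n IUSp =
     {X \<in> carrier_mat (2 * n) (2 * n). mat_adjoint X = X \<and> mat_dual n X = - X}"
| "msp_carrier n (Chiral m) =
     {four_block_mat (0\<^sub>m n n) W (mat_adjoint W) (0\<^sub>m (n + m) (n + m)) |W.
        W \<in> carrier_mat n (n + m)}"

definition orthogonal_mats :: "nat \<Rightarrow> complex mat set" where
  "orthogonal_mats m =
     {k \<in> carrier_mat m m. (\<forall>i<m. \<forall>j<m. k $$ (i, j) \<in> \<real>) \<and> k * transpose_mat k = 1\<^sub>m m}"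

fun msp_group :: "nat \<Rightarrow> matrix_space \<Rightarrow> complex mat set" where
  "msp_group n IO_even = orthogonal_mats (2 * n)"
| "msp_group n IO_odd = orthogonal_mats (2 * n + 1)"
| "msp_group n IUSp = {k \<in> unitary_mats (2 * n). mat_dual n k = mat_adjoint k}"
| "msp_group n (Chiral m) =
     {four_block_mat U (0\<^sub>m n (n + m)) (0\<^sub>m (n + m) n) V |U V.
        U \<in> unitary_mats n \<and> V \<in> unitary_mats (n + m)}"

text \<open>The Borel \<open>\<sigma>\<close>-algebra of the space, generated by the matrix entries.\<close>

definition msp_borel :: "nat \<Rightarrow> matrix_space \<Rightarrow> complex mat measure" where
  "msp_borel n M =
     (let I = {..<msp_dim n M} \<times> {..<msp_dim n M} in
      vimage_algebra (msp_carrier n M) (\<lambda>X. \<lambda>ij\<in>I. X $$ ij) (\<Pi>\<^sub>M ij\<in>I. (borel :: complex measure)))"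

definition real_lincomb ::
    "nat \<Rightarrow> nat \<Rightarrow> (nat \<Rightarrow> complex mat) \<Rightarrow> (nat \<Rightarrow> real) \<Rightarrow> complex mat" where
  "real_lincomb N d B c =
     Matrix.mat N N (\<lambda>ij. \<Sum>k<d. complex_of_real (c k) * (B k $$ ij))"

text \<open>
  Lebesgue measure on the real vector space \<open>msp_carrier n M\<close>: the image of Lebesgue measure
  under the coordinate isomorphism of a real basis \<open>B\<close>. Different bases change it by a positive
  constant factor only, which is irrelevant for the existence of a density.
\<close>

definition msp_lebesgue :: "nat \<Rightarrow> matrix_space \<Rightarrow> complex mat measure \<Rightarrow> bool" where
  "msp_lebesgue n M \<mu> \<longleftrightarrow>
     (\<exists>d B. bij_betw (real_lincomb (msp_dim n M) d B) ({..<d} \<rightarrow>\<^sub>E UNIV) (msp_carrier n M) \<and>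
            \<mu> = distr (\<Pi>\<^sub>M i\<in>{..<d}. (lborel :: real measure)) (msp_borel n M)
                  (real_lincomb (msp_dim n M) d B))"

definition has_invariant_density ::
    "'s measure \<Rightarrow> nat \<Rightarrow> matrix_space \<Rightarrow> ('s \<Rightarrow> complex mat) \<Rightarrow> bool" where
  "has_invariant_density P n M X \<longleftrightarrow>
     X \<in> measurable P (msp_borel n M) \<and>
     (\<exists>\<mu> (f :: complex mat \<Rightarrow> real).
        msp_lebesgue n M \<mu> \<and> f \<in> borel_measurable (msp_borel n M) \<and>
        (\<forall>A\<in>msp_carrier n M. 0 \<le> f A) \<and>
        (\<forall>k\<in>msp_group n M. \<forall>A\<in>msp_carrier n M. f (k * A * mat_adjoint k) = f A) \<and>
        distr P (msp_borel n M) X = density \<mu> (\<lambda>A. ennreal (f A)))"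

section \<open>Squared singular values and their joint density\<close>

text \<open>Vectors \<open>(a\<^sub>1, \<dots>, a\<^sub>n)\<close> are extensional functions on \<open>{1..n}\<close>.\<close>

definition is_squared_sv ::
    "nat \<Rightarrow> matrix_space \<Rightarrow> complex mat \<Rightarrow> (nat \<Rightarrow> real) \<Rightarrow> bool" where
  "is_squared_sv n M X a \<longleftrightarrow>
     a \<in> {1..n} \<rightarrow>\<^sub>E {0..} \<and>
     char_poly X =
       (\<Prod>j\<in>{1..n}. [:- complex_of_real (sqrt (a j)), 1:] * [:complex_of_real (sqrt (a j)), 1:])
         * [:0, 1:] ^ msp_zeros M"

definition lborel_vec :: "nat \<Rightarrow> (nat \<Rightarrow> real) measure" where
  "lborel_vec n = (\<Pi>\<^sub>M i\<in>{1..n}. lborel)"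

definition pos_vec :: "nat \<Rightarrow> (nat \<Rightarrow> real) set" where
  "pos_vec n = {1..n} \<rightarrow>\<^sub>E {0<..}"

definition perm_invariant :: "nat \<Rightarrow> (nat \<Rightarrow> real) set \<Rightarrow> bool" where
  "perm_invariant n B \<longleftrightarrow> (\<forall>\<pi> a. \<pi> permutes {1..n} \<longrightarrow> a \<in> B \<longrightarrow> a \<circ> \<pi> \<in> B)"

text \<open>
  Joint density of the unordered squared singular values: since these are only determined up to
  a permutation, the density is tested on permutation invariant Borel sets.
\<close>

definition has_ssv_density ::
    "'s measure \<Rightarrow> nat \<Rightarrow> matrix_space \<Rightarrow> ('s \<Rightarrow> complex mat) \<Rightarrow> ((nat \<Rightarrow> real) \<Rightarrow> real) \<Rightarrow> bool" where
  "has_ssv_density P n M X f \<longleftrightarrow>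
     set_borel_measurable (lborel_vec n) (pos_vec n) f \<and>
     (AE a in lborel_vec n. a \<in> pos_vec n \<longrightarrow> 0 \<le> f a) \<and>
     (\<forall>B\<in>sets (lborel_vec n). perm_invariant n B \<longrightarrow>
        {s \<in> space P. \<exists>a\<in>B. is_squared_sv n M (X s) a} \<in> sets P \<and>
        emeasure P {s \<in> space P. \<exists>a\<in>B. is_squared_sv n M (X s) a} =
          (\<integral>\<^sup>+ a \<in> B \<inter> pos_vec n. ennreal (f a) \<partial>lborel_vec n))"

section \<open>Function spaces, Hankel transform and convolution\<close>

text \<open>
  Functions on \<open>\<real>\<^sub>+\<close> are functions on \<open>\<real>\<close> of which only the values on \<open>{0<..}\<close> matter.
\<close>

definition L1_moments :: "nat \<Rightarrow> (real \<Rightarrow> real) set" where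
  "L1_moments n =
     {f. set_integrable lborel {0<..} f \<and>
         (\<forall>\<kappa>\<in>{1..real n}. set_integrable lborel {0<..} (\<lambda>x. x powr (\<kappa> - 1) * f x))}"

text \<open>The operators \<open>x\<^sup>\<nu> \<partial> x\<^sup>1\<^sup>-\<^sup>\<nu> \<partial>\<close>, \<open>\<partial> x\<^sup>\<nu>\<^sup>+\<^sup>1 \<partial> x\<^sup>-\<^sup>\<nu>\<close> and \<open>x\<^sup>-\<^sup>\<nu> \<partial> x\<^sup>\<nu>\<^sup>+\<^sup>1 \<partial>\<close>.\<close>

definition weight_op :: "real \<Rightarrow> (real \<Rightarrow> real) \<Rightarrow> real \<Rightarrow> real" where
  "weight_op \<nu> f = (\<lambda>x. x powr \<nu> * deriv (\<lambda>y. y powr (1 - \<nu>) * deriv f y) x)"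

definition boundary_op :: "real \<Rightarrow> (real \<Rightarrow> real) \<Rightarrow> real \<Rightarrow> real" where
  "boundary_op \<nu> f = deriv (\<lambda>x. x powr (\<nu> + 1) * deriv (\<lambda>y. y powr (- \<nu>) * f y) x)"

definition poly_op :: "real \<Rightarrow> (real \<Rightarrow> real) \<Rightarrow> real \<Rightarrow> real" where
  "poly_op \<nu> f = (\<lambda>x. x powr (- \<nu>) * deriv (\<lambda>y. y powr (\<nu> + 1) * deriv f y) x)"

definition L1_nu :: "nat \<Rightarrow> real \<Rightarrow> (real \<Rightarrow> real) set" where
  "L1_nu n \<nu> =
     {f. set_integrable lborel {0<..} f \<and>
         (\<forall>x>0. 0 \<le> f x) \<and>
         (\<forall>k<2 * (n - 1). \<forall>x>0. (deriv ^^ k) f differentiable (at x)) \<and>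
         (\<forall>j<n. \<forall>\<kappa>\<in>{1..real n}.
            set_integrable lborel {0<..} (\<lambda>x. x powr (\<kappa> - 1) * (weight_op \<nu> ^^ j) f x)) \<and>
         (\<forall>l<n - 1.
            ((\<lambda>x. x powr (\<nu> + 1) * deriv (\<lambda>y. y powr (- \<nu>) * (boundary_op \<nu> ^^ l) f y) x)
               \<longlongrightarrow> 0) (at_right 0))}"

definition BesselJ :: "real \<Rightarrow> real \<Rightarrow> real" where
  "BesselJ \<nu> z =
     (\<Sum>k. (- 1) ^ k * rGamma (\<nu> + real k + 1) / fact k * (z / 2) powr (2 * real k + \<nu>))"

definition hankel_pos :: "real \<Rightarrow> (real \<Rightarrow> real) \<Rightarrow> real \<Rightarrow> real" where
  "hankel_pos \<nu> f s =
     Gamma (\<nu> + 1) *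
     (LINT x:{0<..}|lborel. f x * (BesselJ \<nu> (2 * sqrt (x * s)) / (s * x) powr (\<nu> / 2)))"

definition hankel :: "real \<Rightarrow> (real \<Rightarrow> real) \<Rightarrow> real \<Rightarrow> real" where
  "hankel \<nu> f s = (if s = 0 then Lim (at_right 0) (hankel_pos \<nu> f) else hankel_pos \<nu> f s)"

text \<open>Only meant for \<open>\<nu> \<ge> - 1 / 2\<close>.\<close>

definition conv :: "real \<Rightarrow> (real \<Rightarrow> real) \<Rightarrow> (real \<Rightarrow> real) \<Rightarrow> real \<Rightarrow> real" where
  "conv \<nu> f g x =
     (if \<nu> = - 1 / 2 then
        1 / (2 * sqrt x) *
        (LINT y:{0<..}|lborel. f y *
           (\<bar>sqrt y - sqrt x\<bar> * g ((sqrt y - sqrt x)\<^sup>2) + \<bar>sqrt y + sqrt x\<bar> * g ((sqrt y + sqrt x)\<^sup>2)))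
      else
        Gamma (\<nu> + 1) / (sqrt pi * Gamma (\<nu> + 1 / 2)) * x powr \<nu> *
        (LINT y:{0<..}|lborel. f y *
           (LINT t:{-1..1}|lborel.
              g (x + y - 2 * sqrt (x * y) * t) / (x + y - 2 * sqrt (x * y) * t) powr \<nu>
                * (1 - t\<^sup>2) powr (\<nu> - 1 / 2))))"

section \<open>Polynomial and Polya ensembles\<close>

definition Vandermonde :: "nat \<Rightarrow> (nat \<Rightarrow> real) \<Rightarrow> real" where
  "Vandermonde n x = (\<Prod>c\<in>{1..n}. \<Prod>b\<in>{1..<c}. x c - x b)"

definition weight_det :: "nat \<Rightarrow> (nat \<Rightarrow> real \<Rightarrow> real) \<Rightarrow> (nat \<Rightarrow> real) \<Rightarrow> real" where
  "weight_det n w a = Determinant.det (Matrix.mat n n (\<lambda>(b, c). w (Suc b) (a (Suc c))))"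

text \<open>The constant determined by \<open>\<integral> C / n! * \<Delta>\<^sub>n(a) * det [w\<^sub>b(a\<^sub>c)] da = 1\<close>.\<close>

definition norm_const :: "nat \<Rightarrow> (nat \<Rightarrow> real \<Rightarrow> real) \<Rightarrow> real" where
  "norm_const n w =
     fact n / (LINT a:pos_vec n|lborel_vec n. Vandermonde n a * weight_det n w a)"

definition polynomial_ensemble ::
    "'s measure \<Rightarrow> nat \<Rightarrow> matrix_space \<Rightarrow> (nat \<Rightarrow> real \<Rightarrow> real) \<Rightarrow> ('s \<Rightarrow> complex mat) \<Rightarrow> bool" where
  "polynomial_ensemble P n M w X \<longleftrightarrow>
     (\<forall>b\<in>{1..n}. w b \<in> L1_moments n) \<and>
     has_invariant_density P n M X \<and>
     0 < norm_const n w \<and>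
     has_ssv_density P n M X (\<lambda>a. norm_const n w / fact n * Vandermonde n a * weight_det n w a)"

definition polya_ensemble ::
    "'s measure \<Rightarrow> nat \<Rightarrow> matrix_space \<Rightarrow> (real \<Rightarrow> real) \<Rightarrow> ('s \<Rightarrow> complex mat) \<Rightarrow> bool" where
  "polya_ensemble P n M \<omega> X \<longleftrightarrow>
     \<omega> \<in> L1_nu n (msp_nu M) \<and>
     polynomial_ensemble P n M (\<lambda>j. (weight_op (msp_nu M) ^^ (j - 1)) \<omega>) X"

section \<open>Bi-orthonormal functions\<close>

definition fun_span :: "nat \<Rightarrow> (nat \<Rightarrow> real \<Rightarrow> real) \<Rightarrow> (real \<Rightarrow> real) set" where
  "fun_span n F = {\<lambda>y\<in>{0<..}. \<Sum>j<n. c j * F j y |c :: nat \<Rightarrow> real. True}"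

definition described_by ::
    "nat \<Rightarrow> (nat \<Rightarrow> real \<Rightarrow> real) \<Rightarrow> (nat \<Rightarrow> real \<Rightarrow> real) \<Rightarrow> (nat \<Rightarrow> real \<Rightarrow> real) \<Rightarrow> bool" where
  "described_by n v p q \<longleftrightarrow>
     (\<forall>l<n. \<forall>m<n. set_integrable lborel {0<..} (\<lambda>y. p l y * q m y) \<and>
        (LINT y:{0<..}|lborel. p l y * q m y) = (if l = m then 1 else 0)) \<and>
     fun_span n p = fun_span n (\<lambda>j y. y ^ j) \<and>
     fun_span n q = fun_span n (\<lambda>j. v (j + 1))"

definition biorth_kernel ::
    "nat \<Rightarrow> (nat \<Rightarrow> real \<Rightarrow> real) \<Rightarrow> (nat \<Rightarrow> real \<Rightarrow> real) \<Rightarrow> real \<Rightarrow> real \<Rightarrow> real" where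
  "biorth_kernel n p q y' y = (\<Sum>j<n. p j y' * q j y)"

text \<open>
  The operator \<open>r - \<partial>\<^sub>t D\<close> on functions of \<open>(t, y')\<close>, where \<open>D\<close> is \<open>poly_op \<nu>\<close> in the variable
  \<open>y'\<close> and the \<open>t\<close>-derivative is taken within \<open>t \<ge> 0\<close>.
\<close>

definition mixed_op ::
    "real \<Rightarrow> real \<Rightarrow> (real \<Rightarrow> real \<Rightarrow> real) \<Rightarrow> real \<Rightarrow> real \<Rightarrow> real" where
  "mixed_op \<nu> r F =
     (\<lambda>t y'. r * F t y' - vector_derivative (\<lambda>s. poly_op \<nu> (F s) y') (at t within {0..}))"

end

theory Submission
  imports Defs
begin

hide_const (open) Module.smult

text \<open>
  The theorem rests on how moments behave under the convolution. Write \<open>s = \<nu> + 1\<close>, let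
  \<open>D = y\<^sup>-\<^sup>\<nu> \<partial> y\<^sup>\<nu>\<^sup>+\<^sup>1 \<partial>\<close> and let \<open>m\<^sub>i\<close> be the moments of \<open>\<omega>\<close>. The convolution is the radial
  convolution of a (fictitious) space of dimension \<open>2 s\<close>: a function of the squared distance is
  averaged over the angle between two vectors of squared lengths \<open>x\<close> and \<open>y\<close>. Translation invariance
  of the underlying measure moves the average from the density onto the power whose moment is taken,
  and the average of \<open>(u + y - 2 sqrt(u y) t)\<^sup>k\<close> is \<open>\<Sum>\<^sub>i y\<^sup>i / ((s)\<^sub>i i!) D\<^sup>i u\<^sup>k\<close>, an instance of the
  Chu-Vandermonde identity (\<open>average_expansion\<close>). Hence for polynomials \<open>Q\<close> of degree below \<open>n\<close>
  integrating \<open>Q\<close> against \<open>\<omega> * \<sigma>\<close> is the same as integrating \<open>B Q\<close> against \<open>\<sigma>\<close>, where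
  \<open>B = \<Sum>\<^sub>i m\<^sub>i / ((s)\<^sub>i i!) D\<^sup>i\<close> (\<open>conv_moment_functional\<close>).

  On the other side, the Hankel transform of \<open>\<omega>\<close> has the right-hand Taylor coefficients
  \<open>(- 1)\<^sup>i m\<^sub>i / ((s)\<^sub>i i!)\<close> at zero, so \<open>B\<close> is formally the Hankel transform of \<open>\<omega>\<close> evaluated at
  \<open>- D\<close>. Expanding the power of \<open>r - \<partial>\<^sub>t D\<close> by the binomial theorem and integrating against
  \<open>exp(- r)\<close> turns the formula for \<open>p\<^sub>j\<close> into the Taylor polynomial of the reciprocal Hankel transform
  evaluated at \<open>- D\<close> and applied to the given polynomial. Since \<open>D\<close> is nilpotent on polynomials, this
  operator \<open>A\<close> is the inverse of \<open>B\<close> (\<open>bessel_op_series_inverse\<close>). Bi-orthonormality and the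
  statement about spans follow at once: integrating \<open>A P\<^sub>l\<close> against \<open>\<omega> * w\<^sub>m\<close> gives the
  integral of \<open>P\<^sub>l\<close> against \<open>w\<^sub>m\<close>.

  For the kernel formula the operator \<open>A\<close> is linear, so that only the commutativity of the convolution
  is left. It holds for almost every argument, namely wherever the double integral converges
  absolutely. Two analytic facts are behind all this: a symmetric integral kernel for the convolution
  (for \<open>\<nu> = - 1 / 2\<close>, its form as the ordinary convolution of even functions on the line)
  together with Fubini's theorem, and the bound \<open>\<bar>J\<bar> \<le> 1\<close> for the normalised Bessel function, which
  allows differentiation of the Hankel transform under the integral up to order \<open>n - 1\<close>.
\<close>


section \<open>The Bessel operator on polynomials\<close>

text \<open>
  The operator \<open>D = x\<^sup>-\<^sup>\<nu> \<partial> x\<^sup>\<nu>\<^sup>+\<^sup>1 \<partial> = s \<partial> + x \<partial>\<^sup>2\<close> with \<open>s = \<nu> + 1\<close>. On the type of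
  polynomials it needs no differentiability side conditions and its powers can be compared
  as polynomials.
\<close>

definition bessel_op :: "real \<Rightarrow> real poly \<Rightarrow> real poly" where
  "bessel_op s P = smult s (pderiv P) + pCons 0 (pderiv (pderiv P))"

lemma bessel_op_add: "bessel_op s (P + Q) = bessel_op s P + bessel_op s Q"
  by (simp add: bessel_op_def pderiv_add smult_add_right)

lemma bessel_op_smult: "bessel_op s (smult c P) = smult c (bessel_op s P)"
  by (simp add: bessel_op_def pderiv_smult smult_add_right mult.commute)

lemma bessel_op_0 [simp]: "bessel_op s 0 = 0" by (simp add: bessel_op_def)

lemma bessel_op_pow_0 [simp]: "(bessel_op s ^^ k) 0 = 0" by (induction k) auto

lemma bessel_op_sum: "bessel_op s (\<Sum>i\<in>A. f i) = (\<Sum>i\<in>A. bessel_op s (f i))"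
  by (induction A rule: infinite_finite_induct) (auto simp: bessel_op_add)

lemma bessel_op_pow_add: "(bessel_op s ^^ k) (P + Q) = (bessel_op s ^^ k) P + (bessel_op s ^^ k) Q"
  by (induction k) (auto simp: bessel_op_add)

lemma bessel_op_pow_smult: "(bessel_op s ^^ k) (smult c P) = smult c ((bessel_op s ^^ k) P)"
  by (induction k) (auto simp: bessel_op_smult)

lemma bessel_op_pow_sum: "(bessel_op s ^^ k) (\<Sum>i\<in>A. f i) = (\<Sum>i\<in>A. (bessel_op s ^^ k) (f i))"
  by (induction A rule: infinite_finite_induct) (auto simp: bessel_op_pow_add)

text \<open>
  Derivatives are local, so the values on the positive half-line suffice; this is what
  allows the abstract functions of the theorem to be traded for polynomials.
\<close>

lemma poly_op_poly:
  assumes f: "\<And>z. z > 0 \<Longrightarrow> f z = poly P z" and y: "y > 0"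
  shows "poly_op \<nu> f y = poly (bessel_op (\<nu> + 1) P) y"
proof -
  have d: "deriv f z = poly (pderiv P) z" if "z > 0" for z
  proof (rule DERIV_imp_deriv)
    show "(f has_field_derivative poly (pderiv P) z) (at z)"
      by (rule has_field_derivative_transform_within_open[OF poly_DERIV open_greaterThan[of 0]])
         (use that f in auto)
  qed
  have "((\<lambda>z. z powr (\<nu> + 1) * poly (pderiv P) z) has_field_derivative
      (\<nu> + 1) * y powr \<nu> * poly (pderiv P) y + y powr (\<nu> + 1) * poly (pderiv (pderiv P)) y) (at y)"
    using y by (auto intro!: derivative_eq_intros)
  from this open_greaterThan[of 0]
  have "((\<lambda>z. z powr (\<nu> + 1) * deriv f z) has_field_derivative
      (\<nu> + 1) * y powr \<nu> * poly (pderiv P) y + y powr (\<nu> + 1) * poly (pderiv (pderiv P)) y) (at y)"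
    by (rule has_field_derivative_transform_within_open) (use y d in auto)
  hence "poly_op \<nu> f y = y powr (- \<nu>) * ((\<nu> + 1) * y powr \<nu> * poly (pderiv P) y 
      + y powr (\<nu> + 1) * poly (pderiv (pderiv P)) y)"
    by (simp add: poly_op_def DERIV_imp_deriv)
  also have "\<dots> = (y powr (- \<nu>) * y powr \<nu>) * ((\<nu> + 1) * poly (pderiv P) y)
      + (y powr (- \<nu>) * y powr (\<nu> + 1)) * poly (pderiv (pderiv P)) y"
    by (simp add: algebra_simps)
  also have "y powr (- \<nu>) * y powr \<nu> = 1" using y by (simp add: powr_add[symmetric])
  also have "y powr (- \<nu>) * y powr (\<nu> + 1) = y" using y by (simp add: powr_add[symmetric])
  finally show ?thesis by (simp add: bessel_op_def)
qed

lemma bessel_op_monom: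
  "bessel_op s (monom c m) = monom (c * real m * (s + real m - 1)) (m - 1)"
proof (cases m)
  case 0 thus ?thesis by (simp add: bessel_op_def pderiv_monom)
next
  case (Suc j)
  show ?thesis
  proof (cases j)
    case 0 thus ?thesis using Suc by (simp add: bessel_op_def pderiv_monom smult_monom monom_0 pderiv_pCons)
  next
    case (Suc i)
    thus ?thesis using \<open>m = Suc j\<close>
      by (simp add: bessel_op_def pderiv_monom smult_monom monom_Suc[symmetric] add_monom del: of_nat_Suc)
         (simp add: algebra_simps)
  qed
qed

text \<open>
  Each application of \<open>D\<close> lowers the degree by one and contributes \<open>m (m + s - 1)\<close>; the product of
  these factors is a quotient of factorials and Pochhammer symbols.
\<close>

lemma bessel_op_pow_monom:
  assumes "s > 0"
  shows "(bessel_op s ^^ i) (monom 1 m) = (if i \<le> m then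
    monom (fact m * pochhammer s m / (fact (m - i) * pochhammer s (m - i))) (m - i) else 0)"
proof (induction i)
  case 0
  have "pochhammer s m \<noteq> 0" using pochhammer_pos[OF assms] by (metis less_irrefl)
  thus ?case by simp
next
  case (Suc i)
  show ?case
  proof (cases "Suc i \<le> m")
    case True
    then obtain j where j: "m - i = Suc j" "m - Suc i = j" by (metis Suc_diff_Suc Suc_le_lessD)
    have "pochhammer s j > 0" by (rule pochhammer_pos[OF assms])
    moreover have "s + real j > 0" using assms by simp
    ultimately show ?thesis using True Suc j
      by (simp add: bessel_op_monom pochhammer_Suc divide_simps del: of_nat_Suc)
  next
    case False
    show ?thesis
    proof (cases "i = m")
      case True thus ?thesis using Suc by (simp add: bessel_op_monom)
    qed (use Suc False in auto)
  qed
qed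

lemma bessel_op_pow_eq_0:
  assumes "s > 0" "degree P < k"
  shows "(bessel_op s ^^ k) P = 0"
proof -
  have "P = (\<Sum>i\<le>degree P. smult (coeff P i) (monom 1 i))"
    using poly_as_sum_of_monoms[of P] by (simp add: smult_monom)
  hence "(bessel_op s ^^ k) P = (\<Sum>i\<le>degree P. smult (coeff P i) ((bessel_op s ^^ k) (monom 1 i)))"
    by (metis (no_types, lifting) bessel_op_pow_sum bessel_op_pow_smult sum.cong)
  also have "\<dots> = 0" using assms by (intro sum.neutral) (auto simp: bessel_op_pow_monom)
  finally show ?thesis .
qed

text \<open>
  A formal power series in \<open>D\<close>, cut off at order \<open>n\<close>. On polynomials of degree below \<open>n\<close> the
  truncation loses nothing, because \<open>D\<^sup>n\<close> annihilates them.
\<close>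

definition bessel_op_series :: "real \<Rightarrow> nat \<Rightarrow> (nat \<Rightarrow> real) \<Rightarrow> real poly \<Rightarrow> real poly" where
  "bessel_op_series s n c P = (\<Sum>k<n. smult (c k) ((bessel_op s ^^ k) P))"

lemma bessel_op_series_smult: "bessel_op_series s n c (smult a P) = smult a (bessel_op_series s n c P)"
  unfolding bessel_op_series_def smult_sum2 by (simp add: bessel_op_pow_smult mult.commute)

lemma bessel_op_series_sum: "bessel_op_series s n c (\<Sum>i\<in>A. f i) = (\<Sum>i\<in>A. bessel_op_series s n c (f i))"
  unfolding bessel_op_series_def by (subst sum.swap) (simp add: bessel_op_pow_sum smult_sum2)

lemma degree_bessel_op: "degree (bessel_op s P) \<le> degree P"
proof -
  have "degree (pderiv P) \<le> degree P" by (simp add: degree_pderiv)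
  moreover have "degree (pCons 0 (pderiv (pderiv P))) \<le> degree P"
    by (cases "pderiv (pderiv P) = 0")
       (auto simp: degree_pderiv pderiv_eq_0_iff)
  ultimately show ?thesis unfolding bessel_op_def
    by (intro degree_add_le) (auto intro: le_trans[OF degree_smult_le])
qed

lemma degree_bessel_op_series: "degree (bessel_op_series s n c P) \<le> degree P"
proof -
  have "degree ((bessel_op s ^^ k) P) \<le> degree P" for k
    by (induction k) (auto intro: le_trans[OF degree_bessel_op])
  thus ?thesis unfolding bessel_op_series_def
    by (intro degree_sum_le) (auto intro: le_trans[OF degree_smult_le])
qed

text \<open>
  Series in \<open>D\<close> compose like formal power series: the product has the Cauchy product as
  coefficients, and the terms of total order at least \<open>n\<close> vanish by nilpotency.
\<close>

lemma bessel_op_series_inverse: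
  assumes s: "s > 0" and P: "degree P < n"
    and ab: "\<And>k. k < n \<Longrightarrow> (\<Sum>i\<le>k. a i * b (k - i)) = (if k = 0 then 1 else 0)"
  shows "bessel_op_series s n a (bessel_op_series s n b P) = P"
proof -
  define t where "t i j = smult (a i * b j) ((bessel_op s ^^ (i + j)) P)" for i j
  have "bessel_op_series s n a (bessel_op_series s n b P) = (\<Sum>i<n. \<Sum>j<n. t i j)"
    by (simp add: bessel_op_series_def bessel_op_pow_sum bessel_op_pow_smult smult_sum2 t_def funpow_add)
  also have "\<dots> = (\<Sum>i<n. \<Sum>j<n-i. t i j)"
  proof (rule sum.cong[OF refl], rule sum.mono_neutral_right)
    fix i assume "i \<in> {..<n}"
    show "\<forall>j\<in>{..<n} - {..<n-i}. t i j = 0"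
      using P by (auto simp: t_def bessel_op_pow_eq_0[OF s])
  qed auto
  also have "\<dots> = (\<Sum>(i, j)\<in>{(i, j). i + j < n}. t i j)"
    by (subst sum.Sigma) (auto intro!: sum.cong)
  also have "\<dots> = (\<Sum>k<n. \<Sum>i\<le>k. t i (k - i))"
    by (rule sum.triangle_reindex)
  also have "\<dots> = (\<Sum>k<n. smult (if k = 0 then 1 else 0) ((bessel_op s ^^ k) P))"
    by (intro sum.cong refl) (simp add: t_def ab[symmetric] smult_sum)
  also have "\<dots> = P" using P by (subst sum.remove[of _ 0]) auto
  finally show ?thesis .
qed

section \<open>Averages of powers over the angular variable\<close>

text \<open>
  The Chu-Vandermonde identity. Reflecting the falling factorials and the quotient
  \<open>(s)\<^sub>i / (s)\<^sub>k\<close> into rising factorials at negated arguments reduces it to the binomial theorem for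
  rising factorials.
\<close>

lemma chu_vandermonde_pochhammer:
  fixes s :: real
  assumes s: "s > 0" and i: "i \<le> m"
  shows "(\<Sum>k\<le>m. real (i choose k) * real (m - i choose k) * fact k / pochhammer s k)
     = pochhammer s m / (pochhammer s i * pochhammer s (m - i))"
proof -
  define b where "b = m - i"
  have pos: "pochhammer s k > 0" for k by (rule pochhammer_pos[OF s])
  have nz: "pochhammer s k \<noteq> 0" for k using pos[of k] by simp
  have "(\<Sum>k\<le>m. real (i choose k) * real (b choose k) * fact k / pochhammer s k) =
      (\<Sum>k\<le>i. real (i choose k) * real (b choose k) * fact k / pochhammer s k)"
    using i by (intro sum.mono_neutral_right) auto
  also have "\<dots> = (\<Sum>k\<le>i. real (i choose k) * ((- 1) ^ k * pochhammer (- real b) k) 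
      * ((-1) ^ (i - k) * pochhammer (1 - s - real i) (i - k)) / pochhammer s i)"
  proof (intro sum.cong refl)
    fix k assume k: "k \<in> {..i}"
    have 1: "real (b choose k) * fact k = (- 1) ^ k * pochhammer (- real b) k"
      using gbinomial_pochhammer[of "real b" k] by (simp add: binomial_gbinomial)
    have "pochhammer (- (s + real i - 1)) (i - k) = (- 1) ^ (i - k) * pochhammer ((s + real i - 1) - real (i - k) + 1) (i - k)"
      by (rule pochhammer_minus)
    also have "(s + real i - 1) - real (i - k) + 1 = s + real k" using k by (simp add: of_nat_diff)
    also have "- (s + real i - 1) = 1 - s - real i" by simp
    finally have 2: "(-1) ^ (i - k) * pochhammer (1 - s - real i) (i - k) = pochhammer (s + real k) (i - k)"
      by simp
    have 3: "pochhammer s i = pochhammer s k * pochhammer (s + real k) (i - k)"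
      using k by (intro pochhammer_product) auto
    have 4: "pochhammer (s + real k) (i - k) \<noteq> 0" using 3 nz[of i] by auto
    show "real (i choose k) * real (b choose k) * fact k / pochhammer s k = 
      real (i choose k) * ((- 1) ^ k * pochhammer (- real b) k) 
      * ((-1) ^ (i - k) * pochhammer (1 - s - real i) (i - k)) / pochhammer s i"
      unfolding 1[symmetric] 2 3 using 4 nz[of k] by simp
  qed
  also have "\<dots> = (\<Sum>k\<le>i. (- 1) ^ i * (real (i choose k) * pochhammer (- real b) k 
      * pochhammer (1 - s - real i) (i - k)) / pochhammer s i)"
  proof (intro sum.cong refl)
    fix k assume "k \<in> {..i}"
    hence "(- 1 :: real) ^ i = (- 1) ^ k * (- 1) ^ (i - k)" by (simp add: power_add[symmetric])
    thus "real (i choose k) * ((- 1) ^ k * pochhammer (- real b) k) 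
      * ((-1) ^ (i - k) * pochhammer (1 - s - real i) (i - k)) / pochhammer s i =
      (- 1) ^ i * (real (i choose k) * pochhammer (- real b) k 
      * pochhammer (1 - s - real i) (i - k)) / pochhammer s i" by (simp add: mult_ac)
  qed
  also have "\<dots> = (- 1) ^ i * pochhammer (- real b + (1 - s - real i)) i / pochhammer s i"
    by (subst pochhammer_binomial_sum) (simp add: sum_distrib_left sum_divide_distrib)
  also have "pochhammer (- real b + (1 - s - real i)) i = (- 1) ^ i * pochhammer (s + real b) i"
    using pochhammer_minus[of "s + real b + real i - 1" i] by (simp add: algebra_simps)
  also have "(- 1) ^ i * ((- 1) ^ i * pochhammer (s + real b) i) = pochhammer (s + real b) i"
    by simp
  also have "pochhammer (s + real b) i = pochhammer s m / pochhammer s b"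
    using pochhammer_product'[of s b i] i nz[of b] by (simp add: b_def)
  finally show ?thesis by (simp add: b_def mult.commute)
qed

text \<open>
  The \<open>j\<close>-th moment of the probability density proportional to \<open>(1 - t\<^sup>2)\<^sup>s\<^sup>-\<^sup>3\<^sup>/\<^sup>2\<close> on \<open>[-1, 1]\<close>. At
  \<open>s = 1/2\<close> these numbers are the moments of the two point measure at \<open>1\<close> and \<open>- 1\<close>, the limiting
  case of that density.
\<close>

definition average_moment :: "real \<Rightarrow> nat \<Rightarrow> real" where
  "average_moment s j = (if even j then pochhammer (1 / 2) (j div 2) / pochhammer s (j div 2) else 0)"

text \<open>
  The coefficient of \<open>y\<^sup>i u\<^sup>m\<^sup>-\<^sup>i\<close> in the averaged \<open>m\<close>-th power. Equivalently, \<open>1 / ((s)\<^sub>i i!)\<close> times the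
  factor by which \<open>D\<^sup>i\<close> multiplies \<open>u\<^sup>m\<close> on its way to \<open>u\<^sup>m\<^sup>-\<^sup>i\<close>.
\<close>

definition translation_coeff :: "real \<Rightarrow> nat \<Rightarrow> nat \<Rightarrow> real" where
  "translation_coeff s m i = fact m * pochhammer s m /
     ((fact (m - i) * pochhammer s (m - i)) * (fact i * pochhammer s i))"

lemma sum_even_reindex:
  fixes f :: "nat \<Rightarrow> real"
  assumes "\<And>j. odd j \<Longrightarrow> f j = 0" "\<And>j. j > m \<Longrightarrow> f j = 0"
  shows "(\<Sum>j\<le>m. f j) = (\<Sum>k\<le>m. f (2 * k))"
proof -
  have "(\<Sum>k\<le>m. f (2 * k)) = (\<Sum>j\<in>(\<lambda>k. 2 * k) ` {..m}. f j)"
    by (subst sum.reindex) (auto simp: inj_on_def)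
  also have "\<dots> = (\<Sum>j\<le>2*m. f j)"
  proof (rule sum.mono_neutral_left)
    show "\<forall>i\<in>{..2 * m} - (\<lambda>k. 2 * k) ` {..m}. f i = 0"
    proof
      fix i assume i: "i \<in> {..2 * m} - (\<lambda>k. 2 * k) ` {..m}"
      have "odd i" using i by (auto elim!: evenE)
      thus "f i = 0" by (rule assms)
    qed
  qed auto
  also have "\<dots> = (\<Sum>j\<le>m. f j)"
    using assms(2) by (intro sum.mono_neutral_right) auto
  finally show ?thesis ..
qed

lemma double_fact: "4 ^ k * pochhammer (1 / 2) k = (fact (2 * k) / fact k :: real)"
  using fact_double[of k, where ?'a = real] by (simp add: power_mult)

text \<open>
  The average of \<open>(u + y + 2 r t)\<^sup>m\<close> over the angular variable \<open>t\<close>, where \<open>r\<^sup>2 = u y\<close>. Only even powers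
  of \<open>t\<close> survive, so the result is a polynomial in \<open>u\<close> and \<open>y\<close>; after expanding the powers of \<open>u + y\<close>
  its coefficients are the sums evaluated by the Chu-Vandermonde identity.
\<close>

lemma average_expansion:
  fixes s u y r :: real
  assumes s: "s > 0" and r: "r\<^sup>2 = u * y"
  shows "(\<Sum>j\<le>m. real (m choose j) * (u + y) ^ (m - j) * (2 * r) ^ j * average_moment s j)
     = (\<Sum>i\<le>m. translation_coeff s m i * y ^ i * u ^ (m - i))"
proof -
  have nz: "pochhammer s k \<noteq> 0" for k using pochhammer_pos[OF s, of k] by simp
  define T where "T i k = real (m choose i) * real (i choose k) * real (m - i choose k) * 
      fact k / pochhammer s k * y ^ i * u ^ (m - i)" for i k
  have "(\<Sum>j\<le>m. real (m choose j) * (u + y) ^ (m - j) * (2 * r) ^ j * average_moment s j) = 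
        (\<Sum>k\<le>m. real (m choose (2 * k)) * (u + y) ^ (m - 2 * k) * (2 * r) ^ (2 * k) * average_moment s (2 * k))"
    by (rule sum_even_reindex) (auto simp: average_moment_def)
  also have "\<dots> = (\<Sum>k\<le>m. \<Sum>i\<le>m. T i k)"
  proof (intro sum.cong refl)
    fix k assume "k \<in> {..m}"
    show "real (m choose (2 * k)) * (u + y) ^ (m - 2 * k) * (2 * r) ^ (2 * k) * average_moment s (2 * k) = (\<Sum>i\<le>m. T i k)"
    proof (cases "2 * k \<le> m")
      case False
      have "T i k = 0" if "i \<le> m" for i
        using that False by (cases "i < k") (auto simp: T_def)
      thus ?thesis using False by simp
    next
      case True
      have "(\<Sum>i\<le>m. T i k) = (\<Sum>i\<in>{k..m - k}. T i k)"
      proof (rule sum.mono_neutral_right)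
        show "\<forall>i\<in>{..m} - {k..m-k}. T i k = 0"
        proof
          fix i assume "i \<in> {..m} - {k..m-k}"
          hence "i < k \<or> m - i < k" by auto
          thus "T i k = 0" by (auto simp: T_def)
        qed
      qed auto
      also have "\<dots> = (\<Sum>l\<le>m - 2 * k. T (l + k) k)"
      proof (rule sum.reindex_bij_witness[of _ "\<lambda>l. l + k" "\<lambda>i. i - k"])
      qed (use True in auto)
      also have "\<dots> = (\<Sum>l\<le>m - 2 * k. (fact m / fact (m - 2 * k) / fact k / pochhammer s k) * (u * y) ^ k *
           (real (m - 2 * k choose l) * y ^ l * u ^ (m - 2 * k - l)))"
      proof (intro sum.cong refl)
        fix l assume l: "l \<in> {..m - 2 * k}"
        have e: "m - (l + k + k) = m - 2 * k - l" "m - (l + k) - k = m - 2 * k - l" "m - (l + k) = k + (m - 2 * k - l)"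
          using l True by auto
        have "real (m choose (l + k)) * real (l + k choose k) * real (m - (l + k) choose k) * fact k
            = fact m / (fact l * fact k * fact (m - 2 * k - l))"
        proof -
          have 1: "real (m choose (l + k)) = fact m / (fact (l + k) * fact (m - (l + k)))"
            using l True by (intro binomial_fact) auto
          have 2: "real (l + k choose k) = fact (l + k) / (fact k * fact l)"
            by (subst binomial_fact) auto
          have 3: "real (m - (l + k) choose k) = fact (m - (l + k)) / (fact k * fact (m - 2 * k - l))"
            using l True by (subst binomial_fact) (auto simp: e(1,2))
          show ?thesis unfolding 1 2 3 by simp
        qed
        note c1 = this
        have c2: "real (m - 2 * k choose l) = fact (m - 2 * k) / (fact l * fact (m - 2 * k - l))"
          using l by (intro binomial_fact) auto
        have c3: "y ^ (l + k) * u ^ (m - (l + k)) = (u * y) ^ k * (y ^ l * u ^ (m - 2 * k - l))"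
          unfolding e(3) by (simp add: power_add power_mult_distrib mult_ac)
        have "T (l + k) k = real (m choose (l + k)) * real (l + k choose k) * real (m - (l + k) choose k) * fact k
            / pochhammer s k * (y ^ (l + k) * u ^ (m - (l + k)))" by (simp add: T_def)
        also note c1
        also note c3
        finally show "T (l + k) k = (fact m / fact (m - 2 * k) / fact k / pochhammer s k) * (u * y) ^ k *
           (real (m - 2 * k choose l) * y ^ l * u ^ (m - 2 * k - l))"
          unfolding c2 by simp
      qed
      also have "\<dots> = (fact m / fact (m - 2 * k) / fact k / pochhammer s k) * (u * y) ^ k * (y + u) ^ (m - 2 * k)"
        by (subst binomial_ring) (simp add: sum_distrib_left)
      also have "\<dots> = real (m choose (2 * k)) * (u + y) ^ (m - 2 * k) * (2 * r) ^ (2 * k) * average_moment s (2 * k)"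
      proof -
        have "(2 * r) ^ (2 * k) * average_moment s (2 * k) = (4 ^ k * pochhammer (1 / 2) k) * (u * y) ^ k / pochhammer s k"
          by (simp add: average_moment_def power_mult power_mult_distrib r)
        also have "\<dots> = (fact (2 * k) / fact k) * (u * y) ^ k / pochhammer s k"
          unfolding double_fact ..
        finally have x: "(2 * r) ^ (2 * k) * average_moment s (2 * k) = (fact (2 * k) / fact k) * (u * y) ^ k / pochhammer s k" .
        have b: "real (m choose (2 * k)) = fact m / (fact (2 * k) * fact (m - 2 * k))"
          using True by (intro binomial_fact) auto
        show ?thesis unfolding mult.assoc x b by (simp add: add.commute mult_ac)
      qed
      finally show ?thesis ..
    qed
  qed
  also have "\<dots> = (\<Sum>i\<le>m. \<Sum>k\<le>m. T i k)" by (rule sum.swap)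
  also have "\<dots> = (\<Sum>i\<le>m. translation_coeff s m i * y ^ i * u ^ (m - i))"
  proof (intro sum.cong refl)
    fix i assume i: "i \<in> {..m}"
    have "(\<Sum>k\<le>m. T i k) = real (m choose i) * 
      (\<Sum>k\<le>m. real (i choose k) * real (m - i choose k) * fact k / pochhammer s k) * y ^ i * u ^ (m - i)"
      by (simp add: T_def sum_distrib_left sum_distrib_right mult.assoc)
    also have "\<dots> = real (m choose i) * (pochhammer s m / (pochhammer s i * pochhammer s (m - i))) * y ^ i * u ^ (m - i)"
      using i by (subst chu_vandermonde_pochhammer[OF s]) auto
    also have "real (m choose i) = fact m / (fact i * fact (m - i))"
      using i by (intro binomial_fact) auto
    finally show "(\<Sum>k\<le>m. T i k) = translation_coeff s m i * y ^ i * u ^ (m - i)"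
      by (simp add: translation_coeff_def mult_ac)
  qed
  finally show ?thesis .
qed

section \<open>Square substitution and the Gegenbauer weight\<close>

text \<open>
  The substitution \<open>y = b\<^sup>2\<close>, with \<open>b\<close> ranging over the whole line: the two signs of \<open>b\<close> absorb the
  factor \<open>2\<close> of \<open>dy = 2 b db\<close>.
\<close>

lemma nn_integral_square:
  fixes f :: "real \<Rightarrow> real"
  assumes [measurable]: "f \<in> borel_measurable borel" and f: "\<And>x. f x \<ge> 0"
  shows "(\<integral>\<^sup>+b. ennreal (\<bar>b\<bar> * f (b\<^sup>2)) \<partial>lborel) = (\<integral>\<^sup>+y. ennreal (f y) * indicator {0<..} y \<partial>lborel)"
proof -
  have sup: "(\<integral>\<^sup>+y. h y * indicator {0..} y \<partial>lborel) = (SUP n. \<integral>\<^sup>+y. h y * indicator {0..a n} y \<partial>lborel)"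
    if [measurable]: "h \<in> borel_measurable borel" and a: "incseq a" "filterlim a at_top sequentially" 
    for h :: "real \<Rightarrow> ennreal" and a :: "nat \<Rightarrow> real"
  proof -
    have "h y * indicator {0..} y = (SUP n. h y * indicator {0..a n} y)" for y
    proof (cases "y \<ge> 0")
      case True
      obtain n where n: "a n \<ge> y" using a(2) by (auto simp: filterlim_at_top eventually_sequentially)
      show ?thesis
      proof (rule antisym)
        have "h y * indicator {0..} y \<le> h y * indicator {0..a n} y" using True n by simp
        also have "\<dots> \<le> (SUP n. h y * indicator {0..a n} y)" by (rule SUP_upper) simp
        finally show "h y * indicator {0..} y \<le> (SUP n. h y * indicator {0..a n} y)" .
        show "(SUP n. h y * indicator {0..a n} y) \<le> h y * indicator {0..} y"
          by (rule SUP_least) (auto simp: indicator_def)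
      qed
    qed auto
    hence "(\<integral>\<^sup>+y. h y * indicator {0..} y \<partial>lborel) = (\<integral>\<^sup>+y. (SUP n. h y * indicator {0..a n} y) \<partial>lborel)"
      by simp
    also have "\<dots> = (SUP n. \<integral>\<^sup>+y. h y * indicator {0..a n} y \<partial>lborel)"
    proof (rule nn_integral_monotone_convergence_SUP)
      show "incseq (\<lambda>n y. h y * indicator {0..a n} y)"
        using a(1) by (auto simp: incseq_def le_fun_def indicator_def intro: order_trans)
    qed auto
    finally show ?thesis .
  qed
  have sq: "(\<integral>\<^sup>+y. ennreal (f y) * indicator {0..(real n)\<^sup>2} y \<partial>lborel) = 
      (\<integral>\<^sup>+b. ennreal (f (b\<^sup>2) * (2 * b)) * indicator {0..real n} b \<partial>lborel)" for n
  proof -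
    have "(\<integral>\<^sup>+ x. ennreal (f x * indicator {0\<^sup>2..(real n)\<^sup>2} x) \<partial>lborel) = (\<integral>\<^sup>+ x. ennreal (f (x\<^sup>2) * (2 * x) * indicator {0..real n} x) \<partial>lborel)"
      by (rule nn_integral_substitution)
         (auto intro!: derivative_eq_intros continuous_intros simp: set_borel_measurable_def)
    moreover have "(\<integral>\<^sup>+y. ennreal (f y) * indicator {0..(real n)\<^sup>2} y \<partial>lborel) =
        (\<integral>\<^sup>+ x. ennreal (f x * indicator {0\<^sup>2..(real n)\<^sup>2} x) \<partial>lborel)"
      by (intro nn_integral_cong) (auto simp: indicator_def)
    moreover have "(\<integral>\<^sup>+b. ennreal (f (b\<^sup>2) * (2 * b)) * indicator {0..real n} b \<partial>lborel) =
        (\<integral>\<^sup>+ x. ennreal (f (x\<^sup>2) * (2 * x) * indicator {0..real n} x) \<partial>lborel)"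
      by (intro nn_integral_cong) (auto simp: indicator_def)
    ultimately show ?thesis by simp
  qed
  have "(\<integral>\<^sup>+y. ennreal (f y) * indicator {0<..} y \<partial>lborel) = (\<integral>\<^sup>+y. ennreal (f y) * indicator {0..} y \<partial>lborel)"
  proof (rule nn_integral_cong_AE)
    have "AE r in lborel. (r::real) \<noteq> 0" by (rule AE_lborel_singleton)
    thus "AE y in lborel. ennreal (f y) * indicator {0<..} y = ennreal (f y) * indicator {0..} y"
      by eventually_elim (auto simp: indicator_def)
  qed
  also have "\<dots> = (SUP n. \<integral>\<^sup>+y. ennreal (f y) * indicator {0..(real n)\<^sup>2} y \<partial>lborel)"
  proof (rule sup)
    show "incseq (\<lambda>n. (real n)\<^sup>2)" by (auto simp: incseq_def intro!: power_mono)
    show "filterlim (\<lambda>n. (real n)\<^sup>2) at_top sequentially"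
      by (rule filterlim_pow_at_top[OF _ filterlim_real_sequentially]) simp
  qed auto
  also have "\<dots> = (SUP n. \<integral>\<^sup>+b. ennreal (f (b\<^sup>2) * (2 * b)) * indicator {0..real n} b \<partial>lborel)"
    by (simp only: sq)
  also have "\<dots> = (\<integral>\<^sup>+b. ennreal (f (b\<^sup>2) * (2 * b)) * indicator {0..} b \<partial>lborel)"
    by (rule sup[symmetric]) (auto simp: incseq_def filterlim_real_sequentially)
  also have "\<dots> = 2 * (\<integral>\<^sup>+b. ennreal (\<bar>b\<bar> * f (b\<^sup>2)) * indicator {0..} b \<partial>lborel)"
  proof -
    have "ennreal (f (b\<^sup>2) * (2 * b)) * indicator {0..} b = 2 * (ennreal (\<bar>b\<bar> * f (b\<^sup>2)) * indicator {0..} b)" for b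
      using f[of "b\<^sup>2"] by (cases "b \<ge> 0") (auto simp: ennreal_mult' mult_ac)
    thus ?thesis by (simp add: nn_integral_cmult)
  qed
  also have "\<dots> = (\<integral>\<^sup>+b. ennreal (\<bar>b\<bar> * f (b\<^sup>2)) * indicator {0..} b \<partial>lborel)
      + (\<integral>\<^sup>+b. ennreal (\<bar>b\<bar> * f (b\<^sup>2)) * indicator {..0} b \<partial>lborel)"
  proof -
    have "(\<integral>\<^sup>+b. ennreal (\<bar>b\<bar> * f (b\<^sup>2)) * indicator {..0} b \<partial>lborel) = 
      (\<integral>\<^sup>+b. ennreal (\<bar>b\<bar> * f (b\<^sup>2)) * indicator {0..} b \<partial>lborel)"
      by (subst nn_integral_real_affine[where c="-1" and t=0]) (auto simp: indicator_def intro!: nn_integral_cong)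
    thus ?thesis by (simp add: mult_2)
  qed
  also have "\<dots> = (\<integral>\<^sup>+b. ennreal (\<bar>b\<bar> * f (b\<^sup>2)) * indicator {0..} b + ennreal (\<bar>b\<bar> * f (b\<^sup>2)) * indicator {..0} b \<partial>lborel)"
    by (rule nn_integral_add[symmetric]) auto
  also have "\<dots> = (\<integral>\<^sup>+b. ennreal (\<bar>b\<bar> * f (b\<^sup>2)) \<partial>lborel)"
    by (intro nn_integral_cong) (auto simp: indicator_def)
  finally show ?thesis ..
qed

text \<open>
  As an identity of measures the substitution applies to Bochner integrals without an
  integrability hypothesis.
\<close>

lemma distr_square_lborel:
  "distr (density lborel (\<lambda>b. ennreal \<bar>b\<bar>)) borel (\<lambda>b. b\<^sup>2) = density lborel (\<lambda>y. ennreal (indicat_real {0<..} y))"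
proof (rule measure_eqI)
  fix A assume "A \<in> sets (distr (density lborel (\<lambda>b. ennreal \<bar>b::real\<bar>)) borel (\<lambda>b. b\<^sup>2))"
  hence [measurable]: "A \<in> sets borel" by simp
  have [measurable]: "(\<lambda>b::real. b\<^sup>2) -` A \<in> sets borel"
    by (rule measurable_sets_borel[of _ borel]) auto
  have "emeasure (distr (density lborel (\<lambda>b. ennreal \<bar>b\<bar>)) borel (\<lambda>b. b\<^sup>2)) A =
      (\<integral>\<^sup>+b. ennreal \<bar>b\<bar> * indicator ((\<lambda>b. b\<^sup>2) -` A) b \<partial>lborel)"
    by (simp add: emeasure_distr emeasure_density)
  also have "\<dots> = (\<integral>\<^sup>+b. ennreal (\<bar>b\<bar> * indicator A (b\<^sup>2)) \<partial>lborel)"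
    by (intro nn_integral_cong) (auto simp: indicator_def)
  also have "\<dots> = (\<integral>\<^sup>+y. ennreal (indicator A y) * indicator {0<..} y \<partial>lborel)"
    by (rule nn_integral_square) auto
  also have "\<dots> = emeasure (density lborel (\<lambda>y. ennreal (indicat_real {0<..} y))) A"
    by (subst emeasure_density) (auto simp: indicator_def intro!: nn_integral_cong)
  finally show "emeasure (distr (density lborel (\<lambda>b. ennreal \<bar>b\<bar>)) borel (\<lambda>b. b\<^sup>2)) A = 
      emeasure (density lborel (\<lambda>y. ennreal (indicat_real {0<..} y))) A" .
qed simp

lemma has_bochner_integral_square:
  fixes f :: "real \<Rightarrow> real"
  assumes [measurable]: "f \<in> borel_measurable borel"
  shows "has_bochner_integral lborel (\<lambda>b. \<bar>b\<bar> * f (b\<^sup>2)) I \<longleftrightarrow> has_bochner_integral lborel (\<lambda>y. indicat_real {0<..} y * f y) I"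
    and "(\<integral>b. \<bar>b\<bar> * f (b\<^sup>2) \<partial>lborel) = (\<integral>y. indicat_real {0<..} y * f y \<partial>lborel)"
    and "integrable lborel (\<lambda>b. \<bar>b\<bar> * f (b\<^sup>2)) \<longleftrightarrow> integrable lborel (\<lambda>y. indicat_real {0<..} y * f y)"
proof -
  have 1: "(\<integral>b. \<bar>b\<bar> * f (b\<^sup>2) \<partial>lborel) = (\<integral>y. f y \<partial>distr (density lborel (\<lambda>b. ennreal \<bar>b\<bar>)) borel (\<lambda>b. b\<^sup>2))"
    by (simp add: integral_distr integral_density)
  have 2: "integrable lborel (\<lambda>b. \<bar>b\<bar> * f (b\<^sup>2)) \<longleftrightarrow> integrable (distr (density lborel (\<lambda>b. ennreal \<bar>b\<bar>)) borel (\<lambda>b. b\<^sup>2)) f"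
    by (simp add: integrable_distr_eq integrable_density)
  show a: "(\<integral>b. \<bar>b\<bar> * f (b\<^sup>2) \<partial>lborel) = (\<integral>y. indicat_real {0<..} y * f y \<partial>lborel)"
    unfolding 1 distr_square_lborel by (simp add: integral_density)
  show b: "integrable lborel (\<lambda>b. \<bar>b\<bar> * f (b\<^sup>2)) \<longleftrightarrow> integrable lborel (\<lambda>y. indicat_real {0<..} y * f y)"
    unfolding 2 distr_square_lborel by (simp add: integrable_density)
  show "has_bochner_integral lborel (\<lambda>b. \<bar>b\<bar> * f (b\<^sup>2)) I \<longleftrightarrow> has_bochner_integral lborel (\<lambda>y. indicat_real {0<..} y * f y) I"
    unfolding has_bochner_integral_iff a b ..
qed

definition gegenbauer_const :: "real \<Rightarrow> real" where
  "gegenbauer_const \<nu> = Gamma (\<nu> + 1) / (sqrt pi * Gamma (\<nu> + 1 / 2))"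

text \<open>
  The density of the angular variable \<open>t\<close>, the cosine of the angle between two vectors. At the
  endpoints it vanishes, since \<open>0 powr a = 0\<close> also for negative \<open>a\<close>.
\<close>

definition gegenbauer :: "real \<Rightarrow> real \<Rightarrow> real" where
  "gegenbauer \<nu> t = gegenbauer_const \<nu> * (indicat_real {-1..1} t * (1 - t\<^sup>2) powr (\<nu> - 1 / 2))"

lemma gegenbauer_measurable [measurable]: "gegenbauer \<nu> \<in> borel_measurable borel"
  unfolding gegenbauer_def[abs_def] by measurable

lemma gegenbauer_const_pos: "\<nu> > - 1 / 2 \<Longrightarrow> gegenbauer_const \<nu> > 0"
  by (simp add: gegenbauer_const_def)

lemma gegenbauer_nonneg: "\<nu> > - 1 / 2 \<Longrightarrow> gegenbauer \<nu> t \<ge> 0"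
  using gegenbauer_const_pos[of \<nu>] by (simp add: gegenbauer_def)

text \<open>
  With \<open>y = t\<^sup>2\<close> the integral becomes the Beta integral with parameters \<open>k + 1/2\<close> and \<open>\<nu> + 1/2\<close>.
\<close>

lemma gegenbauer_even_moment:
  assumes \<nu>: "\<nu> > - 1 / 2"
  shows "has_bochner_integral lborel (\<lambda>t. gegenbauer \<nu> t * t ^ (2 * k)) (average_moment (\<nu> + 1) (2 * k))"
proof -
  let ?a = "real k + 1 / 2" and ?b = "\<nu> + 1 / 2"
  define \<phi> where "\<phi> y = indicat_real {0..1} y * (y powr (?a - 1) * (1 - y) powr (?b - 1))" for y
  have [measurable]: "\<phi> \<in> borel_measurable borel" unfolding \<phi>_def[abs_def] by measurable
  have int: "set_integrable lborel {0..1} (\<lambda>t. t powr (?a - 1) * (1 - t) powr (?b - 1))"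
    using \<nu> by (intro integrable_Beta) auto
  have "(LINT t:{0..1}|lborel. t powr (?a - 1) * (1 - t) powr (?b - 1)) = Beta ?a ?b"
    using has_integral_Beta_real[of ?a ?b] \<nu>
    by (subst set_borel_integral_eq_integral(2)[OF int]) (auto intro: integral_unique)
  hence "has_bochner_integral lborel \<phi> (Beta ?a ?b)"
    using int unfolding has_bochner_integral_iff set_integrable_def set_lebesgue_integral_def \<phi>_def[abs_def]
    by simp
  hence "has_bochner_integral lborel (\<lambda>y. indicat_real {0<..} y * \<phi> y) (Beta ?a ?b)"
  proof (rule has_bochner_integral_cong_AE[THEN iffD1, rotated 3])
    have "AE r in lborel. (r::real) \<noteq> 0" by (rule AE_lborel_singleton)
    thus "AE y in lborel. \<phi> y = indicat_real {0<..} y * \<phi> y"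
      by eventually_elim (auto simp: indicator_def \<phi>_def)
  qed auto
  hence "has_bochner_integral lborel (\<lambda>b. \<bar>b\<bar> * \<phi> (b\<^sup>2)) (Beta ?a ?b)"
    by (subst has_bochner_integral_square) auto
  hence "has_bochner_integral lborel (\<lambda>b. indicat_real {-1..1} b * (1 - b\<^sup>2) powr (\<nu> - 1 / 2) * b ^ (2 * k)) (Beta ?a ?b)"
  proof (rule has_bochner_integral_cong_AE[THEN iffD1, rotated 3])
    have "AE r in lborel. (r::real) \<noteq> 0" by (rule AE_lborel_singleton)
    thus "AE b in lborel. \<bar>b\<bar> * \<phi> (b\<^sup>2) = indicat_real {-1..1} b * (1 - b\<^sup>2) powr (\<nu> - 1 / 2) * b ^ (2 * k)"
    proof eventually_elim
      case (elim b)
      have "\<bar>b\<bar> * (b\<^sup>2) powr (?a - 1) = b ^ (2 * k)"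
      proof -
        have "\<bar>b\<bar> * (b\<^sup>2) powr (?a - 1) = \<bar>b\<bar> powr 1 * (\<bar>b\<bar> powr 2) powr (?a - 1)"
          using elim by simp
        also have "\<dots> = \<bar>b\<bar> powr (real (2 * k))"
          by (simp only: powr_powr powr_add[symmetric]) (simp add: algebra_simps)
        also have "\<dots> = \<bar>b\<bar> ^ (2 * k)" using elim by (subst powr_realpow) auto
        finally show ?thesis by (simp add: power_even_abs)
      qed
      moreover have "b\<^sup>2 \<in> {0..1} \<longleftrightarrow> b \<in> {-1..1}"
        by (auto simp: abs_square_le_1 abs_le_iff)
      ultimately show ?case by (auto simp: \<phi>_def indicator_def mult_ac)
    qed
  qed auto
  hence "has_bochner_integral lborel (\<lambda>b. gegenbauer_const \<nu> * (indicat_real {-1..1} b * (1 - b\<^sup>2) powr (\<nu> - 1 / 2) * b ^ (2 * k))) 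
     (gegenbauer_const \<nu> * Beta ?a ?b)"
    by (rule has_bochner_integral_mult_right)
  moreover have "gegenbauer_const \<nu> * Beta ?a ?b = average_moment (\<nu> + 1) (2 * k)"
  proof -
    have 1: "pochhammer (1 / 2) k = Gamma (1 / 2 + real k) / Gamma (1 / 2)"
      by (intro pochhammer_Gamma) (auto elim!: nonpos_Ints_cases)
    have 2: "pochhammer (\<nu> + 1) k = Gamma (\<nu> + 1 + real k) / Gamma (\<nu> + 1)"
      using \<nu> by (intro pochhammer_Gamma) (auto elim!: nonpos_Ints_cases)
    have "Gamma (\<nu> + 1 / 2) > 0" "Gamma (\<nu> + 1) > 0" "Gamma (\<nu> + 1 + real k) > 0" using \<nu> by (auto intro: Gamma_real_pos)
    thus ?thesis
      unfolding average_moment_def gegenbauer_const_def Beta_def using 1 2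
      by (simp add: Gamma_one_half_real add_ac)
  qed
  ultimately show ?thesis by (simp add: gegenbauer_def mult_ac)
qed

lemma gegenbauer_moment:
  assumes \<nu>: "\<nu> > - 1 / 2"
  shows "has_bochner_integral lborel (\<lambda>t. gegenbauer \<nu> t * t ^ j) (average_moment (\<nu> + 1) j)"
proof (cases "even j")
  case True thus ?thesis using gegenbauer_even_moment[OF \<nu>, of "j div 2"] by simp
next
  case False
  have int: "integrable lborel (\<lambda>t. gegenbauer \<nu> t * t ^ j)"
  proof (rule Bochner_Integration.integrable_bound)
    show "integrable lborel (gegenbauer \<nu>)"
      using gegenbauer_even_moment[OF \<nu>, of 0] by (simp add: has_bochner_integral_iff)
    show "AE t in lborel. norm (gegenbauer \<nu> t * t ^ j) \<le> norm (gegenbauer \<nu> t)"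
    proof (rule AE_I2)
      fix t :: real
      show "norm (gegenbauer \<nu> t * t ^ j) \<le> norm (gegenbauer \<nu> t)"
      proof (cases "t \<in> {-1..1}")
        case True
        hence "\<bar>t\<bar> ^ j \<le> 1" by (intro power_le_one) auto
        thus ?thesis by (simp add: abs_mult power_abs mult_left_le)
      qed (simp add: gegenbauer_def)
    qed
  qed auto
  have "(\<integral>t. gegenbauer \<nu> t * t ^ j \<partial>lborel) = (\<integral>t. gegenbauer \<nu> (0 + -1 * t) * (0 + -1 * t) ^ j \<partial>lborel)"
    by (subst lborel_integral_real_affine[where c="-1" and t=0]) auto
  also have "\<dots> = (\<integral>t. - (gegenbauer \<nu> t * t ^ j) \<partial>lborel)"
    using False by (intro Bochner_Integration.integral_cong) (auto simp: gegenbauer_def indicator_def)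
  finally have "(\<integral>t. gegenbauer \<nu> t * t ^ j \<partial>lborel) = 0" by simp
  thus ?thesis using int False by (simp add: has_bochner_integral_iff average_moment_def)
qed

lemma gegenbauer_average_power:
  assumes \<nu>: "\<nu> > - 1 / 2" and "u \<ge> 0" "y \<ge> 0"
  shows "has_bochner_integral lborel (\<lambda>t. gegenbauer \<nu> t * (u + y - 2 * sqrt (u * y) * t) ^ m)
     (\<Sum>i\<le>m. translation_coeff (\<nu> + 1) m i * y ^ i * u ^ (m - i))"
proof -
  have "has_bochner_integral lborel (\<lambda>t. \<Sum>j\<le>m. (real (m choose j) * (u + y) ^ (m - j) * (2 * - sqrt (u * y)) ^ j) * (gegenbauer \<nu> t * t ^ j))
     (\<Sum>j\<le>m. (real (m choose j) * (u + y) ^ (m - j) * (2 * - sqrt (u * y)) ^ j) * average_moment (\<nu> + 1) j)"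
    by (intro has_bochner_integral_sum has_bochner_integral_mult_right gegenbauer_moment \<nu>)
  also have "(\<Sum>j\<le>m. (real (m choose j) * (u + y) ^ (m - j) * (2 * - sqrt (u * y)) ^ j) * average_moment (\<nu> + 1) j) =
     (\<Sum>i\<le>m. translation_coeff (\<nu> + 1) m i * y ^ i * u ^ (m - i))"
    using assms by (intro average_expansion) auto
  also have "(\<lambda>t. \<Sum>j\<le>m. (real (m choose j) * (u + y) ^ (m - j) * (2 * - sqrt (u * y)) ^ j) * (gegenbauer \<nu> t * t ^ j)) =
      (\<lambda>t. gegenbauer \<nu> t * (u + y - 2 * sqrt (u * y) * t) ^ m)"
  proof
    fix t
    define c where "c = 2 * - sqrt (u * y)"
    have "(u + y - 2 * sqrt (u * y) * t) ^ m = (c * t + (u + y)) ^ m" by (simp add: c_def algebra_simps)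
    also have "\<dots> = (\<Sum>j\<le>m. real (m choose j) * (c * t) ^ j * (u + y) ^ (m - j))"
      by (rule binomial_ring)
    finally show "(\<Sum>j\<le>m. (real (m choose j) * (u + y) ^ (m - j) * (2 * - sqrt (u * y)) ^ j) * (gegenbauer \<nu> t * t ^ j)) =
      gegenbauer \<nu> t * (u + y - 2 * sqrt (u * y) * t) ^ m"
      unfolding c_def[symmetric] by (simp add: sum_distrib_left power_mult_distrib mult_ac)
  qed
  finally show ?thesis .
qed

section \<open>Moments and commutativity of the convolution for \<open>\<nu> > - 1 / 2\<close>\<close>

text \<open>
  The density of \<open>x = u + y - 2 sqrt(u y) t\<close>, the squared third side of a triangle with squared sides
  \<open>u\<close> and \<open>y\<close>, when the cosine \<open>t\<close> of the enclosed angle has the Gegenbauer density. It is the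
  integral kernel of the convolution with respect to Lebesgue measure in all three variables.
\<close>

definition tri_kernel :: "real \<Rightarrow> real \<Rightarrow> real \<Rightarrow> real \<Rightarrow> real" where
  "tri_kernel \<nu> y u x =
     (if y > 0 \<and> u > 0 then gegenbauer \<nu> ((u + y - x) / (2 * sqrt (u * y))) / (2 * sqrt (u * y)) else 0)"

lemma tri_kernel_measurable [measurable]:
  assumes [measurable]: "f \<in> borel_measurable M" "g \<in> borel_measurable M" "h \<in> borel_measurable M"
  shows "(\<lambda>x. tri_kernel \<nu> (f x) (g x) (h x)) \<in> borel_measurable M"
  unfolding tri_kernel_def by measurable

lemma tri_kernel_commute: "tri_kernel \<nu> y u x = tri_kernel \<nu> u y x"
  by (simp add: tri_kernel_def add.commute mult.commute)

lemma tri_kernel_nonneg: "\<nu> > - 1 / 2 \<Longrightarrow> tri_kernel \<nu> y u x \<ge> 0"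
  by (simp add: tri_kernel_def gegenbauer_nonneg)

lemma gegenbauer_eq_0: "\<bar>t\<bar> \<ge> 1 \<Longrightarrow> gegenbauer \<nu> t = 0"
proof -
  assume "\<bar>t\<bar> \<ge> 1"
  hence "t = 1 \<or> t = -1 \<or> t \<notin> {-1..1}" by auto
  thus ?thesis by (auto simp: gegenbauer_def)
qed

text \<open>
  The triangle inequality: for \<open>x \<le> 0\<close> the corresponding cosine is at least \<open>1\<close>.
\<close>

lemma tri_kernel_eq_0: "x \<le> 0 \<Longrightarrow> tri_kernel \<nu> y u x = 0"
proof -
  assume x: "x \<le> 0"
  show ?thesis
  proof (cases "y > 0 \<and> u > 0")
    case True
    have "2 * sqrt (u * y) \<le> u + y" using arith_geo_mean_sqrt[of u y] True by simp
    hence "1 \<le> (u + y - x) / (2 * sqrt (u * y))" using True x by (simp add: le_divide_eq)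
    thus ?thesis using True by (simp add: tri_kernel_def gegenbauer_eq_0)
  qed (auto simp: tri_kernel_def)
qed

text \<open>
  Clearing denominators isolates \<open>4 a - d\<^sup>2\<close>, which for \<open>a = u y\<close> and \<open>d = u + y - x\<close> is sixteen times
  the squared area of the triangle.
\<close>

lemma gegenbauer_scaled:
  assumes a: "a > 0" 
  shows "gegenbauer \<nu> (d / (2 * sqrt a)) / (2 * sqrt a) = gegenbauer_const \<nu> * 
     (if d\<^sup>2 \<le> 4 * a then (4 * a - d\<^sup>2) powr (\<nu> - 1 / 2) * (4 * a) powr (- \<nu>) else 0)"
proof -
  define q where "q = 2 * sqrt a"
  have q: "q > 0" "q\<^sup>2 = 4 * a" using a by (simp_all add: q_def power_mult_distrib)
  have "d / q \<in> {-1..1} \<longleftrightarrow> \<bar>d / q\<bar> \<le> 1" by (simp only: atLeastAtMost_iff abs_le_iff) linarith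
  also have "\<dots> \<longleftrightarrow> (d / q)\<^sup>2 \<le> 1" by (simp add: abs_square_le_1)
  also have "\<dots> \<longleftrightarrow> d\<^sup>2 \<le> q\<^sup>2" using q(1) by (simp add: power_divide divide_le_eq)
  finally have iff: "d / q \<in> {-1..1} \<longleftrightarrow> d\<^sup>2 \<le> 4 * a" unfolding q(2) .
  show ?thesis
  proof (cases "d\<^sup>2 \<le> 4 * a")
    case False
    hence "gegenbauer \<nu> (d / q) = 0" using iff by (simp add: gegenbauer_def)
    thus ?thesis using False by (simp add: q_def)
  next
    case True
    have e1: "1 - (d / q)\<^sup>2 = (4 * a - d\<^sup>2) / (4 * a)"
      unfolding power_divide q(2) using a by (simp add: field_simps)
    have e2: "1 / q = (4 * a) powr (- 1 / 2)"
    proof -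
      have "q = (4 * a) powr (1 / 2)" using a by (simp add: q_def real_sqrt_mult powr_half_sqrt)
      thus ?thesis using powr_minus_divide[of "4 * a" "1 / 2"] by simp
    qed
    have e3: "gegenbauer \<nu> (d / q) = gegenbauer_const \<nu> * (1 - (d / q)\<^sup>2) powr (\<nu> - 1 / 2)"
      using True iff by (simp add: gegenbauer_def)
    have e4: "((4 * a - d\<^sup>2) / (4 * a)) powr (\<nu> - 1 / 2) = (4 * a - d\<^sup>2) powr (\<nu> - 1 / 2) * (4 * a) powr (- (\<nu> - 1 / 2))"
      unfolding powr_divide powr_minus_divide by simp
    have "gegenbauer \<nu> (d / q) / q = gegenbauer_const \<nu> * ((1 - (d / q)\<^sup>2) powr (\<nu> - 1 / 2) * (1 / q))"
      unfolding e3 by simp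
    also note e1
    also note e2
    also have "((4 * a - d\<^sup>2) / (4 * a)) powr (\<nu> - 1 / 2) * (4 * a) powr (- 1 / 2) = 
       (4 * a - d\<^sup>2) powr (\<nu> - 1 / 2) * ((4 * a) powr (- (\<nu> - 1 / 2)) * (4 * a) powr (- 1 / 2))"
      unfolding e4 by (rule mult.assoc)
    also have "(4 * a) powr (- (\<nu> - 1 / 2)) * (4 * a) powr (- 1 / 2) = (4 * a) powr (- \<nu>)"
      unfolding powr_add[symmetric] by simp
    finally show ?thesis using True by (simp add: q_def)
  qed
qed

text \<open>
  By Heron's formula the area is symmetric in the three sides. Hence the kernel, up to explicit
  powers, does not distinguish the variable that is averaged from the other two; this is the
  translation invariance behind the convolution.
\<close>

lemma tri_kernel_symmetry:
  assumes "x > 0" "y > 0" "u > 0"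
  shows "tri_kernel \<nu> y u x = (x / u) powr \<nu> * tri_kernel \<nu> y x u"
proof -
  have 1: "(u + y - x)\<^sup>2 - 4 * (u * y) = (x + y - u)\<^sup>2 - 4 * (x * y)"
    by (simp add: power2_eq_square algebra_simps)
  have 2: "(u + y - x)\<^sup>2 \<le> 4 * (u * y) \<longleftrightarrow> (x + y - u)\<^sup>2 \<le> 4 * (x * y)" using 1 by linarith
  have 3: "4 * (u * y) - (u + y - x)\<^sup>2 = 4 * (x * y) - (x + y - u)\<^sup>2" using 1 by linarith
  have "(x / u) powr \<nu> * (4 * (x * y)) powr (- \<nu>) = (x / u) powr \<nu> / (4 * (x * y)) powr \<nu>"
    by (simp add: powr_minus_divide)
  also have "\<dots> = ((x / u) / (4 * (x * y))) powr \<nu>"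
    by (simp only: powr_divide[of "x / u" "4 * (x * y)"])
  also have "(x / u) / (4 * (x * y)) = 1 / (4 * (u * y))" using assms by (simp add: field_simps)
  also have "\<dots> powr \<nu> = (4 * (u * y)) powr (- \<nu>)" using assms by (simp add: powr_divide powr_minus_divide)
  finally have 4: "(4 * (u * y)) powr (- \<nu>) = (x / u) powr \<nu> * (4 * (x * y)) powr (- \<nu>)" ..
  show ?thesis
    using assms by (simp add: tri_kernel_def gegenbauer_scaled 2 3 4)
qed

lemma tri_kernel_moment:
  assumes \<nu>: "\<nu> > - 1 / 2" and uy: "u > 0" "y > 0"
  shows "has_bochner_integral lborel (\<lambda>x. tri_kernel \<nu> y u x * x ^ m)
     (\<Sum>i\<le>m. translation_coeff (\<nu> + 1) m i * y ^ i * u ^ (m - i))"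
proof -
  define q where "q = 2 * sqrt (u * y)"
  have q: "q > 0" using uy by (simp add: q_def)
  let ?S = "\<Sum>i\<le>m. translation_coeff (\<nu> + 1) m i * y ^ i * u ^ (m - i)"
  have b: "has_bochner_integral lborel (\<lambda>t. (1 / q) * (gegenbauer \<nu> t * (u + y - q * t) ^ m)) ((1 / q) * ?S)"
    using gegenbauer_average_power[OF \<nu>, of u y m] uy by (intro has_bochner_integral_mult_right) (simp add: q_def mult.assoc)
  have e: "(\<lambda>t. (1 / q) * (gegenbauer \<nu> t * (u + y - q * t) ^ m)) = 
      (\<lambda>t. tri_kernel \<nu> y u ((u + y) + (- q) * t) * ((u + y) + (- q) * t) ^ m)"
  proof
    fix t
    have "tri_kernel \<nu> y u ((u + y) + (- q) * t) = (1 / q) * gegenbauer \<nu> t"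
      using uy q unfolding tri_kernel_def q_def[symmetric] by simp
    thus "(1 / q) * (gegenbauer \<nu> t * (u + y - q * t) ^ m) =
        tri_kernel \<nu> y u ((u + y) + (- q) * t) * ((u + y) + (- q) * t) ^ m" by simp
  qed
  have sc: "(1 / q) * S = S /\<^sub>R \<bar>- q\<bar>" for S using q by (simp add: divide_inverse)
  have "- q \<noteq> 0" using q by simp
  from lborel_has_bochner_integral_real_affine_iff[OF this, of "\<lambda>x. tri_kernel \<nu> y u x * x ^ m" ?S "u + y"]
  show ?thesis using b unfolding e sc[of ?S] by (rule iffD2)
qed

text \<open>
  The substitution \<open>u = x + y - 2 sqrt(x y) t\<close> in the definition of the convolution, followed by the
  symmetry of the kernel.
\<close>

lemma tri_kernel_translation:
  assumes "x > 0" "y > 0"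
  shows "gegenbauer_const \<nu> * x powr \<nu> *
      (LINT t:{-1..1}|lborel. g (x + y - 2 * sqrt (x * y) * t) / (x + y - 2 * sqrt (x * y) * t) powr \<nu> * (1 - t\<^sup>2) powr (\<nu> - 1 / 2))
    = (\<integral>u. indicat_real {0<..} u * g u * tri_kernel \<nu> y u x \<partial>lborel)"
proof -
  define q where "q = 2 * sqrt (x * y)"
  have q: "q > 0" using assms by (simp add: q_def)
  define h where "h u = indicat_real {0<..} u * g u * tri_kernel \<nu> y u x" for u
  have h: "h ((x + y) + (- q) * t) = (1 / q) * (gegenbauer_const \<nu> * x powr \<nu> * (indicat_real {-1..1} t * (g (x + y - q * t) / (x + y - q * t) powr \<nu> * (1 - t\<^sup>2) powr (\<nu> - 1 / 2))))" for t
  proof (cases "\<bar>t\<bar> < 1")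
    case True
    have "q * t < q" using True q by simp
    also have "q \<le> x + y" using arith_geo_mean_sqrt[of x y] assms by (simp add: q_def)
    finally have u: "x + y - q * t > 0" by simp
    have "h ((x + y) + (- q) * t) = g (x + y - q * t) * ((x / (x + y - q * t)) powr \<nu> * tri_kernel \<nu> y x (x + y - q * t))"
      unfolding h_def using u assms tri_kernel_symmetry[of x y "x + y - q * t" \<nu>] by simp
    also have "tri_kernel \<nu> y x (x + y - q * t) = gegenbauer \<nu> t / q"
      using assms q by (simp add: tri_kernel_def q_def[symmetric])
    finally show ?thesis using u assms True by (simp add: gegenbauer_def powr_divide mult_ac)
  next
    case False
    have "h ((x + y) + (- q) * t) = 0"
    proof (cases "x + y - q * t > 0")
      case True
      have "h ((x + y) + (- q) * t) = g (x + y - q * t) * ((x / (x + y - q * t)) powr \<nu> * tri_kernel \<nu> y x (x + y - q * t))"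
        unfolding h_def using True assms tri_kernel_symmetry[of x y "x + y - q * t" \<nu>] by simp
      also have "tri_kernel \<nu> y x (x + y - q * t) = gegenbauer \<nu> t / q"
        using assms q by (simp add: tri_kernel_def q_def[symmetric])
      also have "gegenbauer \<nu> t = 0" using False by (simp add: gegenbauer_eq_0)
      finally show ?thesis by simp
    qed (simp add: h_def)
    moreover have "t = 1 \<or> t = -1 \<or> t \<notin> {-1..1}" using False by auto
    hence "indicat_real {-1..1} t * (1 - t\<^sup>2) powr (\<nu> - 1 / 2) = 0" by auto
    hence "indicat_real {-1..1} t * (g (x + y - q * t) / (x + y - q * t) powr \<nu> * (1 - t\<^sup>2) powr (\<nu> - 1 / 2)) = 0"
      by (metis mult.left_commute mult_zero_right)
    ultimately show ?thesis by (simp only: mult_zero_right)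
  qed
  have "(\<integral>u. h u \<partial>lborel) = q * (\<integral>t. h ((x + y) + (- q) * t) \<partial>lborel)"
    using lborel_integral_real_affine[of "- q" h "x + y"] q by simp
  also have "\<dots> = gegenbauer_const \<nu> * x powr \<nu> * (\<integral>t. indicat_real {-1..1} t * (g (x + y - q * t) / (x + y - q * t) powr \<nu> * (1 - t\<^sup>2) powr (\<nu> - 1 / 2)) \<partial>lborel)"
    unfolding h integral_mult_right_zero using q by simp
  finally show ?thesis by (simp add: h_def q_def set_lebesgue_integral_def)
qed

lemma integrable_pair_product:
  fixes f g :: "real \<Rightarrow> real"
  assumes f: "integrable lborel f" and g: "integrable lborel g"
  shows "integrable (lborel \<Otimes>\<^sub>M lborel) (\<lambda>(x, y). f x * g y)"
    and "(\<integral>p. (case p of (x, y) \<Rightarrow> f x * g y) \<partial>(lborel \<Otimes>\<^sub>M lborel)) = (\<integral>x. f x \<partial>lborel) * (\<integral>y. g y \<partial>lborel)"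
proof -
  have [measurable]: "f \<in> borel_measurable borel" "g \<in> borel_measurable borel" using f g by auto
  show int: "integrable (lborel \<Otimes>\<^sub>M lborel) (\<lambda>(x, y). f x * g y)"
    by (rule lborel_pair.Fubini_integrable) (use f g in \<open>auto simp: abs_mult\<close>)
  show "(\<integral>p. (case p of (x, y) \<Rightarrow> f x * g y) \<partial>(lborel \<Otimes>\<^sub>M lborel)) = (\<integral>x. f x \<partial>lborel) * (\<integral>y. g y \<partial>lborel)"
    using lborel_pair.integral_fst[OF int] by simp
qed

text \<open>
  Integrating the variable \<open>x\<close> first shows absolute integrability on the triple product, as the
  kernel is nonnegative and its moments in \<open>x\<close> are polynomials in \<open>y\<close> and \<open>u\<close>. All statements about the
  convolution follow by integrating in a different order.
\<close>

lemma tri_kernel_fubini: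
  fixes f g :: "real \<Rightarrow> real"
  assumes \<nu>: "\<nu> > - 1 / 2"
    and f: "\<And>k. k \<le> m \<Longrightarrow> integrable lborel (\<lambda>x. f x * x ^ k)" and f0: "\<And>x. x \<le> 0 \<Longrightarrow> f x = 0"
    and g: "\<And>k. k \<le> m \<Longrightarrow> integrable lborel (\<lambda>x. g x * x ^ k)" and g0: "\<And>x. x \<le> 0 \<Longrightarrow> g x = 0"
  defines "\<Phi> \<equiv> \<lambda>(y, u) x. f y * g u * (tri_kernel \<nu> y u x * x ^ m)"
  shows "integrable ((lborel \<Otimes>\<^sub>M lborel) \<Otimes>\<^sub>M lborel) (case_prod \<Phi>)"
    and "(\<integral>p. (\<integral>x. \<Phi> p x \<partial>lborel) \<partial>(lborel \<Otimes>\<^sub>M lborel)) =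
      (\<Sum>i\<le>m. translation_coeff (\<nu> + 1) m i * (\<integral>y. f y * y ^ i \<partial>lborel) * (\<integral>u. g u * u ^ (m - i) \<partial>lborel))"
proof -
  have [measurable]: "f \<in> borel_measurable borel" "g \<in> borel_measurable borel"
    using f[of 0] g[of 0] by auto
  interpret L2: sigma_finite_measure "lborel \<Otimes>\<^sub>M lborel :: (real \<times> real) measure"
    unfolding lborel_prod by (rule lborel.sigma_finite_measure_axioms)
  interpret P: pair_sigma_finite "lborel \<Otimes>\<^sub>M lborel :: (real \<times> real) measure" "lborel :: real measure" ..
  define S where "S y u = (\<Sum>i\<le>m. translation_coeff (\<nu> + 1) m i * y ^ i * u ^ (m - i))" for y u :: real
  have mom: "has_bochner_integral lborel (\<lambda>x. tri_kernel \<nu> y u x * x ^ m) (S y u)" if "u > 0" "y > 0" for y u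
    unfolding S_def by (rule tri_kernel_moment[OF \<nu> that])
  have inner: "has_bochner_integral lborel (\<Phi> (y, u)) (f y * g u * S y u)" for y u
  proof (cases "u > 0 \<and> y > 0")
    case True thus ?thesis unfolding \<Phi>_def using mom by (auto intro: has_bochner_integral_mult_right)
  next
    case False
    hence z: "f y * g u = 0" using f0 g0 by auto
    show ?thesis unfolding \<Phi>_def prod.case z by (simp add: has_bochner_integral_zero)
  qed
  have Snn: "\<bar>f y * g u\<bar> * S y u = \<bar>f y * g u * S y u\<bar>" for y u
  proof (cases "u > 0 \<and> y > 0")
    case True
    have "S y u = (\<integral>x. tri_kernel \<nu> y u x * x ^ m \<partial>lborel)" using mom True by (simp add: has_bochner_integral_iff)
    also have "\<dots> \<ge> 0"
    proof (rule integral_nonneg_AE, rule AE_I2)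
      fix x show "0 \<le> tri_kernel \<nu> y u x * x ^ m"
        using tri_kernel_nonneg[OF \<nu>, of y u x] tri_kernel_eq_0[of x \<nu> y u] by (cases "x \<le> 0") auto
    qed
    finally show ?thesis by (simp add: abs_mult)
  next
    case False
    hence "f y * g u = 0" using f0 g0 by auto
    thus ?thesis by auto
  qed
  have norm: "(\<integral>x. norm (\<Phi> (y, u) x) \<partial>lborel) = \<bar>f y * g u\<bar> * S y u" for y u
  proof (cases "u > 0 \<and> y > 0")
    case True
    have "norm (\<Phi> (y, u) x) = \<bar>f y * g u\<bar> * (tri_kernel \<nu> y u x * x ^ m)" for x
      using tri_kernel_nonneg[OF \<nu>, of y u x] tri_kernel_eq_0[of x \<nu> y u]
      by (cases "x \<le> 0") (auto simp: \<Phi>_def abs_mult)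
    thus ?thesis using mom[of u y] True by (simp add: has_bochner_integral_iff)
  next
    case False
    hence "f y * g u = 0" using f0 g0 by auto
    thus ?thesis by (auto simp: \<Phi>_def)
  qed
  define Q where "Q i = (\<lambda>(y, u). (f y * y ^ i) * (g u * u ^ (m - i)))" for i
  have Q: "integrable (lborel \<Otimes>\<^sub>M lborel) (Q i)" 
    "integral\<^sup>L (lborel \<Otimes>\<^sub>M lborel) (Q i) = (\<integral>y. f y * y ^ i \<partial>lborel) * (\<integral>u. g u * u ^ (m - i) \<partial>lborel)"
    if "i \<le> m" for i
    unfolding Q_def using that by (intro integrable_pair_product f g; simp)+
  have SQ: "(\<lambda>(y, u). f y * g u * S y u) = (\<lambda>p. \<Sum>i\<le>m. translation_coeff (\<nu> + 1) m i * Q i p)"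
    by (auto simp: fun_eq_iff S_def Q_def sum_distrib_left mult_ac)
  have intS: "integrable (lborel \<Otimes>\<^sub>M lborel) (\<lambda>(y, u). f y * g u * S y u)"
    unfolding SQ using Q by (intro Bochner_Integration.integrable_sum integrable_mult_right) auto
  have meas: "case_prod \<Phi> \<in> borel_measurable ((lborel \<Otimes>\<^sub>M lborel) \<Otimes>\<^sub>M lborel)"
    unfolding \<Phi>_def split_beta' by measurable
  show "integrable ((lborel \<Otimes>\<^sub>M lborel) \<Otimes>\<^sub>M lborel) (case_prod \<Phi>)"
  proof (rule P.Fubini_integrable[OF meas])
    have "(\<lambda>p. \<integral>x. norm (case (p, x) of (p, x) \<Rightarrow> \<Phi> p x) \<partial>lborel) = (\<lambda>p. \<bar>case p of (y, u) \<Rightarrow> f y * g u * S y u\<bar>)"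
      using norm Snn by (auto simp: fun_eq_iff)
    thus "integrable (lborel \<Otimes>\<^sub>M lborel) (\<lambda>p. \<integral>x. norm (case (p, x) of (p, x) \<Rightarrow> \<Phi> p x) \<partial>lborel)"
      using intS by simp
    show "AE p in lborel \<Otimes>\<^sub>M lborel. integrable lborel (\<lambda>x. case (p, x) of (p, x) \<Rightarrow> \<Phi> p x)"
      using inner by (auto simp: has_bochner_integral_iff intro!: AE_I2)
  qed
  have "(\<lambda>p. \<integral>x. \<Phi> p x \<partial>lborel) = (\<lambda>(y, u). f y * g u * S y u)"
    using inner by (auto simp: fun_eq_iff has_bochner_integral_iff)
  thus "(\<integral>p. (\<integral>x. \<Phi> p x \<partial>lborel) \<partial>(lborel \<Otimes>\<^sub>M lborel)) =
      (\<Sum>i\<le>m. translation_coeff (\<nu> + 1) m i * (\<integral>y. f y * y ^ i \<partial>lborel) * (\<integral>u. g u * u ^ (m - i) \<partial>lborel))"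
    unfolding SQ using Q by (simp add: Bochner_Integration.integral_sum mult.assoc)
qed

text \<open>
  The generalised translate of \<open>g\<close>: the function against which \<open>f\<close> is integrated to give
  \<open>conv \<nu> f g x\<close>. Naming it treats both cases of the convolution alike.
\<close>

definition translate :: "real \<Rightarrow> (real \<Rightarrow> real) \<Rightarrow> real \<Rightarrow> real \<Rightarrow> real" where
  "translate \<nu> g x y = (if \<nu> = - 1 / 2 then
      1 / (2 * sqrt x) * (\<bar>sqrt y - sqrt x\<bar> * g ((sqrt y - sqrt x)\<^sup>2) + \<bar>sqrt y + sqrt x\<bar> * g ((sqrt y + sqrt x)\<^sup>2))
    else gegenbauer_const \<nu> * x powr \<nu> *
      (LINT t:{-1..1}|lborel. g (x + y - 2 * sqrt (x * y) * t) / (x + y - 2 * sqrt (x * y) * t) powr \<nu> * (1 - t\<^sup>2) powr (\<nu> - 1 / 2)))"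

lemma conv_eq_translate: "conv \<nu> f g x = (LINT y:{0<..}|lborel. f y * translate \<nu> g x y)"
proof -
  have "c * (LINT y:{0<..}|lborel. f y * h y) = (LINT y:{0<..}|lborel. f y * (c * h y))" for c :: real and h
    by (simp add: mult.left_commute[of _ c])
  thus ?thesis unfolding conv_def translate_def gegenbauer_const_def by simp
qed

text \<open>
  The symmetric kernel and absolute convergence of the double integral for almost every \<open>x\<close> give
  commutativity, and integrating against \<open>x\<^sup>m\<close> gives the moments.
\<close>

lemma conv_Fubini_gt:
  fixes f g :: "real \<Rightarrow> real"
  assumes \<nu>: "\<nu> > - 1 / 2"
    and f: "\<And>k. k \<le> m \<Longrightarrow> set_integrable lborel {0<..} (\<lambda>x. x ^ k * f x)"
    and g: "\<And>k. k \<le> m \<Longrightarrow> set_integrable lborel {0<..} (\<lambda>x. x ^ k * g x)"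
  shows "AE x in lborel. x > 0 \<longrightarrow> set_integrable lborel {0<..} (\<lambda>y. f y * translate \<nu> g x y) \<and>
           conv \<nu> f g x = conv \<nu> g f x"
    and "set_integrable lborel {0<..} (\<lambda>x. x ^ m * conv \<nu> f g x)"
    and "(LINT x:{0<..}|lborel. x ^ m * conv \<nu> f g x) =
      (\<Sum>i\<le>m. translation_coeff (\<nu> + 1) m i * (LINT y:{0<..}|lborel. y ^ i * f y) * (LINT y:{0<..}|lborel. y ^ (m - i) * g y))"
proof -
  define F where "F x = indicat_real {0<..} x * f x" for x
  define G where "G x = indicat_real {0<..} x * g x" for x
  have F: "integrable lborel (\<lambda>x. F x * x ^ k)" and G: "integrable lborel (\<lambda>x. G x * x ^ k)" if "k \<le> m" for k
    using f[OF that] g[OF that] by (simp_all add: F_def G_def set_integrable_def mult_ac)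
  have F0: "F x = 0" and G0: "G x = 0" if "x \<le> 0" for x using that by (simp_all add: F_def G_def)
  have [measurable]: "F \<in> borel_measurable borel" "G \<in> borel_measurable borel"
    using F[of 0] G[of 0] by auto
  interpret L2: sigma_finite_measure "lborel \<Otimes>\<^sub>M lborel :: (real \<times> real) measure"
    unfolding lborel_prod by (rule lborel.sigma_finite_measure_axioms)
  interpret P: pair_sigma_finite "lborel \<Otimes>\<^sub>M lborel :: (real \<times> real) measure" "lborel :: real measure" ..
  have shF: "indicat_real {0<..} y * translate \<nu> f x y = indicat_real {0<..} y * (\<integral>u. F u * tri_kernel \<nu> y u x \<partial>lborel)"
    and shG: "indicat_real {0<..} y * translate \<nu> g x y = indicat_real {0<..} y * (\<integral>u. G u * tri_kernel \<nu> y u x \<partial>lborel)"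
    if "x > 0" for x y
    using \<nu> tri_kernel_translation[OF that, of y \<nu> f] tri_kernel_translation[OF that, of y \<nu> g]
    by (auto simp: translate_def F_def G_def indicator_def)
  have convFG: "conv \<nu> f g x = (\<integral>y. F y * (\<integral>u. G u * tri_kernel \<nu> y u x \<partial>lborel) \<partial>lborel)" if "x > 0" for x
    unfolding conv_eq_translate set_lebesgue_integral_def
    by (rule Bochner_Integration.integral_cong) (use shG[OF that] in \<open>auto simp: F_def indicator_def\<close>)
  have convGF: "conv \<nu> g f x = (\<integral>y. G y * (\<integral>u. F u * tri_kernel \<nu> y u x \<partial>lborel) \<partial>lborel)" if "x > 0" for x
    unfolding conv_eq_translate set_lebesgue_integral_def
    by (rule Bochner_Integration.integral_cong) (use shF[OF that] in \<open>auto simp: G_def indicator_def\<close>)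
  define \<Phi> where "\<Phi> m = (\<lambda>(y, u) x. F y * G u * (tri_kernel \<nu> y u x * x ^ m))" for m
  have \<Phi>int: "integrable ((lborel \<Otimes>\<^sub>M lborel) \<Otimes>\<^sub>M lborel) (case_prod (\<Phi> j))" if "j \<le> m" for j
    unfolding \<Phi>_def using that by (intro tri_kernel_fubini \<nu> F G F0 G0) auto
  have AE0: "AE x in lborel. integrable (lborel \<Otimes>\<^sub>M lborel) (\<lambda>p. \<Phi> 0 p x)"
    by (rule P.AE_integrable_snd[OF \<Phi>int]) simp
  have swap: "(\<integral>y. F y * (\<integral>u. G u * tri_kernel \<nu> y u x \<partial>lborel) \<partial>lborel) = (\<integral>p. \<Phi> 0 p x \<partial>(lborel \<Otimes>\<^sub>M lborel))"
    "(\<integral>u. G u * (\<integral>y. F y * tri_kernel \<nu> u y x \<partial>lborel) \<partial>lborel) = (\<integral>p. \<Phi> 0 p x \<partial>(lborel \<Otimes>\<^sub>M lborel))"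
    "integrable lborel (\<lambda>y. F y * (\<integral>u. G u * tri_kernel \<nu> y u x \<partial>lborel))"
    if "integrable (lborel \<Otimes>\<^sub>M lborel) (\<lambda>p. \<Phi> 0 p x)" for x
  proof -
    have i: "integrable (lborel \<Otimes>\<^sub>M lborel) (\<lambda>(y, u). F y * (G u * tri_kernel \<nu> y u x))"
      using that by (simp add: \<Phi>_def split_beta' mult.assoc)
    have e: "(\<integral>p. \<Phi> 0 p x \<partial>(lborel \<Otimes>\<^sub>M lborel)) = (\<integral>p. (case p of (y, u) \<Rightarrow> F y * (G u * tri_kernel \<nu> y u x)) \<partial>(lborel \<Otimes>\<^sub>M lborel))"
      by (simp add: \<Phi>_def split_beta' mult.assoc)
    show "(\<integral>y. F y * (\<integral>u. G u * tri_kernel \<nu> y u x \<partial>lborel) \<partial>lborel) = (\<integral>p. \<Phi> 0 p x \<partial>(lborel \<Otimes>\<^sub>M lborel))"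
      unfolding e using lborel_pair.integral_fst[OF i] by simp
    show "integrable lborel (\<lambda>y. F y * (\<integral>u. G u * tri_kernel \<nu> y u x \<partial>lborel))"
      using lborel_pair.integrable_fst[OF i] by simp
    have "(\<integral>u. (\<integral>y. F y * (G u * tri_kernel \<nu> y u x) \<partial>lborel) \<partial>lborel) = (\<integral>p. \<Phi> 0 p x \<partial>(lborel \<Otimes>\<^sub>M lborel))"
      unfolding e using lborel_pair.integral_snd[OF i] by simp
    thus "(\<integral>u. G u * (\<integral>y. F y * tri_kernel \<nu> u y x \<partial>lborel) \<partial>lborel) = (\<integral>p. \<Phi> 0 p x \<partial>(lborel \<Otimes>\<^sub>M lborel))"
      by (simp add: mult.left_commute[of "F _"] tri_kernel_commute[of \<nu> _ _ x])
  qed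
  show "AE x in lborel. x > 0 \<longrightarrow> set_integrable lborel {0<..} (\<lambda>y. f y * translate \<nu> g x y) \<and>
           conv \<nu> f g x = conv \<nu> g f x"
    using AE0
  proof eventually_elim
    case (elim x)
    show ?case
    proof (intro impI conjI)
      assume x: "x > 0"
      show "conv \<nu> f g x = conv \<nu> g f x" 
        unfolding convFG[OF x] convGF[OF x] using swap(1,2)[OF elim] by simp
      have "(\<lambda>y. indicat_real {0<..} y *\<^sub>R (f y * translate \<nu> g x y)) = (\<lambda>y. F y * (\<integral>u. G u * tri_kernel \<nu> y u x \<partial>lborel))"
        using shG[OF x] by (auto simp: F_def fun_eq_iff indicator_def)
      thus "set_integrable lborel {0<..} (\<lambda>y. f y * translate \<nu> g x y)"
        unfolding set_integrable_def using swap(3)[OF elim] by simp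
    qed
  qed
  define J where "J x = (\<integral>p. \<Phi> m p x \<partial>(lborel \<Otimes>\<^sub>M lborel))" for x
  have J: "integrable lborel J" unfolding J_def[abs_def] by (rule P.integrable_snd[OF \<Phi>int]) simp
  have Jmom: "(\<integral>x. J x \<partial>lborel) = (\<Sum>i\<le>m. translation_coeff (\<nu> + 1) m i * (\<integral>y. F y * y ^ i \<partial>lborel) * (\<integral>u. G u * u ^ (m - i) \<partial>lborel))"
  proof -
    have "(\<integral>x. J x \<partial>lborel) = (\<integral>p. (\<integral>x. \<Phi> m p x \<partial>lborel) \<partial>(lborel \<Otimes>\<^sub>M lborel))"
      unfolding J_def by (rule P.Fubini_integral[OF \<Phi>int]) simp
    also have "\<dots> = (\<Sum>i\<le>m. translation_coeff (\<nu> + 1) m i * (\<integral>y. F y * y ^ i \<partial>lborel) * (\<integral>u. G u * u ^ (m - i) \<partial>lborel))"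
      unfolding \<Phi>_def by (intro tri_kernel_fubini \<nu> F G F0 G0) auto
    finally show ?thesis .
  qed
  \<comment> \<open>The convolution itself has to be Borel measurable; equality almost everywhere with a measurable
      function would not be enough.\<close>
  define c where "c x = indicat_real {0<..} x * (x ^ m * (\<integral>y. F y * (\<integral>u. G u * tri_kernel \<nu> y u x \<partial>lborel) \<partial>lborel))" for x
  have [measurable]: "c \<in> borel_measurable lborel" unfolding c_def[abs_def] by measurable
  have cJ: "AE x in lborel. J x = c x"
    using AE0
  proof eventually_elim
    case (elim x)
    have e: "\<Phi> m p x = x ^ m * \<Phi> 0 p x" for p by (cases p) (simp add: \<Phi>_def mult_ac)
    show ?case
    proof (cases "x > 0")
      case True
      thus ?thesis unfolding J_def c_def e swap(1)[OF elim] by simp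
    next
      case False
      hence "\<Phi> m p x = 0" for p using tri_kernel_eq_0[of x \<nu>] by (cases p) (simp add: \<Phi>_def)
      thus ?thesis using False by (simp add: J_def c_def)
    qed
  qed
  have ceq: "(\<lambda>x. indicat_real {0<..} x *\<^sub>R (x ^ m * conv \<nu> f g x)) = c"
    using convFG by (auto simp: c_def fun_eq_iff indicator_def)
  have "integrable lborel c"
    using integrable_cong_AE[OF _ _ cJ] J by simp
  thus "set_integrable lborel {0<..} (\<lambda>x. x ^ m * conv \<nu> f g x)"
    unfolding set_integrable_def ceq .
  have "(\<integral>x. c x \<partial>lborel) = (\<integral>x. J x \<partial>lborel)"
    using integral_cong_AE[OF _ _ cJ] J by simp
  thus "(LINT x:{0<..}|lborel. x ^ m * conv \<nu> f g x) =
      (\<Sum>i\<le>m. translation_coeff (\<nu> + 1) m i * (LINT y:{0<..}|lborel. y ^ i * f y) * (LINT y:{0<..}|lborel. y ^ (m - i) * g y))"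
    unfolding set_lebesgue_integral_def ceq Jmom by (simp add: F_def G_def mult_ac)
qed

section \<open>Moments and commutativity of the convolution for \<open>\<nu> = - 1 / 2\<close>\<close>

text \<open>
  At \<open>s = 1/2\<close> the duplication formula for factorials makes the coefficients ordinary binomial
  coefficients, matching the even part of \<open>(b + c)\<^sup>2\<^sup>m\<close>.
\<close>

lemma translation_coeff_half: 
  assumes "i \<le> m"
  shows "translation_coeff (1 / 2) m i = real (2 * m choose (2 * i))"
proof -
  have p: "pochhammer (1 / 2 :: real) k = fact (2 * k) / (4 ^ k * fact k)" for k :: nat
    using double_fact[of k] by (simp add: field_simps)
  have e: "2 * (m - i) = 2 * m - 2 * i" by simp
  have f: "(4::real) ^ m = 4 ^ (m - i) * 4 ^ i" using assms by (simp add: power_add[symmetric])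
  have "real (2 * m choose (2 * i)) = fact (2 * m) / (fact (2 * i) * fact (2 * m - 2 * i))"
    using assms by (intro binomial_fact) auto
  thus ?thesis unfolding translation_coeff_def p e f by simp
qed

text \<open>
  In the coordinate \<open>b\<close> with \<open>b\<^sup>2 = y\<close> densities on the half-line become even densities on the line, and
  the convolution for \<open>\<nu> = - 1 / 2\<close> becomes the ordinary convolution.
\<close>

definition fold_even :: "(real \<Rightarrow> real) \<Rightarrow> real \<Rightarrow> real" where
  "fold_even F b = \<bar>b\<bar> * F (b\<^sup>2)"

lemma fold_even_minus [simp]: "fold_even F (- b) = fold_even F b"
  by (simp add: fold_even_def)

lemma fold_even_measurable [measurable]:
  assumes [measurable]: "F \<in> borel_measurable borel"
  shows "fold_even F \<in> borel_measurable borel"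
  unfolding fold_even_def[abs_def] by measurable

lemma fold_even_moments:
  assumes F: "\<And>k. k \<le> m \<Longrightarrow> integrable lborel (\<lambda>x. F x * x ^ k)" and F0: "\<And>x. x \<le> 0 \<Longrightarrow> F x = 0"
  shows "j \<le> 2 * m \<Longrightarrow> integrable lborel (\<lambda>b. fold_even F b * b ^ j)"
    and "k \<le> m \<Longrightarrow> (\<integral>b. fold_even F b * b ^ (2 * k) \<partial>lborel) = (\<integral>x. F x * x ^ k \<partial>lborel)"
    and "odd j \<Longrightarrow> (\<integral>b. fold_even F b * b ^ j \<partial>lborel) = 0"
proof -
  have [measurable]: "F \<in> borel_measurable borel" using F[of 0] by auto
  have F0': "indicat_real {0<..} x * (F x * x ^ k) = F x * x ^ k" for x k
    using F0[of x] by (auto simp: indicator_def)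
  have ev: "fold_even F b * b ^ (2 * k) = \<bar>b\<bar> * (\<lambda>x. F x * x ^ k) (b\<^sup>2)" for b k
    by (simp add: fold_even_def power_mult)
  have even: "integrable lborel (\<lambda>b. fold_even F b * b ^ (2 * k))" if "k \<le> m" for k
    unfolding ev using F[OF that] by (subst has_bochner_integral_square(3)) (simp_all add: F0')
  show "(\<integral>b. fold_even F b * b ^ (2 * k) \<partial>lborel) = (\<integral>x. F x * x ^ k \<partial>lborel)" if "k \<le> m" for k
    unfolding ev by (subst has_bochner_integral_square(2)) (simp_all add: F0')
  show "integrable lborel (\<lambda>b. fold_even F b * b ^ j)" if j: "j \<le> 2 * m" for j
  proof (rule Bochner_Integration.integrable_bound)
    show "integrable lborel (\<lambda>b. \<bar>fold_even F b * b ^ (2 * 0)\<bar> + \<bar>fold_even F b * b ^ (2 * m)\<bar>)"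
      using even[of 0] even[of m] by (intro Bochner_Integration.integrable_add integrable_abs) auto
    show "AE b in lborel. norm (fold_even F b * b ^ j) \<le> norm (\<bar>fold_even F b * b ^ (2 * 0)\<bar> + \<bar>fold_even F b * b ^ (2 * m)\<bar>)"
    proof (rule AE_I2)
      fix b :: real
      have "\<bar>b\<bar> ^ j \<le> 1 + \<bar>b\<bar> ^ (2 * m)"
      proof (cases "\<bar>b\<bar> \<le> 1")
        case True
        hence "\<bar>b\<bar> ^ j \<le> 1" by (intro power_le_one) auto
        thus ?thesis by (simp add: add_increasing2)
      next
        case False
        hence "\<bar>b\<bar> ^ j \<le> \<bar>b\<bar> ^ (2 * m)" using j by (intro power_increasing) auto
        thus ?thesis by simp
      qed
      hence "\<bar>fold_even F b\<bar> * \<bar>b\<bar> ^ j \<le> \<bar>fold_even F b\<bar> * (1 + \<bar>b\<bar> ^ (2 * m))" by (intro mult_left_mono) auto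
      thus "norm (fold_even F b * b ^ j) \<le> norm (\<bar>fold_even F b * b ^ (2 * 0)\<bar> + \<bar>fold_even F b * b ^ (2 * m)\<bar>)"
        by (simp add: abs_mult power_abs distrib_left)
    qed
  qed measurable
  show "(\<integral>b. fold_even F b * b ^ j \<partial>lborel) = 0" if j: "odd j" for j
  proof -
    have "(\<integral>b. fold_even F b * b ^ j \<partial>lborel) = (\<integral>b. fold_even F (0 + - 1 * b) * (0 + - 1 * b) ^ j \<partial>lborel)"
      by (subst lborel_integral_real_affine[where c="- 1" and t=0]) auto
    also have "\<dots> = (\<integral>b. - (fold_even F b * b ^ j) \<partial>lborel)"
      using j by (intro Bochner_Integration.integral_cong) auto
    finally show ?thesis by simp
  qed
qed

text \<open>
  Translation of the inner variable turns \<open>s\<^sup>N\<close> into \<open>(b + c)\<^sup>N\<close>, a finite sum of products.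
\<close>

lemma line_convolution_fubini:
  fixes f g :: "real \<Rightarrow> real"
  assumes f: "\<And>j. j \<le> N \<Longrightarrow> integrable lborel (\<lambda>b. f b * b ^ j)"
    and g: "\<And>j. j \<le> N \<Longrightarrow> integrable lborel (\<lambda>b. g b * b ^ j)"
  defines "\<Psi> \<equiv> \<lambda>b s. f b * g (s - b) * s ^ N"
  shows "integrable (lborel \<Otimes>\<^sub>M lborel) (case_prod \<Psi>)"
    and "(\<integral>p. case_prod \<Psi> p \<partial>(lborel \<Otimes>\<^sub>M lborel)) =
      (\<Sum>j\<le>N. real (N choose j) * (\<integral>b. f b * b ^ j \<partial>lborel) * (\<integral>b. g b * b ^ (N - j) \<partial>lborel))"
proof -
  have [measurable]: "f \<in> borel_measurable borel" "g \<in> borel_measurable borel"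
    using f[of 0] g[of 0] by auto
  define R where "R b c = f b * g c * (b + c) ^ N" for b c
  define Q where "Q j = (\<lambda>(b, c). (f b * b ^ j) * (g c * c ^ (N - j)))" for j
  have Q: "integrable (lborel \<Otimes>\<^sub>M lborel) (Q j)" 
    "integral\<^sup>L (lborel \<Otimes>\<^sub>M lborel) (Q j) = (\<integral>b. f b * b ^ j \<partial>lborel) * (\<integral>b. g b * b ^ (N - j) \<partial>lborel)"
    if "j \<le> N" for j
    unfolding Q_def using that by (intro integrable_pair_product f g; simp)+
  have RQ: "case_prod R = (\<lambda>p. \<Sum>j\<le>N. real (N choose j) * Q j p)"
    by (auto simp: fun_eq_iff R_def Q_def binomial_ring sum_distrib_left mult_ac)
  have R: "integrable (lborel \<Otimes>\<^sub>M lborel) (case_prod R)"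
    unfolding RQ using Q by (intro Bochner_Integration.integrable_sum integrable_mult_right) auto
  have Rnorm: "integrable (lborel \<Otimes>\<^sub>M lborel) (\<lambda>(b, c). norm (R b c))"
    using integrable_norm[OF R] by (simp add: split_beta')
  have \<Psi>R: "\<Psi> b (b + 1 * c) = R b c" for b c by (simp add: \<Psi>_def R_def)
  have i1: "(\<integral>s. norm (\<Psi> b s) \<partial>lborel) = (\<integral>c. norm (R b c) \<partial>lborel)" for b
    by (subst lborel_integral_real_affine[where c=1 and t=b]) (simp_all only: \<Psi>R, simp_all)
  have i2: "(\<integral>s. \<Psi> b s \<partial>lborel) = (\<integral>c. R b c \<partial>lborel)" for b
    by (subst lborel_integral_real_affine[where c=1 and t=b]) (simp_all only: \<Psi>R, simp_all)
  have i3: "integrable lborel (\<Psi> b) \<longleftrightarrow> integrable lborel (R b)" for b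
    using lborel_integrable_real_affine_iff[of 1 "\<Psi> b" b] by (simp only: \<Psi>R)
  show int: "integrable (lborel \<Otimes>\<^sub>M lborel) (case_prod \<Psi>)"
  proof (rule lborel_pair.Fubini_integrable)
    show "integrable lborel (\<lambda>b. \<integral>s. norm (case (b, s) of (b, s) \<Rightarrow> \<Psi> b s) \<partial>lborel)"
      using lborel_pair.integrable_fst[OF Rnorm] unfolding prod.case i1 .
    show "AE b in lborel. integrable lborel (\<lambda>s. case (b, s) of (b, s) \<Rightarrow> \<Psi> b s)"
      using lborel_pair.AE_integrable_fst[OF R] by (simp add: i3[symmetric])
  qed (unfold \<Psi>_def split_beta', measurable)
  have "(\<integral>p. case_prod \<Psi> p \<partial>(lborel \<Otimes>\<^sub>M lborel)) = (\<integral>b. (\<integral>s. \<Psi> b s \<partial>lborel) \<partial>lborel)"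
    using lborel_pair.integral_fst[OF int] by simp
  also have "\<dots> = (\<integral>p. case_prod R p \<partial>(lborel \<Otimes>\<^sub>M lborel))"
    unfolding i2 using lborel_pair.integral_fst[OF R] by simp
  also have "\<dots> = (\<Sum>j\<le>N. real (N choose j) * (\<integral>b. f b * b ^ j \<partial>lborel) * (\<integral>b. g b * b ^ (N - j) \<partial>lborel))"
    unfolding RQ using Q by (simp add: Bochner_Integration.integral_sum mult.assoc)
  finally show "(\<integral>p. case_prod \<Psi> p \<partial>(lborel \<Otimes>\<^sub>M lborel)) = \<dots>" .
qed

text \<open>
  For almost every \<open>s\<close> the line convolution of the folded functions converges absolutely at \<open>s\<close>, and
  there \<open>\<bar>s\<bar> conv f g (s\<^sup>2)\<close> is its value. Commutativity is that of the line, and the odd moments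
  drop out because the folded functions are even.
\<close>

lemma conv_Fubini_half:
  fixes f g :: "real \<Rightarrow> real"
  assumes f: "\<And>k. k \<le> m \<Longrightarrow> set_integrable lborel {0<..} (\<lambda>x. x ^ k * f x)"
    and g: "\<And>k. k \<le> m \<Longrightarrow> set_integrable lborel {0<..} (\<lambda>x. x ^ k * g x)"
  defines "\<nu> \<equiv> - 1 / 2 :: real"
  shows "AE x in lborel. x > 0 \<longrightarrow> set_integrable lborel {0<..} (\<lambda>y. f y * translate \<nu> g x y) \<and>
           conv \<nu> f g x = conv \<nu> g f x"
    and "set_integrable lborel {0<..} (\<lambda>x. x ^ m * conv \<nu> f g x)"
    and "(LINT x:{0<..}|lborel. x ^ m * conv \<nu> f g x) =
      (\<Sum>i\<le>m. translation_coeff (\<nu> + 1) m i * (LINT y:{0<..}|lborel. y ^ i * f y) * (LINT y:{0<..}|lborel. y ^ (m - i) * g y))"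
proof -
  define F where "F x = indicat_real {0<..} x * f x" for x
  define G where "G x = indicat_real {0<..} x * g x" for x
  have F: "integrable lborel (\<lambda>x. F x * x ^ k)" and G: "integrable lborel (\<lambda>x. G x * x ^ k)" if "k \<le> m" for k
    using f[OF that] g[OF that] by (simp_all add: F_def G_def set_integrable_def mult_ac)
  have F0: "F x = 0" and G0: "G x = 0" if "x \<le> 0" for x using that by (simp_all add: F_def G_def)
  have [measurable]: "F \<in> borel_measurable borel" "G \<in> borel_measurable borel"
    using F[of 0] G[of 0] by auto
  let ?F = "fold_even F" and ?G = "fold_even G"
  have foldf: "\<bar>b\<bar> * f (b\<^sup>2) = ?F b" and foldg: "\<bar>b\<bar> * g (b\<^sup>2) = ?G b" for b
    by (auto simp: fold_even_def F_def G_def indicator_def)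
  have mF: "integrable lborel (\<lambda>b. ?F b * b ^ j)" and mG: "integrable lborel (\<lambda>b. ?G b * b ^ j)" if "j \<le> 2 * m" for j
    using fold_even_moments(1)[OF F F0 that] fold_even_moments(1)[OF G G0 that] by auto
  define good where "good s \<longleftrightarrow> integrable lborel (\<lambda>b. ?F b * ?G (s - b))" for s
  have [measurable]: "Measurable.pred borel good" unfolding good_def[abs_def] by measurable
  have "integrable (lborel \<Otimes>\<^sub>M lborel) (\<lambda>(b, s). ?F b * ?G (s - b) * s ^ 0)"
    using mF[of 0] mG[of 0] by (intro line_convolution_fubini) auto
  from lborel_pair.AE_integrable_snd[OF this] have good: "AE s in lborel. good s"
    by (simp add: good_def)
  have reflect_int: "integrable lborel (\<lambda>b. ?F b * ?G (- s - b)) \<longleftrightarrow> integrable lborel (\<lambda>b. ?F b * ?G (s - b))" for s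
  proof -
    have "?G (- s - - b) = ?G (s - b)" for b using fold_even_minus[of G "s - b"] by simp
    thus ?thesis using lborel_integrable_real_affine_iff[of "- 1" "\<lambda>b. ?F b * ?G (- s - b)" 0] by simp
  qed
  have reflect: "(\<integral>b. ?F b * ?G (- s - b) \<partial>lborel) = (\<integral>b. ?F b * ?G (s - b) \<partial>lborel)" for s
  proof -
    have "?G (- s - - b) = ?G (s - b)" for b using fold_even_minus[of G "s - b"] by simp
    thus ?thesis using lborel_integral_real_affine[of "- 1" "\<lambda>b. ?F b * ?G (- s - b)" 0] by simp
  qed
  have good_abs: "good \<bar>s\<bar> \<longleftrightarrow> good s" for s
    using reflect_int[of s] by (cases "s \<ge> 0") (auto simp: good_def)
  \<comment> \<open>The exceptional set is symmetric, so squaring carries it to a null set of the half-line.\<close>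
  have "AE x in distr (density lborel (\<lambda>b. ennreal \<bar>b\<bar>)) borel (\<lambda>b. b\<^sup>2). good (sqrt x)"
    using good by (subst AE_distr_iff) (auto simp: AE_density good_abs)
  hence good_sqrt: "AE x in lborel. x > 0 \<longrightarrow> good (sqrt x)"
    unfolding distr_square_lborel by (auto simp: AE_density indicator_def elim!: eventually_mono)

  have sh: "indicat_real {0<..} y * (f y * translate \<nu> g x y) = indicat_real {0<..} y * (F y * (1 / (2 * sqrt x) * (?G (sqrt y - sqrt x) + ?G (sqrt y + sqrt x))))" for x y
    by (simp add: translate_def \<nu>_def foldg) (simp add: F_def indicator_def)
  have Fmeas: "(\<lambda>y. F y * (1 / (2 * sqrt x) * (?G (sqrt y - sqrt x) + ?G (sqrt y + sqrt x)))) \<in> borel_measurable borel" for x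
    by measurable
  have sq: "\<bar>b\<bar> * (F (b\<^sup>2) * (1 / (2 * s) * (?G (sqrt (b\<^sup>2) - s) + ?G (sqrt (b\<^sup>2) + s)))) =
      1 / (2 * s) * (?F b * ?G (s - b) + ?F b * ?G (- s - b))" for b s
  proof -
    have "?G (\<bar>b\<bar> - s) + ?G (\<bar>b\<bar> + s) = ?G (s - b) + ?G (- s - b)"
      using fold_even_minus[of G "s - b"] arg_cong[of "- s - b" "- (b + s)" ?G, unfolded fold_even_minus] arg_cong[of "- b - s" "- (b + s)" ?G, unfolded fold_even_minus]
      by (cases "b \<ge> 0") (auto simp: add.commute)
    thus ?thesis by (simp add: fold_even_def distrib_left mult_ac)
  qed
  have conv1: "set_integrable lborel {0<..} (\<lambda>y. f y * translate \<nu> g x y)"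
    "conv \<nu> f g x = 1 / sqrt x * (\<integral>b. ?F b * ?G (sqrt x - b) \<partial>lborel)" if "x > 0" "good (sqrt x)" for x
  proof -
    have i: "integrable lborel (\<lambda>b. ?F b * ?G (sqrt x - b))" "integrable lborel (\<lambda>b. ?F b * ?G (- sqrt x - b))"
      using that reflect_int by (auto simp: good_def)
    have "integrable lborel (\<lambda>b. 1 / (2 * sqrt x) * (?F b * ?G (sqrt x - b) + ?F b * ?G (- sqrt x - b)))"
      using i by (intro integrable_mult_right Bochner_Integration.integrable_add)
    thus "set_integrable lborel {0<..} (\<lambda>y. f y * translate \<nu> g x y)"
      unfolding set_integrable_def real_scaleR_def sh has_bochner_integral_square(3)[OF Fmeas, symmetric] sq .
    have "conv \<nu> f g x = (\<integral>b. 1 / (2 * sqrt x) * (?F b * ?G (sqrt x - b) + ?F b * ?G (- sqrt x - b)) \<partial>lborel)"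
      unfolding conv_eq_translate set_lebesgue_integral_def real_scaleR_def sh has_bochner_integral_square(2)[OF Fmeas, symmetric] sq ..
    also have "\<dots> = 1 / (2 * sqrt x) * ((\<integral>b. ?F b * ?G (sqrt x - b) \<partial>lborel) + (\<integral>b. ?F b * ?G (- sqrt x - b) \<partial>lborel))"
      unfolding integral_mult_right_zero Bochner_Integration.integral_add[OF i] ..
    finally show "conv \<nu> f g x = 1 / sqrt x * (\<integral>b. ?F b * ?G (sqrt x - b) \<partial>lborel)"
      unfolding reflect by (simp add: field_simps)
  qed
  have comm: "(\<integral>b. ?G b * ?F (s - b) \<partial>lborel) = (\<integral>b. ?F b * ?G (s - b) \<partial>lborel)" for s
    using lborel_integral_real_affine[of "- 1" "\<lambda>b. ?G b * ?F (s - b)" s] by (simp add: mult.commute)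
  have comm_int: "integrable lborel (\<lambda>b. ?G b * ?F (s - b)) \<longleftrightarrow> integrable lborel (\<lambda>b. ?F b * ?G (s - b))" for s
    using lborel_integrable_real_affine_iff[of "- 1" "\<lambda>b. ?G b * ?F (s - b)" s] by (simp add: mult.commute)
  have conv2: "conv \<nu> g f x = 1 / sqrt x * (\<integral>b. ?G b * ?F (sqrt x - b) \<partial>lborel)" if "x > 0" "good (sqrt x)" for x
  proof -
    have reflect_int': "integrable lborel (\<lambda>b. ?G b * ?F (- s - b)) \<longleftrightarrow> integrable lborel (\<lambda>b. ?G b * ?F (s - b))" for s
      unfolding comm_int by (rule reflect_int)
    have reflect': "(\<integral>b. ?G b * ?F (- s - b) \<partial>lborel) = (\<integral>b. ?G b * ?F (s - b) \<partial>lborel)" for s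
      unfolding comm by (rule reflect)
    have sh': "indicat_real {0<..} y * (g y * translate \<nu> f x y) = indicat_real {0<..} y * (G y * (1 / (2 * sqrt x) * (?F (sqrt y - sqrt x) + ?F (sqrt y + sqrt x))))" for x y
      by (simp add: translate_def \<nu>_def foldf) (simp add: G_def indicator_def)
    have Gmeas: "(\<lambda>y. G y * (1 / (2 * sqrt x) * (?F (sqrt y - sqrt x) + ?F (sqrt y + sqrt x)))) \<in> borel_measurable borel" for x
      by measurable
    have sq': "\<bar>b\<bar> * (G (b\<^sup>2) * (1 / (2 * s) * (?F (sqrt (b\<^sup>2) - s) + ?F (sqrt (b\<^sup>2) + s)))) =
        1 / (2 * s) * (?G b * ?F (s - b) + ?G b * ?F (- s - b))" for b s
    proof -
      have "?F (\<bar>b\<bar> - s) + ?F (\<bar>b\<bar> + s) = ?F (s - b) + ?F (- s - b)"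
        using fold_even_minus[of F "s - b"] arg_cong[of "- s - b" "- (b + s)" ?F, unfolded fold_even_minus] arg_cong[of "- b - s" "- (b + s)" ?F, unfolded fold_even_minus]
        by (cases "b \<ge> 0") (auto simp: add.commute)
      thus ?thesis by (simp add: fold_even_def distrib_left mult_ac)
    qed
    have i: "integrable lborel (\<lambda>b. ?G b * ?F (sqrt x - b))" "integrable lborel (\<lambda>b. ?G b * ?F (- sqrt x - b))"
      using that reflect_int' comm_int by (auto simp: good_def)
    have "conv \<nu> g f x = (\<integral>b. 1 / (2 * sqrt x) * (?G b * ?F (sqrt x - b) + ?G b * ?F (- sqrt x - b)) \<partial>lborel)"
      unfolding conv_eq_translate set_lebesgue_integral_def real_scaleR_def sh' has_bochner_integral_square(2)[OF Gmeas, symmetric] sq' ..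
    also have "\<dots> = 1 / (2 * sqrt x) * ((\<integral>b. ?G b * ?F (sqrt x - b) \<partial>lborel) + (\<integral>b. ?G b * ?F (- sqrt x - b) \<partial>lborel))"
      unfolding integral_mult_right_zero Bochner_Integration.integral_add[OF i] ..
    finally show ?thesis unfolding reflect' by (simp add: field_simps)
  qed
  show "AE x in lborel. x > 0 \<longrightarrow> set_integrable lborel {0<..} (\<lambda>y. f y * translate \<nu> g x y) \<and>
           conv \<nu> f g x = conv \<nu> g f x"
    using good_sqrt by eventually_elim (auto simp: conv1 conv2 comm)

  define C where "C x = x ^ m * (\<integral>y. indicat_real {0<..} y * (F y * (1 / (2 * sqrt x) * (?G (sqrt y - sqrt x) + ?G (sqrt y + sqrt x)))) \<partial>lborel)" for x
  have C: "C x = x ^ m * conv \<nu> f g x" for x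
    unfolding C_def conv_eq_translate set_lebesgue_integral_def real_scaleR_def sh ..
  have Cmeas [measurable]: "C \<in> borel_measurable borel" unfolding C_def[abs_def] by measurable
  define \<Psi> where "\<Psi> b s = ?F b * ?G (s - b) * s ^ (2 * m)" for b s
  have \<Psi>: "integrable (lborel \<Otimes>\<^sub>M lborel) (case_prod \<Psi>)"
    "(\<integral>p. case_prod \<Psi> p \<partial>(lborel \<Otimes>\<^sub>M lborel)) =
      (\<Sum>j\<le>2*m. real (2 * m choose j) * (\<integral>b. ?F b * b ^ j \<partial>lborel) * (\<integral>b. ?G b * b ^ (2 * m - j) \<partial>lborel))"
    unfolding \<Psi>_def[abs_def] by (intro line_convolution_fubini mF mG; simp)+
  define J where "J s = (\<integral>b. \<Psi> b s \<partial>lborel)" for s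
  have J: "integrable lborel J" "integral\<^sup>L lborel J = (\<integral>p. case_prod \<Psi> p \<partial>(lborel \<Otimes>\<^sub>M lborel))"
    unfolding J_def[abs_def] using lborel_pair.integrable_snd[OF \<Psi>(1)] lborel_pair.integral_snd[OF \<Psi>(1)] by simp_all
  have CJ: "AE s in lborel. J s = \<bar>s\<bar> * C (s\<^sup>2)"
    using good AE_lborel_singleton[of 0]
  proof eventually_elim
    case (elim s)
    have "\<bar>s\<bar> * C (s\<^sup>2) = (s\<^sup>2) ^ m * (\<integral>b. ?F b * ?G (\<bar>s\<bar> - b) \<partial>lborel)"
      using elim by (simp add: C conv1 good_abs)
    also have "(\<integral>b. ?F b * ?G (\<bar>s\<bar> - b) \<partial>lborel) = (\<integral>b. ?F b * ?G (s - b) \<partial>lborel)"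
      using reflect[of s] by (cases "s \<ge> 0") auto
    finally show ?case
      unfolding J_def \<Psi>_def power_mult by (simp add: mult.commute[of "(s\<^sup>2) ^ m"])
  qed
  have "integrable lborel (\<lambda>s. \<bar>s\<bar> * C (s\<^sup>2))"
    using integrable_cong_AE[OF _ _ CJ] J by simp
  thus "set_integrable lborel {0<..} (\<lambda>x. x ^ m * conv \<nu> f g x)"
    unfolding set_integrable_def real_scaleR_def C[symmetric] has_bochner_integral_square(3)[OF Cmeas] .
  have "(LINT x:{0<..}|lborel. x ^ m * conv \<nu> f g x) = (\<integral>s. \<bar>s\<bar> * C (s\<^sup>2) \<partial>lborel)"
    unfolding set_lebesgue_integral_def real_scaleR_def C[symmetric] has_bochner_integral_square(2)[OF Cmeas] ..
  also have "\<dots> = integral\<^sup>L lborel J"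
    using integral_cong_AE[OF _ _ CJ] J by simp
  also have "\<dots> = (\<Sum>j\<le>2*m. real (2 * m choose j) * (\<integral>b. ?F b * b ^ j \<partial>lborel) * (\<integral>b. ?G b * b ^ (2 * m - j) \<partial>lborel))"
    using J \<Psi> by simp
  also have "\<dots> = (\<Sum>i\<le>2*m. real (2 * m choose (2 * i)) * (\<integral>b. ?F b * b ^ (2 * i) \<partial>lborel) * (\<integral>b. ?G b * b ^ (2 * m - 2 * i) \<partial>lborel))"
    by (rule sum_even_reindex) (auto simp: fold_even_moments(3)[where m=m, OF F F0])
  also have "\<dots> = (\<Sum>i\<le>m. real (2 * m choose (2 * i)) * (\<integral>b. ?F b * b ^ (2 * i) \<partial>lborel) * (\<integral>b. ?G b * b ^ (2 * m - 2 * i) \<partial>lborel))"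
    by (rule sum.mono_neutral_right) auto
  also have "\<dots> = (\<Sum>i\<le>m. translation_coeff (\<nu> + 1) m i * (LINT y:{0<..}|lborel. y ^ i * f y) * (LINT y:{0<..}|lborel. y ^ (m - i) * g y))"
  proof (intro sum.cong refl)
    fix i assume i: "i \<in> {..m}"
    have "(\<integral>b. ?F b * b ^ (2 * i) \<partial>lborel) = (\<integral>x. F x * x ^ i \<partial>lborel)"
      by (rule fold_even_moments(2)[where m=m]) (use F F0 i in auto)
    hence "(\<integral>b. ?F b * b ^ (2 * i) \<partial>lborel) = (LINT y:{0<..}|lborel. y ^ i * f y)"
      by (simp only: F_def set_lebesgue_integral_def mult_ac real_scaleR_def)
    moreover have "(\<integral>b. ?G b * b ^ (2 * (m - i)) \<partial>lborel) = (\<integral>x. G x * x ^ (m - i) \<partial>lborel)"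
      by (rule fold_even_moments(2)[where m=m]) (use G G0 i in auto)
    hence "(\<integral>b. ?G b * b ^ (2 * (m - i)) \<partial>lborel) = (LINT y:{0<..}|lborel. y ^ (m - i) * g y)"
      by (simp only: G_def set_lebesgue_integral_def mult_ac real_scaleR_def)
    moreover have "2 * (m - i) = 2 * m - 2 * i" by simp
    moreover have "translation_coeff (\<nu> + 1) m i = real (2 * m choose (2 * i))"
      using translation_coeff_half[of i m] i by (simp add: \<nu>_def)
    ultimately show "real (2 * m choose (2 * i)) * (\<integral>b. ?F b * b ^ (2 * i) \<partial>lborel) * (\<integral>b. ?G b * b ^ (2 * m - 2 * i) \<partial>lborel) =
       translation_coeff (\<nu> + 1) m i * (LINT y:{0<..}|lborel. y ^ i * f y) * (LINT y:{0<..}|lborel. y ^ (m - i) * g y)"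
      by (simp only:)
  qed
  finally show "(LINT x:{0<..}|lborel. x ^ m * conv \<nu> f g x) = \<dots>" .
qed

lemma conv_Fubini:
  fixes f g :: "real \<Rightarrow> real"
  assumes \<nu>: "\<nu> \<ge> - 1 / 2"
    and f: "\<And>k. k \<le> m \<Longrightarrow> set_integrable lborel {0<..} (\<lambda>x. x ^ k * f x)"
    and g: "\<And>k. k \<le> m \<Longrightarrow> set_integrable lborel {0<..} (\<lambda>x. x ^ k * g x)"
  shows "AE x in lborel. x > 0 \<longrightarrow> set_integrable lborel {0<..} (\<lambda>y. f y * translate \<nu> g x y) \<and>
           conv \<nu> f g x = conv \<nu> g f x"
    and "set_integrable lborel {0<..} (\<lambda>x. x ^ m * conv \<nu> f g x)"
    and "(LINT x:{0<..}|lborel. x ^ m * conv \<nu> f g x) =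
      (\<Sum>i\<le>m. translation_coeff (\<nu> + 1) m i * (LINT y:{0<..}|lborel. y ^ i * f y) * (LINT y:{0<..}|lborel. y ^ (m - i) * g y))"
  using conv_Fubini_gt[of \<nu> m f g] conv_Fubini_half[of m f g] \<nu> f g by (cases "\<nu> = - 1 / 2"; auto)+

section \<open>The entire Bessel function\<close>

text \<open>
  The entire function \<open>\<^sub>0F\<^sub>1(; s; - z)\<close>. With \<open>s = \<nu> + 1\<close> it is the Bessel function
  \<open>J\<^sub>\<nu>(2 sqrt z)\<close> divided by \<open>z\<^sup>\<nu>\<^sup>/\<^sup>2\<close> and normalised to \<open>1\<close> at the origin.
\<close>

definition bessel_clifford :: "real \<Rightarrow> real \<Rightarrow> real" where
  "bessel_clifford s z = (\<Sum>k. (- 1) ^ k / (fact k * pochhammer s k) * z ^ k)"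

lemma pochhammer_Suc_lower:
  fixes s :: real
  assumes "s > 0"
  shows "pochhammer s (Suc k) \<ge> s * fact k"
proof -
  have "pochhammer 1 k \<le> pochhammer (s + 1) k"
    unfolding pochhammer_prod using assms by (intro prod_mono) auto
  hence "fact k \<le> pochhammer (s + 1) k" by (simp add: pochhammer_fact)
  thus ?thesis using assms by (simp add: pochhammer_rec)
qed

lemma bessel_clifford_summable:
  assumes "s > 0"
  shows "summable (\<lambda>k. (- 1) ^ k / (fact k * pochhammer s k) * (z::real) ^ k)"
proof (rule summable_comparison_test)
  have "summable (\<lambda>k. inverse (fact k) * \<bar>z\<bar> ^ k)" by (rule summable_exp)
  thus "summable (\<lambda>k. inverse (fact k) * \<bar>z\<bar> ^ k / s * (s + 1) )"
    by (intro summable_mult2 summable_divide)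
  have "norm ((- 1) ^ k / (fact k * pochhammer s k) * z ^ k) \<le> inverse (fact k) * \<bar>z\<bar> ^ k / s * (s + 1)" for k
  proof -
    have "pochhammer s k \<ge> s / (s + 1)"
    proof (cases k)
      case 0 thus ?thesis using assms by simp
    next
      case (Suc j)
      have "s / (s + 1) \<le> s" using assms by (simp add: field_simps)
      also have "\<dots> \<le> s * fact j" using assms by simp
      also have "\<dots> \<le> pochhammer s k" using pochhammer_Suc_lower[OF assms] Suc by simp
      finally show ?thesis .
    qed
    hence "1 / pochhammer s k \<le> 1 / (s / (s + 1))"
      using assms by (intro frac_le) auto
    hence "1 / pochhammer s k \<le> (s + 1) / s" by simp
    hence "(inverse (fact k) * \<bar>z\<bar> ^ k) * (1 / pochhammer s k) \<le> (inverse (fact k) * \<bar>z\<bar> ^ k) * ((s + 1) / s)"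
      by (intro mult_left_mono) auto
    thus ?thesis using pochhammer_pos[OF assms, of k] 
      by (simp add: abs_mult power_abs field_simps)
  qed
  thus "\<exists>N. \<forall>n\<ge>N. norm ((- 1) ^ n / (fact n * pochhammer s n) * z ^ n) \<le> inverse (fact n) * \<bar>z\<bar> ^ n / s * (s + 1)"
    by blast
qed

lemma bessel_clifford_0 [simp]: "bessel_clifford s 0 = 1"
  unfolding bessel_clifford_def by (subst suminf_finite[of "{0}"]) auto

lemma bessel_clifford_deriv:
  assumes "s > 0"
  shows "(bessel_clifford s has_field_derivative (- bessel_clifford (s + 1) z / s)) (at z)"
proof -
  let ?c = "\<lambda>k. (- 1) ^ k / (fact k * pochhammer s k) :: real"
  have "((\<lambda>x. \<Sum>n. ?c n * x^n) has_field_derivative (\<Sum>n. diffs ?c n * z^n)) (at z)"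
    by (rule termdiffs_strong_converges_everywhere) (rule bessel_clifford_summable[OF assms])
  moreover have "diffs ?c n * z^n = (- 1 / s) * ((- 1) ^ n / (fact n * pochhammer (s + 1) n) * z ^ n)" for n
    using assms pochhammer_pos[of "s+1" n]
    by (simp add: diffs_def pochhammer_rec field_simps del: of_nat_Suc)
  hence "(\<Sum>n. diffs ?c n * z^n) = (- 1 / s) * bessel_clifford (s + 1) z"
    unfolding bessel_clifford_def using suminf_mult[OF bessel_clifford_summable[of "s + 1" z], of "- 1 / s"] assms by simp
  ultimately show ?thesis by (simp add: bessel_clifford_def[abs_def])
qed

text \<open>
  Bessel's differential equation, written as a contiguous relation by means of the
  derivative formula.
\<close>

lemma bessel_clifford_ode:
  assumes "s > 0"
  shows "z * bessel_clifford (s + 2) z / (s * (s + 1)) = bessel_clifford (s + 1) z - bessel_clifford s z"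
proof -
  let ?c = "\<lambda>s k. (- 1) ^ k / (fact k * pochhammer s k) * z ^ k :: real"
  have S: "summable (?c s)" if "s > 0" for s using bessel_clifford_summable[OF that] .
  have "bessel_clifford (s + 1) z - bessel_clifford s z = (\<Sum>k. ?c (s + 1) k - ?c s k)"
    unfolding bessel_clifford_def using assms by (intro suminf_diff S) auto
  also have "\<dots> = (\<Sum>k. ?c (s + 1) (Suc k) - ?c s (Suc k))"
  proof -
    have "summable (\<lambda>k. ?c (s + 1) k - ?c s k)" using assms by (intro summable_diff S) auto
    from suminf_split_head[OF this] show ?thesis by simp
  qed
  also have "\<dots> = (\<Sum>k. z / (s * (s + 1)) * ?c (s + 2) k)"
  proof (rule suminf_cong)
    fix k
    have p: "pochhammer (s + 2) k > 0" using assms by (intro pochhammer_pos) auto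
    have a: "pochhammer s (Suc k) = s * pochhammer (s + 1) k" by (simp add: pochhammer_rec)
    have b: "(s + 1) * pochhammer (s + 2) k = pochhammer (s + 1) k * (s + 1 + k)"
    proof -
      have "pochhammer (s + 1) (Suc k) = (s + 1) * pochhammer (s + 2) k" 
        by (simp add: pochhammer_rec add.assoc)
      thus ?thesis by (simp add: pochhammer_Suc)
    qed
    have c: "pochhammer (s + 1) (Suc k) = (s + 1) * pochhammer (s + 2) k"
      by (simp add: pochhammer_rec add.assoc)
    have pk: "pochhammer (s + 1) k > 0" using assms by (intro pochhammer_pos) auto
    have d: "pochhammer (s + 1) k = (s + 1) * pochhammer (s + 2) k / (s + 1 + k)"
      using b assms by (simp add: field_simps)
    have nz: "s + 1 + real k > 0" using assms by simp
    have alg: "- E / ((r * f) * ((s + 1) * p)) * Z - (- E / ((r * f) * (s * ((s + 1) * p / (s + r)))) * Z)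
        = 1 / (s * (s + 1)) * (E / (f * p) * Z)" if "r > 0" "f > 0" "p > 0" for E r f p Z :: real
      using that assms by (simp add: divide_simps) (simp add: algebra_simps)
    from alg[of "real (Suc k)" "fact k" "pochhammer (s + 2) k" "(- 1) ^ k" "z ^ Suc k"]
    show "?c (s + 1) (Suc k) - ?c s (Suc k) = z / (s * (s + 1)) * ?c (s + 2) k"
      unfolding a c d using p by (simp add: algebra_simps)
  qed
  also have "\<dots> = z / (s * (s + 1)) * bessel_clifford (s + 2) z"
    unfolding bessel_clifford_def using assms by (intro suminf_mult S) auto
  finally show ?thesis by simp
qed

text \<open>
  By the differential equation the energy \<open>j\<^sup>2 + z j'\<^sup>2\<close> has derivative \<open>(1 - 2 s) j'\<^sup>2\<close>, so for
  \<open>s \<ge> 1/2\<close> it decreases from its value \<open>1\<close> at the origin.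
\<close>

lemma bessel_clifford_bounded:
  assumes "s \<ge> 1 / 2" "z \<ge> 0"
  shows "\<bar>bessel_clifford s z\<bar> \<le> 1"
proof -
  have s: "s > 0" using assms by simp
  define E where "E z = (bessel_clifford s z)\<^sup>2 + z * (bessel_clifford (s + 1) z / s)\<^sup>2" for z
  have "E z \<le> E 0"
  proof (rule DERIV_nonpos_imp_nonincreasing[OF assms(2)])
    fix x assume x: "0 \<le> x" "x \<le> z"
    have "(E has_field_derivative
        (2 * bessel_clifford s x * (- bessel_clifford (s + 1) x / s) + ((bessel_clifford (s + 1) x / s)\<^sup>2 +
          x * (2 * (bessel_clifford (s + 1) x / s) * ((- bessel_clifford (s + 2) x / (s + 1)) / s))))) (at x)"
    proof -
      have generic: "((\<lambda>z. (F z)\<^sup>2 + z * (G z)\<^sup>2) has_field_derivative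
          (2 * F x * F' + ((G x)\<^sup>2 + x * (2 * G x * G')))) (at x)"
        if "(F has_field_derivative F') (at x)" "(G has_field_derivative G') (at x)" 
        for F G :: "real \<Rightarrow> real" and F' G'
        using that by (auto intro!: derivative_eq_intros)
      show ?thesis
        unfolding E_def[abs_def] 
        using bessel_clifford_deriv[OF s] DERIV_cdivide[OF bessel_clifford_deriv[of "s + 1" x], of s] s
        by (intro generic) (simp_all add: add.assoc)
    qed
    also have "(2 * bessel_clifford s x * (- bessel_clifford (s + 1) x / s) + ((bessel_clifford (s + 1) x / s)\<^sup>2 +
          x * (2 * (bessel_clifford (s + 1) x / s) * ((- bessel_clifford (s + 2) x / (s + 1)) / s)))) =
        2 * bessel_clifford s x * (- bessel_clifford (s + 1) x / s) + (bessel_clifford (s + 1) x / s)\<^sup>2 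
        - 2 * (bessel_clifford (s + 1) x / s) * (x * bessel_clifford (s + 2) x / (s * (s + 1)))"
      using s by (simp add: divide_simps) (simp add: algebra_simps power2_eq_square)
    also have "\<dots> = (bessel_clifford (s + 1) x)\<^sup>2 * ((1 - 2 * s) / s\<^sup>2)"
      unfolding bessel_clifford_ode[OF s] using s by (simp add: divide_simps power2_eq_square) (simp add: algebra_simps)
    finally have "(E has_field_derivative (bessel_clifford (s + 1) x)\<^sup>2 * ((1 - 2 * s) / s\<^sup>2)) (at x)" .
    moreover have "(bessel_clifford (s + 1) x)\<^sup>2 * ((1 - 2 * s) / s\<^sup>2) \<le> 0"
      using assms by (intro mult_nonneg_nonpos divide_nonpos_nonneg) auto
    ultimately show "\<exists>y. (E has_field_derivative y) (at x) \<and> y \<le> 0" by blast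
  qed
  moreover have "(bessel_clifford s z)\<^sup>2 \<le> E z" using assms by (simp add: E_def)
  ultimately have "(bessel_clifford s z)\<^sup>2 \<le> 1" by (simp add: E_def)
  thus ?thesis by (simp add: abs_square_le_1)
qed

section \<open>Smoothness of the Hankel transform\<close>

lemma hankel_kernel_bessel_clifford:
  assumes \<nu>: "\<nu> > - 1" and z: "z > 0"
  shows "Gamma (\<nu> + 1) * (BesselJ \<nu> (2 * sqrt z) / z powr (\<nu> / 2)) = bessel_clifford (\<nu> + 1) z"
proof -
  let ?c = "\<lambda>k. (- 1) ^ k / (fact k * pochhammer (\<nu> + 1) k) * z ^ k :: real"
  have G: "Gamma (\<nu> + 1) > 0" using \<nu> by simp
  have "BesselJ \<nu> (2 * sqrt z) = (\<Sum>k. z powr (\<nu> / 2) / Gamma (\<nu> + 1) * ?c k)"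
    unfolding BesselJ_def
  proof (rule suminf_cong)
    fix k
    have "pochhammer (\<nu> + 1) k = Gamma (\<nu> + 1 + real k) / Gamma (\<nu> + 1)"
      using \<nu> by (intro pochhammer_Gamma) (auto elim!: nonpos_Ints_cases)
    moreover have "Gamma (\<nu> + 1 + real k) > 0" using \<nu> by (intro Gamma_real_pos) auto
    ultimately have r: "rGamma (\<nu> + real k + 1) = 1 / (Gamma (\<nu> + 1) * pochhammer (\<nu> + 1) k)"
      using G by (simp add: rGamma_inverse_Gamma field_simps)
    have "(2 * sqrt z / 2) powr (2 * real k + \<nu>) = (z powr (1/2)) powr (2 * real k + \<nu>)"
      using z by (simp add: powr_half_sqrt)
    also have "\<dots> = z powr (real k + \<nu> / 2)" by (simp add: powr_powr field_simps)
    also have "\<dots> = z ^ k * z powr (\<nu> / 2)" using z by (simp add: powr_add powr_realpow)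
    finally show "(- 1) ^ k * rGamma (\<nu> + real k + 1) / fact k * (2 * sqrt z / 2) powr (2 * real k + \<nu>) =
      z powr (\<nu> / 2) / Gamma (\<nu> + 1) * ?c k"
      unfolding r by (simp add: mult_ac)
  qed
  also have "\<dots> = z powr (\<nu> / 2) / Gamma (\<nu> + 1) * bessel_clifford (\<nu> + 1) z"
    unfolding bessel_clifford_def using \<nu> by (intro suminf_mult bessel_clifford_summable) auto
  finally show ?thesis using G z by simp
qed

text \<open>
  Dominated convergence: the difference quotients of \<open>\<phi>(x t)\<close> in \<open>t\<close> are bounded by \<open>C' x\<close>. The derivative
  is taken within \<open>t \<ge> 0\<close> because \<open>\<phi>\<close> is bounded on the positive half-line only.
\<close>

lemma integral_dilation_has_derivative:
  fixes f \<phi> \<phi>' :: "real \<Rightarrow> real"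
  assumes "set_integrable lborel {0<..} f" "set_integrable lborel {0<..} (\<lambda>x. x * f x)"
    and d: "\<And>z. (\<phi> has_field_derivative \<phi>' z) (at z)"
    and cont: "continuous_on UNIV \<phi>'"
    and b: "\<And>z. z \<ge> 0 \<Longrightarrow> \<bar>\<phi> z\<bar> \<le> C" and b': "\<And>z. z \<ge> 0 \<Longrightarrow> \<bar>\<phi>' z\<bar> \<le> C'"
    and t: "t \<ge> 0"
  shows "((\<lambda>t. LINT x:{0<..}|lborel. f x * \<phi> (x * t)) has_field_derivative
          (LINT x:{0<..}|lborel. (x * f x) * \<phi>' (x * t))) (at t within {0..})"
proof -
  have [measurable]: "\<phi> \<in> borel_measurable borel" "\<phi>' \<in> borel_measurable borel"
    using cont d by (auto intro!: borel_measurable_continuous_onI DERIV_continuous_on)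
  define g where "g x = indicat_real {0<..} x * f x" for x
  have g: "integrable lborel g" and xg: "integrable lborel (\<lambda>x. x * g x)"
    using assms(1,2) by (auto simp: set_integrable_def g_def[abs_def] mult_ac)
  have [measurable]: "g \<in> borel_measurable borel" using g by auto
  have g0: "g x = 0" if "x \<le> 0" for x using that by (simp add: g_def)
  have eq1: "(LINT x:{0<..}|lborel. f x * \<phi> (x * t)) = (\<integral>x. g x * \<phi> (x * t) \<partial>lborel)" for t
    by (simp add: set_lebesgue_integral_def g_def mult_ac)
  have eq2: "(LINT x:{0<..}|lborel. x * f x * \<phi>' (x * t)) = (\<integral>x. x * g x * \<phi>' (x * t) \<partial>lborel)" for t
    by (simp add: set_lebesgue_integral_def g_def mult_ac)
  have int: "integrable lborel (\<lambda>x. g x * \<phi> (x * t))" if "t \<ge> 0" for t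
  proof (rule Bochner_Integration.integrable_bound[where f="\<lambda>x. C * g x"])
    show "AE x in lborel. norm (g x * \<phi> (x * t)) \<le> norm (C * g x)"
    proof (rule AE_I2)
      fix x show "norm (g x * \<phi> (x * t)) \<le> norm (C * g x)"
      proof (cases "x \<le> 0")
        case False
        hence "\<bar>\<phi> (x * t)\<bar> \<le> \<bar>C\<bar>" using b[of "x * t"] that by (simp add: )
        hence "\<bar>g x\<bar> * \<bar>\<phi> (x * t)\<bar> \<le> \<bar>g x\<bar> * \<bar>C\<bar>" by (intro mult_left_mono) auto
        thus ?thesis by (simp add: abs_mult mult.commute)
      qed (simp add: g0)
    qed
  qed (use g in auto)
  have lip: "\<bar>\<phi> u - \<phi> v\<bar> \<le> C' * \<bar>u - v\<bar>" if "u \<ge> 0" "v \<ge> 0" for u v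
    using field_differentiable_bound[of "{0..}" \<phi> \<phi>' C' u v] b' d that
    by (auto intro: has_field_derivative_at_within simp: )
  show ?thesis
    unfolding eq1 eq2 has_field_derivative_iff tendsto_at_iff_sequentially comp_def
  proof (intro allI impI)
    fix y :: "nat \<Rightarrow> real"
    assume y: "\<forall>i. y i \<in> {0..} - {t}" "y \<longlonglongrightarrow> t"
    have "(\<lambda>i. \<integral>x. g x * ((\<phi> (x * y i) - \<phi> (x * t)) / (y i - t)) \<partial>lborel)
        \<longlonglongrightarrow> (\<integral>x. x * g x * \<phi>' (x * t) \<partial>lborel)"
    proof (rule integral_dominated_convergence[where w="\<lambda>x. C' * \<bar>x * g x\<bar>"])
      show "integrable lborel (\<lambda>x. C' * \<bar>x * g x\<bar>)" using xg by auto
      show "AE x in lborel. (\<lambda>i. g x * ((\<phi> (x * y i) - \<phi> (x * t)) / (y i - t))) \<longlonglongrightarrow> x * g x * \<phi>' (x * t)"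
      proof (rule AE_I2)
        fix x
        have "((\<lambda>s. \<phi> (x * s)) has_field_derivative \<phi>' (x * t) * x) (at t)"
          by (rule DERIV_chain2[OF d]) (auto intro!: derivative_eq_intros)
        hence "((\<lambda>s. \<phi> (x * s)) has_field_derivative \<phi>' (x * t) * x) (at t within {0..})"
          by (rule has_field_derivative_at_within)
        hence "(\<lambda>i. (\<phi> (x * y i) - \<phi> (x * t)) / (y i - t)) \<longlonglongrightarrow> \<phi>' (x * t) * x"
          using y unfolding has_field_derivative_iff tendsto_at_iff_sequentially comp_def by blast
        from tendsto_mult_left[OF this, of "g x"] 
        show "(\<lambda>i. g x * ((\<phi> (x * y i) - \<phi> (x * t)) / (y i - t))) \<longlonglongrightarrow> x * g x * \<phi>' (x * t)"
          by (simp add: mult_ac)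
      qed
      show "AE x in lborel. norm (g x * ((\<phi> (x * y i) - \<phi> (x * t)) / (y i - t))) \<le> C' * \<bar>x * g x\<bar>" for i
      proof (rule AE_I2)
        fix x show "norm (g x * ((\<phi> (x * y i) - \<phi> (x * t)) / (y i - t))) \<le> C' * \<bar>x * g x\<bar>"
        proof (cases "x \<le> 0")
          case False
          have ne: "y i \<noteq> t" and ge: "y i \<ge> 0" using y by auto
          have "\<bar>\<phi> (x * y i) - \<phi> (x * t)\<bar> \<le> C' * \<bar>x * y i - x * t\<bar>"
            using False ge t by (intro lip) auto
          also have "\<dots> = C' * x * \<bar>y i - t\<bar>" using False
            by (simp add: right_diff_distrib[symmetric] abs_mult)
          finally have "\<bar>\<phi> (x * y i) - \<phi> (x * t)\<bar> / \<bar>y i - t\<bar> \<le> C' * x"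
            using ne by (simp add: divide_le_eq)
          hence "\<bar>g x\<bar> * (\<bar>\<phi> (x * y i) - \<phi> (x * t)\<bar> / \<bar>y i - t\<bar>) \<le> \<bar>g x\<bar> * (C' * x)"
            by (intro mult_left_mono) auto
          thus ?thesis using False by (simp add: abs_mult mult_ac)
        qed (simp add: g0)
      qed
    qed auto
    moreover have "(\<integral>x. g x * ((\<phi> (x * y i) - \<phi> (x * t)) / (y i - t)) \<partial>lborel) =
        ((\<integral>x. g x * \<phi> (x * y i) \<partial>lborel) - (\<integral>x. g x * \<phi> (x * t) \<partial>lborel)) / (y i - t)" for i
    proof -
      have "((\<integral>x. g x * \<phi> (x * y i) \<partial>lborel) - (\<integral>x. g x * \<phi> (x * t) \<partial>lborel)) / (y i - t) =
        (\<integral>x. (g x * \<phi> (x * y i) - g x * \<phi> (x * t)) / (y i - t) \<partial>lborel)"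
        using y t by (simp add: Bochner_Integration.integral_diff int)
      thus ?thesis by (simp add: right_diff_distrib diff_divide_distrib)
    qed
    ultimately show "(\<lambda>i. ((\<integral>x. g x * \<phi> (x * y i) \<partial>lborel) - (\<integral>x. g x * \<phi> (x * t) \<partial>lborel)) / (y i - t))
        \<longlonglongrightarrow> (\<integral>x. x * g x * \<phi>' (x * t) \<partial>lborel)" by (simp only:)
  qed
qed

lemma dilation_continuous:
  fixes f \<phi> :: "real \<Rightarrow> real"
  assumes f: "set_integrable lborel {0<..} f"
    and cont: "continuous_on UNIV \<phi>" and b: "\<And>z. z \<ge> 0 \<Longrightarrow> \<bar>\<phi> z\<bar> \<le> C"
  shows "continuous_on {0..} (\<lambda>t. LINT x:{0<..}|lborel. f x * \<phi> (x * t))"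
proof -
  have [measurable]: "\<phi> \<in> borel_measurable borel"
    using cont by (rule borel_measurable_continuous_onI)
  define g where "g x = indicat_real {0<..} x * f x" for x
  have g: "integrable lborel g" using f by (simp add: set_integrable_def g_def[abs_def] mult_ac)
  hence [measurable]: "g \<in> borel_measurable borel" by auto
  have eq: "(LINT x:{0<..}|lborel. f x * \<phi> (x * t)) = (\<integral>x. g x * \<phi> (x * t) \<partial>lborel)" for t
    by (simp add: set_lebesgue_integral_def g_def mult_ac)
  show ?thesis
    unfolding eq continuous_on_sequentially comp_def
  proof (intro allI ballI impI, elim conjE)
    fix X :: "nat \<Rightarrow> real" and t assume t: "t \<in> {0..}" "\<forall>n. X n \<in> {0..}" "X \<longlonglongrightarrow> t"
    show "(\<lambda>n. \<integral>x. g x * \<phi> (x * X n) \<partial>lborel) \<longlonglongrightarrow> (\<integral>x. g x * \<phi> (x * t) \<partial>lborel)"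
    proof (rule integral_dominated_convergence[where w="\<lambda>x. C * \<bar>g x\<bar>"])
      show "AE x in lborel. (\<lambda>n. g x * \<phi> (x * X n)) \<longlonglongrightarrow> g x * \<phi> (x * t)"
      proof (rule AE_I2)
        fix x
        have "isCont \<phi> (x * t)" using cont by (simp add: continuous_on_eq_continuous_at)
        thus "(\<lambda>n. g x * \<phi> (x * X n)) \<longlonglongrightarrow> g x * \<phi> (x * t)"
          by (rule tendsto_mult_left[OF isCont_tendsto_compose]) (intro tendsto_mult_left t)
      qed
      show "AE x in lborel. norm (g x * \<phi> (x * X n)) \<le> C * \<bar>g x\<bar>" for n
      proof (rule AE_I2)
        fix x show "norm (g x * \<phi> (x * X n)) \<le> C * \<bar>g x\<bar>"
        proof (cases "x \<le> 0")
          case False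
          hence "\<bar>\<phi> (x * X n)\<bar> \<le> C" using b[of "x * X n"] t by simp
          hence "\<bar>g x\<bar> * \<bar>\<phi> (x * X n)\<bar> \<le> \<bar>g x\<bar> * C" by (intro mult_left_mono) auto
          thus ?thesis by (simp add: abs_mult mult.commute)
        qed (simp add: g_def)
      qed
    qed (use g in auto)
  qed
qed

text \<open>
  The \<open>k\<close>-th derivative of the Hankel transform, obtained by differentiating under the integral. All
  of them are again Hankel transforms, with \<open>s\<close> raised by \<open>k\<close>.
\<close>

definition hankel_derivs :: "(real \<Rightarrow> real) \<Rightarrow> real \<Rightarrow> nat \<Rightarrow> real \<Rightarrow> real" where
  "hankel_derivs \<omega> s k t = (LINT x:{0<..}|lborel. (x ^ k * \<omega> x) * ((- 1) ^ k / pochhammer s k * bessel_clifford (s + real k) (x * t)))"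

lemma bessel_clifford_continuous: "s > 0 \<Longrightarrow> continuous_on UNIV (bessel_clifford s)"
  by (rule DERIV_continuous_on, rule has_field_derivative_at_within, rule bessel_clifford_deriv)

lemma hankel_derivs_continuous:
  assumes "s \<ge> 1 / 2" "set_integrable lborel {0<..} (\<lambda>x. x ^ k * \<omega> x)"
  shows "continuous_on {0..} (hankel_derivs \<omega> s k)"
  unfolding hankel_derivs_def[abs_def]
proof (rule dilation_continuous[OF assms(2)])
  show "continuous_on UNIV (\<lambda>z. (- 1) ^ k / pochhammer s k * bessel_clifford (s + real k) z)"
    using assms by (intro continuous_intros bessel_clifford_continuous) auto
  fix z :: real assume z: "z \<ge> 0"
  show "\<bar>(- 1) ^ k / pochhammer s k * bessel_clifford (s + real k) z\<bar> \<le> 1 / pochhammer s k"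
    using bessel_clifford_bounded[of "s + real k" z] assms z pochhammer_pos[of s k]
    by (simp add: abs_mult divide_le_cancel)
qed

lemma hankel_derivs_step:
  assumes s: "s \<ge> 1 / 2"
    and int: "set_integrable lborel {0<..} (\<lambda>x. x ^ k * \<omega> x)"
      "set_integrable lborel {0<..} (\<lambda>x. x ^ Suc k * \<omega> x)"
    and t: "t \<ge> 0"
  shows "(hankel_derivs \<omega> s k has_field_derivative hankel_derivs \<omega> s (Suc k) t) (at t within {0..})"
proof -
  let ?f = "\<lambda>x. x ^ k * \<omega> x"
  define c where "c j = (- 1) ^ j / pochhammer s j" for j
  have ck: "\<bar>c j\<bar> = 1 / pochhammer s j" for j
    using pochhammer_pos[of s j] s by (simp add: c_def abs_mult)
  have "((\<lambda>t. LINT x:{0<..}|lborel. ?f x * (c k * bessel_clifford (s + real k) (x * t))) has_field_derivative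
          (LINT x:{0<..}|lborel. (x * ?f x) * (c (Suc k) * bessel_clifford (s + real (Suc k)) (x * t)))) (at t within {0..})"
  proof (rule integral_dilation_has_derivative[OF int(1)])
    show "set_integrable lborel {0<..} (\<lambda>x. x * (x ^ k * \<omega> x))"
      using int(2) by (simp add: mult.assoc)
    fix z
    have "((\<lambda>z. c k * bessel_clifford (s + real k) z) has_field_derivative c k * (- bessel_clifford (s + real k + 1) z / (s + real k))) (at z)"
      using s by (intro DERIV_cmult bessel_clifford_deriv) auto
    also have "c k * (- bessel_clifford (s + real k + 1) z / (s + real k)) = c (Suc k) * bessel_clifford (s + real (Suc k)) z"
      using s by (simp add: c_def pochhammer_Suc add_ac)
    finally show "((\<lambda>z. c k * bessel_clifford (s + real k) z) has_field_derivative c (Suc k) * bessel_clifford (s + real (Suc k)) z) (at z)" .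
    have bb: "\<bar>c j * bessel_clifford (s + real j) z\<bar> \<le> \<bar>c j\<bar>" if "z \<ge> 0" for j z
      using bessel_clifford_bounded[of "s + real j" z] s that
      by (simp add: abs_mult mult_left_le)
    show "\<bar>c k * bessel_clifford (s + real k) z\<bar> \<le> \<bar>c k\<bar>" "\<bar>c (Suc k) * bessel_clifford (s + real (Suc k)) z\<bar> \<le> \<bar>c (Suc k)\<bar>"
      if "z \<ge> 0" using bb that by blast+
  next
    show "continuous_on UNIV (\<lambda>z. c (Suc k) * bessel_clifford (s + real (Suc k)) z)"
      using s by (intro continuous_intros bessel_clifford_continuous) auto
  qed (use t in auto)
  moreover have e1: "hankel_derivs \<omega> s k = (\<lambda>t. LINT x:{0<..}|lborel. ?f x * (c k * bessel_clifford (s + real k) (x * t)))"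
    unfolding hankel_derivs_def[abs_def] c_def by (rule refl)
  moreover have e2: "hankel_derivs \<omega> s (Suc k) t = (LINT x:{0<..}|lborel. (x * ?f x) * (c (Suc k) * bessel_clifford (s + real (Suc k)) (x * t)))"
    unfolding hankel_derivs_def c_def by (simp only: power_Suc[of x k for x] mult.assoc)
  ultimately show ?thesis unfolding e1 e2 by blast
qed

text \<open>
  The Taylor coefficients at zero are moments of \<open>\<omega>\<close>; they are matched with the coefficients in the
  moment formula of the convolution.
\<close>

lemma hankel_derivs_at_0:
  "hankel_derivs \<omega> s k 0 = (- 1) ^ k / pochhammer s k * (LINT x:{0<..}|lborel. x ^ k * \<omega> x)"
  unfolding hankel_derivs_def by (simp add: set_integral_mult_left mult.commute)

text \<open>
  At zero the Hankel transform is defined as a limit from the right, which continuity evaluates.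
\<close>

lemma hankel_eq_hankel_derivs:
  assumes \<nu>: "\<nu> \<ge> - 1 / 2" and int: "set_integrable lborel {0<..} \<omega>" and t: "t \<ge> 0"
  shows "hankel \<nu> \<omega> t = hankel_derivs \<omega> (\<nu> + 1) 0 t"
proof -
  have pos: "hankel_pos \<nu> \<omega> t = hankel_derivs \<omega> (\<nu> + 1) 0 t" if "t > 0" for t
  proof -
    define X where "X x = \<omega> x * (BesselJ \<nu> (2 * sqrt (x * t)) / (t * x) powr (\<nu> / 2))" for x
    have "hankel_pos \<nu> \<omega> t = Gamma (\<nu> + 1) * (LINT x:{0<..}|lborel. X x)"
      by (simp only: hankel_pos_def X_def)
    also have "\<dots> = (LINT x:{0<..}|lborel. Gamma (\<nu> + 1) * X x)"
      by (simp only: set_integral_mult_right)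
    also have "\<dots> = (LINT x:{0<..}|lborel. \<omega> x * bessel_clifford (\<nu> + 1) (x * t))"
    proof (intro set_lebesgue_integral_cong allI impI)
      fix x :: real assume "x \<in> {0<..}"
      thus "Gamma (\<nu> + 1) * X x = \<omega> x * bessel_clifford (\<nu> + 1) (x * t)"
      proof -
        have h: "bessel_clifford (\<nu> + 1) (x * t) = Gamma (\<nu> + 1) * (BesselJ \<nu> (2 * sqrt (x * t)) / (x * t) powr (\<nu> / 2))"
          by (rule hankel_kernel_bessel_clifford[symmetric]) (use \<nu> that \<open>x \<in> {0<..}\<close> in auto)
        show ?thesis unfolding X_def h mult.commute[of t x] by (rule mult.left_commute)
      qed
    qed auto
    finally show ?thesis by (simp add: hankel_derivs_def)
  qed
  show ?thesis
  proof (cases "t = 0")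
    case False thus ?thesis using pos[of t] t by (simp add: hankel_def)
  next
    case True
    have "continuous_on {0..} (hankel_derivs \<omega> (\<nu> + 1) 0)"
      using \<nu> int by (intro hankel_derivs_continuous) auto
    hence "(hankel_derivs \<omega> (\<nu> + 1) 0 \<longlongrightarrow> hankel_derivs \<omega> (\<nu> + 1) 0 0) (at 0 within {0..})"
      by (auto simp: continuous_on_def)
    hence "(hankel_derivs \<omega> (\<nu> + 1) 0 \<longlongrightarrow> hankel_derivs \<omega> (\<nu> + 1) 0 0) (at_right 0)"
      by (simp add: at_within_Ici_at_right)
    hence "(hankel_pos \<nu> \<omega> \<longlongrightarrow> hankel_derivs \<omega> (\<nu> + 1) 0 0) (at_right 0)"
      by (rule Lim_transform_eventually) 
         (use eventually_at_right_less[of "0::real"] pos in \<open>auto elim: eventually_mono\<close>)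
    hence "Lim (at_right 0) (hankel_pos \<nu> \<omega>) = hankel_derivs \<omega> (\<nu> + 1) 0 0"
      by (intro tendsto_Lim) auto
    thus ?thesis using True by (simp add: hankel_def)
  qed
qed

section \<open>Derivatives of the reciprocal Hankel transform\<close>

text \<open>
  Pascal's rule in the form needed for induction on the order of a Leibniz or binomial expansion.
\<close>

lemma sum_choose_Suc:
  fixes f :: "nat \<Rightarrow> 'a :: comm_semiring_1"
  shows "(\<Sum>k\<le>Suc m. of_nat (Suc m choose k) * f k) = (\<Sum>k\<le>m. of_nat (m choose k) * (f k + f (Suc k)))"
proof -
  have "(\<Sum>k\<le>Suc m. of_nat (Suc m choose k) * f k) = 
     f 0 + (\<Sum>k\<le>m. of_nat ((m choose Suc k) + (m choose k)) * f (Suc k))"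
    by (subst sum.atMost_Suc_shift) (simp add: add.commute)
  also have "\<dots> = (f 0 + (\<Sum>k\<le>m. of_nat (m choose Suc k) * f (Suc k))) + (\<Sum>k\<le>m. of_nat (m choose k) * f (Suc k))"
    by (simp add: sum.distrib algebra_simps)
  also have "f 0 + (\<Sum>k\<le>m. of_nat (m choose Suc k) * f (Suc k)) = (\<Sum>k\<le>Suc m. of_nat (m choose k) * f k)"
    by (subst sum.atMost_Suc_shift) simp
  also have "\<dots> = (\<Sum>k\<le>m. of_nat (m choose k) * f k)" by (simp add: binomial_eq_0)
  finally show ?thesis by (simp add: sum.distrib algebra_simps)
qed

text \<open>
  Candidates for the derivatives of \<open>1 / h\<^sub>0\<close>, where \<open>h\<^sub>k\<close> are the derivatives of \<open>h\<^sub>0\<close>: the Leibniz rule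
  for \<open>(1 / h\<^sub>0) h\<^sub>0 = 1\<close> solved for the highest one. In this form the relation to formal
  inversion of power series is built in.
\<close>

fun recip_derivs :: "(nat \<Rightarrow> real \<Rightarrow> real) \<Rightarrow> nat \<Rightarrow> real \<Rightarrow> real" where
  "recip_derivs h k t = (if k = 0 then 1 / h 0 t
     else - (\<Sum>i<k. real (k choose i) * recip_derivs h i t * h (k - i) t) / h 0 t)"

declare recip_derivs.simps [simp del]

lemma recip_derivs_leibniz:
  assumes "h 0 t \<noteq> 0"
  shows "(\<Sum>i\<le>k. real (k choose i) * recip_derivs h i t * h (k - i) t) = (if k = 0 then 1 else 0)"
proof (cases "k = 0")
  case True thus ?thesis using assms by (simp add: recip_derivs.simps)
next
  case False
  have "{..k} = insert k {..<k}" by auto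
  thus ?thesis using assms False by (simp add: recip_derivs.simps[of h k])
qed

text \<open>
  Differentiating the defining relation of order \<open>k\<close> and collecting terms with Pascal's rule gives
  the defining relation of order \<open>k + 1\<close>.
\<close>

lemma recip_derivs_deriv:
  assumes h: "\<And>k t. k < N \<Longrightarrow> t \<in> T \<Longrightarrow> (h k has_field_derivative h (Suc k) t) (at t within U)"
    and nz: "\<And>t. t \<in> T \<Longrightarrow> h 0 t \<noteq> 0"
    and k: "k < N" and t: "t \<in> T"
  shows "(recip_derivs h k has_field_derivative recip_derivs h (Suc k) t) (at t within U)"
  using k t
proof (induction k arbitrary: t rule: less_induct)
  case (less k)
  let ?G = "recip_derivs h"
  note t = less.prems(2)
  have h0: "(h 0 has_field_derivative h 1 t) (at t within U)" using h[of 0 t] less.prems by simp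
  show ?case
  proof (cases "k = 0")
    case True
    have "?G k = (\<lambda>t. 1 / h 0 t)" using True by (simp add: recip_derivs.simps fun_eq_iff)
    moreover have "?G (Suc k) t = - h 1 t / (h 0 t)\<^sup>2"
      using nz[OF t] True by (simp add: recip_derivs.simps[of h "Suc 0"] recip_derivs.simps[of h 0] power2_eq_square)
    moreover have "((\<lambda>t. 1 / h 0 t) has_field_derivative - h 1 t / (h 0 t)\<^sup>2) (at t within U)"
      using nz[OF t] h0 by (auto intro!: derivative_eq_intros simp: power2_eq_square)
    ultimately show ?thesis by simp
  next
    case False
    define S where "S t = (\<Sum>i<k. real (k choose i) * ?G i t * h (k - i) t)" for t
    define S' where "S' = (\<Sum>i<k. real (k choose i) * (?G i t * h (Suc k - i) t + ?G (Suc i) t * h (Suc k - Suc i) t))"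
    have G: "?G k = (\<lambda>t. - S t / h 0 t)" using False by (simp add: recip_derivs.simps[of h k] fun_eq_iff S_def)
    have "(S has_field_derivative S') (at t within U)"
      unfolding S_def[abs_def] S'_def
    proof (rule DERIV_sum)
      fix i assume i: "i \<in> {..<k}"
      have 1: "(?G i has_field_derivative ?G (Suc i) t) (at t within U)"
        using less i by auto
      have 2: "(h (k - i) has_field_derivative h (Suc (k - i)) t) (at t within U)"
        using h[of "k - i" t] less.prems by simp
      have "((\<lambda>t. real (k choose i) * (?G i t * h (k - i) t)) has_field_derivative
         real (k choose i) * (?G i t * h (Suc (k - i)) t + ?G (Suc i) t * h (k - i) t)) (at t within U)"
        by (rule DERIV_cmult) (rule DERIV_mult'[OF 1 2])
      moreover have "Suc (k - i) = Suc k - i" using i by auto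
      ultimately show "((\<lambda>t. real (k choose i) * ?G i t * h (k - i) t) has_field_derivative
         real (k choose i) * (?G i t * h (Suc k - i) t + ?G (Suc i) t * h (Suc k - Suc i) t)) (at t within U)"
        by (simp add: mult.assoc)
    qed
    hence d: "((\<lambda>t. - S t / h 0 t) has_field_derivative - (S' + ?G k t * h 1 t) / h 0 t) (at t within U)"
      using nz[OF t] h0 unfolding G
      by (auto intro!: derivative_eq_intros simp: divide_simps)
    define f where "f i = ?G i t * h (Suc k - i) t" for i
    have "(\<Sum>i\<le>Suc k. real (Suc k choose i) * f i) = (\<Sum>i\<le>k. real (k choose i) * (f i + f (Suc i)))"
      by (rule sum_choose_Suc)
    moreover have "{..k} = insert k {..<k}" "{..Suc k} = insert (Suc k) {..<Suc k}" by auto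
    ultimately have "(\<Sum>i<Suc k. real (Suc k choose i) * f i) = (\<Sum>i<k. real (k choose i) * (f i + f (Suc i))) + f k"
      by (simp del: sum.lessThan_Suc)
    hence "(\<Sum>i<Suc k. real (Suc k choose i) * ?G i t * h (Suc k - i) t) = S' + ?G k t * h 1 t"
      by (simp add: f_def S'_def mult.assoc del: sum.lessThan_Suc)
    hence "?G (Suc k) t = - (S' + ?G k t * h 1 t) / h 0 t"
      by (simp only: recip_derivs.simps[of h "Suc k"]) simp
    thus ?thesis using d G by simp
  qed
qed

text \<open>
  The Taylor coefficients of the reciprocal Hankel transform, with alternating signs, and the
  normalised moments of \<open>\<omega>\<close> are coefficients of mutually inverse power series. Only an interval
  \<open>[0, \<delta>)\<close> on which the transform does not vanish matters for iterated derivatives at zero.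
\<close>

lemma hankel_reciprocal_derivs:
  fixes \<omega> :: "real \<Rightarrow> real"
  assumes \<nu>: "\<nu> \<ge> - 1 / 2" and n: "n \<ge> 1"
    and \<omega>: "\<And>k. k < n \<Longrightarrow> set_integrable lborel {0<..} (\<lambda>x. x ^ k * \<omega> x)"
    and mass: "(LINT x:{0<..}|lborel. \<omega> x) > 0"
  obtains \<delta> g where "\<delta> > 0" "\<forall>t\<in>{0..<\<delta>}. g 0 t = 1 / hankel \<nu> \<omega> t"
    "\<forall>k<n - 1. \<forall>t\<in>{0..<\<delta>}. (g k has_field_derivative g (Suc k) t) (at t within {0..})"
    "\<forall>k. (\<Sum>i\<le>k. ((- 1) ^ i * g i 0 / fact i) *
        ((LINT x:{0<..}|lborel. x ^ (k - i) * \<omega> x) / (pochhammer (\<nu> + 1) (k - i) * fact (k - i)))) = (if k = 0 then 1 else 0 :: real)"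
proof -
  define h where "h = hankel_derivs \<omega> (\<nu> + 1)"
  have s: "\<nu> + 1 \<ge> 1 / 2" using \<nu> by simp
  have \<omega>0: "set_integrable lborel {0<..} \<omega>" using \<omega>[of 0] n by simp
  have h0: "h 0 0 > 0" using mass by (simp add: h_def hankel_derivs_at_0)
  have "continuous_on {0..} (h 0)" unfolding h_def using s \<omega>0 by (intro hankel_derivs_continuous) auto
  hence "(h 0 \<longlongrightarrow> h 0 0) (at 0 within {0..})" by (auto simp: continuous_on_def)
  hence "eventually (\<lambda>t. h 0 t > 0) (at 0 within {0..})" using h0 by (rule order_tendstoD)
  then obtain \<delta> where \<delta>: "\<delta> > 0" "\<And>t. t \<in> {0..} \<Longrightarrow> t \<noteq> 0 \<Longrightarrow> dist t 0 < \<delta> \<Longrightarrow> h 0 t > 0"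
    by (auto simp: eventually_at)
  have nz: "h 0 t \<noteq> 0" if "t \<in> {0..<\<delta>}" for t
    using \<delta>(2)[of t] h0 that by (cases "t = 0") (auto simp: dist_real_def)
  show ?thesis
  proof (rule that[of \<delta> "recip_derivs h"])
    show "\<forall>t\<in>{0..<\<delta>}. recip_derivs h 0 t = 1 / hankel \<nu> \<omega> t"
      using hankel_eq_hankel_derivs[OF \<nu> \<omega>0] by (simp add: recip_derivs.simps h_def)
    show "\<forall>k<n - 1. \<forall>t\<in>{0..<\<delta>}. (recip_derivs h k has_field_derivative recip_derivs h (Suc k) t) (at t within {0..})"
    proof (intro allI impI ballI)
      fix k t assume kt: "k < n - 1" "t \<in> {0..<\<delta>}"
      show "(recip_derivs h k has_field_derivative recip_derivs h (Suc k) t) (at t within {0..})"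
      proof (rule recip_derivs_deriv[where N="n - 1" and T="{0..<\<delta>}"])
        show "(h k has_field_derivative h (Suc k) t) (at t within {0..})" if "k < n - 1" "t \<in> {0..<\<delta>}" for k t
          unfolding h_def using that \<omega>[of k] \<omega>[of "Suc k"] s by (intro hankel_derivs_step) auto
      qed (use nz kt in auto)
    qed
    show "\<forall>k. (\<Sum>i\<le>k. ((- 1) ^ i * recip_derivs h i 0 / fact i) *
        ((LINT x:{0<..}|lborel. x ^ (k - i) * \<omega> x) / (pochhammer (\<nu> + 1) (k - i) * fact (k - i)))) = (if k = 0 then 1 else 0)"
    proof
      fix k
      have "((- 1) ^ i * recip_derivs h i 0 / fact i) *
        ((LINT x:{0<..}|lborel. x ^ (k - i) * \<omega> x) / (pochhammer (\<nu> + 1) (k - i) * fact (k - i))) =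
        ((- 1) ^ k / fact k) * (real (k choose i) * recip_derivs h i 0 * h (k - i) 0)" if i: "i \<le> k" for i
      proof -
        have b: "real (k choose i) = fact k / (fact i * fact (k - i))" using i by (rule binomial_fact)
        have sg: "(- 1 :: real) ^ k = (- 1) ^ i * (- 1) ^ (k - i)" using i by (simp add: power_add[symmetric])
        have "(- 1 :: real) ^ k * (- 1) ^ (k - i) = (- 1) ^ i" unfolding sg by (simp add: mult.assoc)
        hence "((- 1) ^ k / fact k) * (real (k choose i) * recip_derivs h i 0 * h (k - i) 0) =
          (- 1) ^ i * (1 / (fact i * fact (k - i)) * recip_derivs h i 0 * 
          ((LINT x:{0<..}|lborel. x ^ (k - i) * \<omega> x) / pochhammer (\<nu> + 1) (k - i)))"
          by (simp add: h_def hankel_derivs_at_0 b)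
        thus ?thesis by (simp add: mult_ac)
      qed
      hence "(\<Sum>i\<le>k. ((- 1) ^ i * recip_derivs h i 0 / fact i) *
        ((LINT x:{0<..}|lborel. x ^ (k - i) * \<omega> x) / (pochhammer (\<nu> + 1) (k - i) * fact (k - i)))) =
        ((- 1) ^ k / fact k) * (\<Sum>i\<le>k. real (k choose i) * recip_derivs h i 0 * h (k - i) 0)"
        unfolding sum_distrib_left by (intro sum.cong) auto
      also have "\<dots> = (if k = 0 then 1 else 0)" 
        using recip_derivs_leibniz[of h 0 k] h0 by simp
      finally show "(\<Sum>i\<le>k. ((- 1) ^ i * recip_derivs h i 0 / fact i) *
        ((LINT x:{0<..}|lborel. x ^ (k - i) * \<omega> x) / (pochhammer (\<nu> + 1) (k - i) * fact (k - i)))) = (if k = 0 then 1 else 0)" .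
    qed
  qed (use \<delta> in auto)
qed

section \<open>The operator \<open>r - \<partial>\<^sub>t D\<close> and its exponential average\<close>

text \<open>
  The operators \<open>\<partial>\<^sub>t\<close> and \<open>D\<close> act on different factors, so the power expands by the binomial
  theorem. The claim is needed for all \<open>t\<close> near zero, since the next application differentiates in \<open>t\<close>.
\<close>

lemma mixed_op_pow:
  assumes F: "\<And>t z. t \<in> {0..<\<delta>} \<Longrightarrow> z > 0 \<Longrightarrow> F t z = g 0 t * poly P z"
    and g: "\<And>k t. k < N \<Longrightarrow> t \<in> {0..<\<delta>} \<Longrightarrow> (g k has_field_derivative g (Suc k) t) (at t within {0..})"
    and m: "m \<le> N" and t: "t \<in> {0..<\<delta>}" and z: "z > 0"
  shows "(mixed_op \<nu> r ^^ m) F t z =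
    (\<Sum>k\<le>m. real (m choose k) * (r ^ (m - k) * (- 1) ^ k * g k t * poly ((bessel_op (\<nu> + 1) ^^ k) P) z))"
  using m t z
proof (induction m arbitrary: t z)
  case 0 thus ?case by (simp add: F)
next
  case (Suc m)
  define D where "D k = (bessel_op (\<nu> + 1) ^^ k) P" for k
  define c where "c k = real (m choose k) * (r ^ (m - k) * (- 1) ^ k)" for k
  let ?F = "(mixed_op \<nu> r ^^ m) F"
  have IH: "?F t z = (\<Sum>k\<le>m. c k * (g k t * poly (D k) z))" if "t \<in> {0..<\<delta>}" "z > 0" for t z
    using Suc that by (simp add: c_def D_def mult.assoc)
  have op: "poly_op \<nu> (?F s) z = (\<Sum>k\<le>m. c k * (g k s * poly (D (Suc k)) z))" if "s \<in> {0..<\<delta>}" for s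
  proof -
    have "poly_op \<nu> (?F s) z = poly (bessel_op (\<nu> + 1) (\<Sum>k\<le>m. Polynomial.smult (c k * g k s) (D k))) z"
      using that Suc.prems by (intro poly_op_poly) (auto simp: IH poly_sum mult.assoc)
    thus ?thesis by (simp add: bessel_op_sum bessel_op_smult poly_sum D_def mult.assoc)
  qed
  have "((\<lambda>s. \<Sum>k\<le>m. c k * (g k s * poly (D (Suc k)) z)) has_field_derivative
      (\<Sum>k\<le>m. c k * (g (Suc k) t * poly (D (Suc k)) z))) (at t within {0..})"
    using Suc.prems by (intro DERIV_sum DERIV_cmult DERIV_cmult_right g) auto
  hence "((\<lambda>s. \<Sum>k\<le>m. c k * (g k s * poly (D (Suc k)) z)) has_vector_derivative
      (\<Sum>k\<le>m. c k * (g (Suc k) t * poly (D (Suc k)) z))) (at t within {0..})"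
    by (rule has_real_derivative_iff_has_vector_derivative[THEN iffD1])
  hence "((\<lambda>s. poly_op \<nu> (?F s) z) has_vector_derivative
      (\<Sum>k\<le>m. c k * (g (Suc k) t * poly (D (Suc k)) z))) (at t within {0..})"
  proof (rule has_vector_derivative_transform_within)
    show "0 < \<delta> - t" using Suc.prems by auto
    show "(\<Sum>k\<le>m. c k * (g k s * poly (D (Suc k)) z)) = poly_op \<nu> (?F s) z"
      if "s \<in> {0..}" "dist s t < \<delta> - t" for s
      using that by (intro op[symmetric]) (auto simp: dist_real_def)
  qed (use Suc.prems in auto)
  moreover have "at t within {0..} \<noteq> bot"
  proof -
    have "t islimpt {t<..<t+1}" by (rule islimpt_greaterThanLessThan1) simp
    hence "t islimpt {0..}" by (rule islimpt_subset) (use Suc.prems in auto)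
    thus ?thesis by (simp add: trivial_limit_within)
  qed
  ultimately have vd: "vector_derivative (\<lambda>s. poly_op \<nu> (?F s) z) (at t within {0..})
     = (\<Sum>k\<le>m. c k * (g (Suc k) t * poly (D (Suc k)) z))"
    by (intro vector_derivative_within)
  define f where "f k = r ^ (Suc m - k) * (- 1) ^ k * g k t * poly (D k) z" for k
  have "(mixed_op \<nu> r ^^ Suc m) F t z = r * ?F t z - vector_derivative (\<lambda>s. poly_op \<nu> (?F s) z) (at t within {0..})"
    by (simp add: mixed_op_def)
  also have "\<dots> = (\<Sum>k\<le>m. r * (c k * (g k t * poly (D k) z)) - c k * (g (Suc k) t * poly (D (Suc k)) z))"
    unfolding vd using Suc.prems by (simp add: IH sum_distrib_left sum_subtractf)
  also have "\<dots> = (\<Sum>k\<le>m. real (m choose k) * (f k + f (Suc k)))"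
    by (intro sum.cong refl) (auto simp: c_def f_def Suc_diff_le algebra_simps)
  also have "\<dots> = (\<Sum>k\<le>Suc m. real (Suc m choose k) * f k)"
    by (rule sum_choose_Suc[symmetric])
  finally show ?case by (simp add: f_def D_def)
qed

lemma exp_moment:
  "has_bochner_integral lborel (\<lambda>r. indicat_real {0<..} r * (exp (- r) * r ^ k)) (fact k)"
proof (rule has_bochner_integral_nn_integral)
  have "(\<integral>\<^sup>+ r. ennreal (indicat_real {0<..} r * (exp (- r) * r ^ k)) \<partial>lborel) =
      (\<integral>\<^sup>+ r. ennreal (r ^ k * exp (- r)) * indicator {0..} r \<partial>lborel)"
  proof (rule nn_integral_cong_AE)
    have "AE r in lborel. (r::real) \<noteq> 0" by (rule AE_lborel_singleton)
    thus "AE r in lborel. ennreal (indicat_real {0<..} r * (exp (- r) * r ^ k)) =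
        ennreal (r ^ k * exp (- r)) * indicator {0..} r"
      by eventually_elim (auto simp: indicator_def mult.commute)
  qed
  also have "\<dots> = real_of_nat (fact k)" by (rule nn_intergal_power_times_exp_Ici)
  finally show "(\<integral>\<^sup>+ r. ennreal (indicat_real {0<..} r * (exp (- r) * r ^ k)) \<partial>lborel) = ennreal (fact k)"
    by simp
qed (auto simp: indicator_def)

text \<open>
  The Gamma integral \<open>\<integral> exp(- r) r\<^sup>N\<^sup>-\<^sup>k dr = (N - k)!\<close> reduces the binomial coefficients over \<open>N!\<close> to
  \<open>1 / k!\<close>, the weights of a Taylor series.
\<close>

lemma exp_binomial_integral:
  "(LINT r:{0<..}|lborel. exp (- r) * (a * ((\<Sum>k\<le>N. real (N choose k) * (r ^ (N - k) * c k)) / fact N)))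
    = a * (\<Sum>k\<le>N. c k / fact k)"
proof -
  have "has_bochner_integral lborel (\<lambda>r. \<Sum>k\<le>N. (a * real (N choose k) * c k / fact N) * (indicat_real {0<..} r * (exp (- r) * r ^ (N - k))))
     (\<Sum>k\<le>N. (a * real (N choose k) * c k / fact N) * fact (N - k))"
    by (intro has_bochner_integral_sum has_bochner_integral_mult_right exp_moment)
  hence "(\<integral>r. (\<Sum>k\<le>N. (a * real (N choose k) * c k / fact N) * (indicat_real {0<..} r * (exp (- r) * r ^ (N - k)))) \<partial>lborel)
     = (\<Sum>k\<le>N. (a * real (N choose k) * c k / fact N) * fact (N - k))"
    by (rule has_bochner_integral_integral_eq)
  also have "\<dots> = (\<Sum>k\<le>N. a * (c k / fact k))"
    by (intro sum.cong refl) (simp add: binomial_fact)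
  also have "(\<lambda>r. (\<Sum>k\<le>N. (a * real (N choose k) * c k / fact N) * (indicat_real {0<..} r * (exp (- r) * r ^ (N - k))))) =
     (\<lambda>r. indicat_real {0<..} r * (exp (- r) * (a * ((\<Sum>k\<le>N. real (N choose k) * (r ^ (N - k) * c k)) / fact N))))"
    by (simp add: sum_distrib_left sum_distrib_right sum_divide_distrib fun_eq_iff mult_ac)
  finally show ?thesis by (simp add: set_lebesgue_integral_def sum_distrib_left)
qed

section \<open>Bi-orthonormal functions and the kernel\<close>

lemma moments_from_powr:
  assumes "\<forall>\<kappa>\<in>{1..real n}. set_integrable lborel {0<..} (\<lambda>x. x powr (\<kappa> - 1) * f x)" and k: "k < n"
  shows "set_integrable lborel {0<..} (\<lambda>x. x ^ k * f x)"
proof -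
  have "set_integrable lborel {0<..} (\<lambda>x. x powr (real (Suc k) - 1) * f x)"
    using assms by (intro assms(1)[rule_format]) auto
  also have "?this \<longleftrightarrow> ?thesis"
    by (intro set_integrable_cong) (auto simp: powr_realpow)
  finally show ?thesis .
qed

text \<open>
  If the first weight vanished almost everywhere, then so would a row of the determinant, and the
  normalisation integral would be zero, making the normalisation constant \<open>fact n / 0 = 0\<close>.
\<close>

lemma weight_not_null:
  assumes n: "n \<ge> 1" and pos: "0 < norm_const n w"
  shows "\<not> (AE x in lborel. x > 0 \<longrightarrow> w 1 x = 0)"
proof
  assume "AE x in lborel. x > 0 \<longrightarrow> w 1 x = 0"
  then obtain N where N: "{x \<in> space lborel. \<not> (x > 0 \<longrightarrow> w 1 x = 0)} \<subseteq> N" "emeasure lborel N = 0" "N \<in> sets lborel"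
    by (rule AE_E)
  interpret product_sigma_finite "\<lambda>_::nat. lborel :: real measure"
    by standard
  define Z where "Z c = Pi\<^sub>E {1..n} (\<lambda>i. if i = c then N else UNIV)" for c
  have Z: "Z c \<in> null_sets (lborel_vec n)" if "c \<in> {1..n}" for c
  proof -
    have "emeasure (lborel_vec n) (Z c) = (\<Prod>i\<in>{1..n}. emeasure lborel (if i = c then N else UNIV))"
      unfolding lborel_vec_def Z_def using N by (intro emeasure_PiM) auto
    also have "\<dots> = 0" using that N by (intro prod_zero) auto
    moreover have "Z c \<in> sets (lborel_vec n)"
      unfolding lborel_vec_def Z_def using N by (intro sets_PiM_I_finite) auto
    ultimately show ?thesis by (simp add: null_sets_def)
  qed
  have zero: "weight_det n w a = 0" if "a \<in> pos_vec n" "a \<notin> (\<Union>c\<in>{1..n}. Z c)" for a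
  proof -
    have w0: "w 1 (a c) = 0" if c: "c \<in> {1..n}" for c
    proof -
      have "a \<notin> Z c" using that \<open>a \<notin> _\<close> by blast
      hence "a c \<notin> N" using \<open>a \<in> pos_vec n\<close> by (auto simp: Z_def pos_vec_def PiE_iff split: if_splits)
      moreover have "a c > 0" using \<open>a \<in> pos_vec n\<close> c by (auto simp: pos_vec_def)
      ultimately show ?thesis using N(1) by auto
    qed
    have "(\<Prod>i = 0..<n. Matrix.mat n n (\<lambda>(b, c). w (Suc b) (a (Suc c))) $$ (i, \<pi> i)) = 0"
      if "\<pi> permutes {0..<n}" for \<pi>
    proof (rule prod_zero)
      have "\<pi> 0 < n" using permutes_in_image[OF that, of 0] n by auto
      thus "\<exists>i\<in>{0..<n}. Matrix.mat n n (\<lambda>(b, c). w (Suc b) (a (Suc c))) $$ (i, \<pi> i) = 0"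
        using n w0[of "Suc (\<pi> 0)"] by (intro bexI[of _ 0]) auto
    qed auto
    thus ?thesis unfolding weight_det_def by (subst det_def'[of _ n]) (auto intro!: sum.neutral)
  qed
  have "(\<Union>c\<in>{1..n}. Z c) \<in> null_sets (lborel_vec n)"
    using Z by (intro null_sets_UN') auto
  hence "AE a in lborel_vec n. a \<notin> (\<Union>c\<in>{1..n}. Z c)" by (rule AE_not_in)
  hence "AE a in lborel_vec n. indicator (pos_vec n) a *\<^sub>R (Vandermonde n a * weight_det n w a) = 0"
    by eventually_elim (use zero in \<open>auto simp: indicator_def\<close>)
  hence "(LINT a:pos_vec n|lborel_vec n. Vandermonde n a * weight_det n w a) = 0"
    unfolding set_lebesgue_integral_def by (rule integral_eq_zero_AE)
  thus False using pos by (simp add: norm_const_def)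
qed

lemma mass_pos:
  fixes f :: "real \<Rightarrow> real"
  assumes "set_integrable lborel {0<..} f" "\<forall>x>0. 0 \<le> f x" "\<not> (AE x in lborel. x > 0 \<longrightarrow> f x = 0)"
  shows "(LINT x:{0<..}|lborel. f x) > 0"
proof -
  have nn: "AE x in lborel. 0 \<le> indicator {0<..} x *\<^sub>R f x" using assms(2) by (auto simp: indicator_def)
  have "(LINT x:{0<..}|lborel. f x) \<ge> 0" unfolding set_lebesgue_integral_def by (rule integral_nonneg_AE[OF nn])
  moreover have "(LINT x:{0<..}|lborel. f x) \<noteq> 0"
  proof
    assume "(LINT x:{0<..}|lborel. f x) = 0"
    hence "AE x in lborel. indicator {0<..} x *\<^sub>R f x = 0"
      using integral_nonneg_eq_0_iff_AE[OF assms(1)[unfolded set_integrable_def] nn]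
      by (simp add: set_lebesgue_integral_def)
    hence "AE x in lborel. x > 0 \<longrightarrow> f x = 0" by eventually_elim (auto simp: indicator_def)
    thus False using assms(3) by blast
  qed
  ultimately show ?thesis by simp
qed

lemma fun_span_monomials:
  assumes n: "n \<ge> 1"
  shows "fun_span n (\<lambda>j y. y ^ j) = {\<lambda>y\<in>{0<..}. poly Q y |Q. degree Q < n}"
proof (intro equalityI subsetI)
  fix f assume "f \<in> fun_span n (\<lambda>j y. y ^ j)"
  then obtain c :: "nat \<Rightarrow> real" where f: "f = (\<lambda>y\<in>{0<..}. \<Sum>j<n. c j * y ^ j)" by (auto simp: fun_span_def)
  define Q where "Q = (\<Sum>j<n. Polynomial.monom (c j) j)"
  have "degree Q \<le> n - 1" unfolding Q_def
    by (intro degree_sum_le) (auto intro: le_trans[OF degree_monom_le])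
  hence "degree Q < n" using n by simp
  moreover have "f = (\<lambda>y\<in>{0<..}. poly Q y)" by (simp add: f Q_def poly_sum poly_monom)
  ultimately show "f \<in> {\<lambda>y\<in>{0<..}. poly Q y |Q. degree Q < n}" by blast
next
  fix f :: "real \<Rightarrow> real" assume "f \<in> {\<lambda>y\<in>{0<..}. poly Q y |Q. degree Q < n}"
  then obtain Q where Q: "degree Q < n" "f = (\<lambda>y\<in>{0<..}. poly Q y)" by blast
  have "poly Q y = (\<Sum>j<n. coeff Q j * y ^ j)" for y
    unfolding poly_altdef using Q by (intro sum.mono_neutral_left) (auto simp: coeff_eq_0)
  hence "f = (\<lambda>y\<in>{0<..}. \<Sum>j<n. coeff Q j * y ^ j)" using Q(2) by simp
  thus "f \<in> fun_span n (\<lambda>j y. y ^ j)" unfolding fun_span_def by blast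
qed

lemma fun_span_eq_restrict:
  assumes "\<And>j y. j < n \<Longrightarrow> y > 0 \<Longrightarrow> F j y = G j y"
  shows "fun_span n F = fun_span n G"
proof -
  have "(\<lambda>y\<in>{0<..}. \<Sum>j<n. c j * F j y) = (\<lambda>y\<in>{0<..}. \<Sum>j<n. c j * G j y)" for c :: "nat \<Rightarrow> real"
    using assms by (intro restrict_ext sum.cong) auto
  thus ?thesis by (simp add: fun_span_def)
qed

lemma poly_eqI_pos_reals:
  fixes P Q :: "real poly"
  assumes "\<And>y. y > 0 \<Longrightarrow> poly P y = poly Q y"
  shows "P = Q"
proof (rule ccontr)
  assume "P \<noteq> Q"
  hence "finite {x. poly (P - Q) x = 0}" by (intro poly_roots_finite) auto
  moreover have "{0<..} \<subseteq> {x. poly (P - Q) x = 0}" using assms by auto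
  ultimately have "finite {0::real<..}" by (rule finite_subset[rotated])
  thus False by (simp add: infinite_Ioi)
qed

lemma set_integral_lincomb:
  fixes f :: "'i \<Rightarrow> 'a \<Rightarrow> real"
  assumes "\<And>i. i \<in> I \<Longrightarrow> set_integrable M A (f i)"
  shows "set_integrable M A (\<lambda>x. \<Sum>i\<in>I. c i * f i x)"
    and "(LINT x:A|M. (\<Sum>i\<in>I. c i * f i x)) = (\<Sum>i\<in>I. c i * (LINT x:A|M. f i x))"
proof -
  have e: "(\<lambda>x. indicat_real A x *\<^sub>R (\<Sum>i\<in>I. c i * f i x)) = (\<lambda>x. \<Sum>i\<in>I. c i * (indicat_real A x *\<^sub>R f i x))"
    by (simp add: sum_distrib_left mult.left_commute)
  have i: "integrable M (\<lambda>x. c i * (indicat_real A x *\<^sub>R f i x))" if "i \<in> I" for i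
    using assms[OF that] unfolding set_integrable_def by (rule integrable_mult_right)
  show "set_integrable M A (\<lambda>x. \<Sum>i\<in>I. c i * f i x)"
    unfolding set_integrable_def e by (rule Bochner_Integration.integrable_sum[OF i])
  show "(LINT x:A|M. (\<Sum>i\<in>I. c i * f i x)) = (\<Sum>i\<in>I. c i * (LINT x:A|M. f i x))"
    unfolding set_lebesgue_integral_def e
    by (subst Bochner_Integration.integral_sum[OF i]) (simp_all only: integral_mult_right_zero)
qed

text \<open>
  The two families of coefficients agree: those of the averaged power, and those of the powers
  of \<open>D\<close> acting on monomials. Hence taking moments of a convolution amounts to applying a series
  in \<open>D\<close> to the polynomial first.
\<close>

lemma conv_moment_functional:
  fixes \<omega> \<sigma> :: "real \<Rightarrow> real" and Q :: "real poly"
  assumes \<nu>: "\<nu> \<ge> - 1 / 2" and Q: "degree Q < n"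
    and \<omega>: "\<And>k. k < n \<Longrightarrow> set_integrable lborel {0<..} (\<lambda>x. x ^ k * \<omega> x)"
    and \<sigma>: "\<And>k. k < n \<Longrightarrow> set_integrable lborel {0<..} (\<lambda>x. x ^ k * \<sigma> x)"
  defines "\<beta> \<equiv> \<lambda>k. (LINT x:{0<..}|lborel. x ^ k * \<omega> x) / (pochhammer (\<nu> + 1) k * fact k)"
  shows "set_integrable lborel {0<..} (\<lambda>y. poly Q y * conv \<nu> \<omega> \<sigma> y)"
    and "(LINT y:{0<..}|lborel. poly Q y * conv \<nu> \<omega> \<sigma> y) =
         (LINT y:{0<..}|lborel. poly (bessel_op_series (\<nu> + 1) n \<beta> Q) y * \<sigma> y)"
proof -
  let ?s = "\<nu> + 1"
  have s: "?s > 0" using \<nu> by simp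
  have expand: "poly Q y = (\<Sum>k<n. coeff Q k * y ^ k)" for y
    unfolding poly_altdef using Q by (intro sum.mono_neutral_left) (auto simp: coeff_eq_0)
  have conv_int: "set_integrable lborel {0<..} (\<lambda>y. y ^ k * conv \<nu> \<omega> \<sigma> y)" if "k < n" for k
    using that by (intro conv_Fubini(2) \<nu> \<omega> \<sigma>) auto
  have conv_mom: "(LINT y:{0<..}|lborel. y ^ k * conv \<nu> \<omega> \<sigma> y) =
      (\<Sum>i\<le>k. translation_coeff ?s k i * (LINT y:{0<..}|lborel. y ^ i * \<omega> y) * (LINT y:{0<..}|lborel. y ^ (k - i) * \<sigma> y))"
    if "k < n" for k
    using that by (intro conv_Fubini(3) \<nu> \<omega> \<sigma>) auto
  have e: "poly Q y * conv \<nu> \<omega> \<sigma> y = (\<Sum>k<n. coeff Q k * (y ^ k * conv \<nu> \<omega> \<sigma> y))" for y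
    by (simp add: expand sum_distrib_right mult.assoc)
  show "set_integrable lborel {0<..} (\<lambda>y. poly Q y * conv \<nu> \<omega> \<sigma> y)"
    unfolding e using conv_int by (intro set_integral_lincomb(1)) auto
  have "(LINT y:{0<..}|lborel. poly Q y * conv \<nu> \<omega> \<sigma> y) = (\<Sum>k<n. coeff Q k * (LINT y:{0<..}|lborel. y ^ k * conv \<nu> \<omega> \<sigma> y))"
    unfolding e using conv_int by (intro set_integral_lincomb(2)) auto
  also have "\<dots> = (\<Sum>k<n. coeff Q k * (\<Sum>i\<le>k. (\<beta> i * (fact k * pochhammer ?s k / (fact (k - i) * pochhammer ?s (k - i)))) *
        (LINT y:{0<..}|lborel. y ^ (k - i) * \<sigma> y)))"
    by (intro sum.cong refl) (simp add: conv_mom translation_coeff_def \<beta>_def mult_ac)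
  also have "\<dots> = (LINT y:{0<..}|lborel. \<Sum>k<n. coeff Q k * (\<Sum>i\<le>k. (\<beta> i * (fact k * pochhammer ?s k / (fact (k - i) * pochhammer ?s (k - i)))) *
        (y ^ (k - i) * \<sigma> y)))"
  proof -
    define \<gamma> where "\<gamma> k i = \<beta> i * (fact k * pochhammer ?s k / (fact (k - i) * pochhammer ?s (k - i)))" for k i
    have int: "set_integrable lborel {0<..} (\<lambda>y. y ^ (k - i) * \<sigma> y)" if "k < n" for k i
      using that by (intro \<sigma>) auto
    have "(LINT y:{0<..}|lborel. \<Sum>k<n. coeff Q k * (\<Sum>i\<le>k. \<gamma> k i * (y ^ (k - i) * \<sigma> y))) =
        (\<Sum>k<n. coeff Q k * (LINT y:{0<..}|lborel. (\<Sum>i\<le>k. \<gamma> k i * (y ^ (k - i) * \<sigma> y))))"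
      by (intro set_integral_lincomb int) auto
    also have "\<dots> = (\<Sum>k<n. coeff Q k * (\<Sum>i\<le>k. \<gamma> k i * (LINT y:{0<..}|lborel. y ^ (k - i) * \<sigma> y)))"
      by (intro sum.cong refl arg_cong2[where f="(*)"] set_integral_lincomb int) auto
    finally show ?thesis unfolding \<gamma>_def ..
  qed
  also have "\<dots> = (LINT y:{0<..}|lborel. poly (bessel_op_series ?s n \<beta> Q) y * \<sigma> y)"
  proof -
    have "Q = (\<Sum>k<n. Polynomial.smult (coeff Q k) (Polynomial.monom 1 k))"
      by (rule poly_eqI_pos_reals) (simp add: expand poly_sum poly_monom)
    hence "bessel_op_series ?s n \<beta> Q = (\<Sum>k<n. Polynomial.smult (coeff Q k) (bessel_op_series ?s n \<beta> (Polynomial.monom 1 k)))"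
      by (metis (no_types, lifting) bessel_op_series_sum bessel_op_series_smult sum.cong)
    moreover have "poly (bessel_op_series ?s n \<beta> (Polynomial.monom 1 k)) y =
       (\<Sum>i\<le>k. (\<beta> i * (fact k * pochhammer ?s k / (fact (k - i) * pochhammer ?s (k - i)))) * y ^ (k - i))"
      if k: "k < n" for k y
    proof -
      have "poly (bessel_op_series ?s n \<beta> (Polynomial.monom 1 k)) y = (\<Sum>i<n. \<beta> i * poly ((bessel_op ?s ^^ i) (Polynomial.monom 1 k)) y)"
        by (simp add: bessel_op_series_def poly_sum)
      also have "\<dots> = (\<Sum>i\<le>k. \<beta> i * poly ((bessel_op ?s ^^ i) (Polynomial.monom 1 k)) y)"
        using k by (intro sum.mono_neutral_right) (auto simp: bessel_op_pow_monom[OF s])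
      finally show ?thesis by (simp add: bessel_op_pow_monom[OF s] poly_monom mult.assoc)
    qed
    ultimately have "poly (bessel_op_series ?s n \<beta> Q) y * \<sigma> y = (\<Sum>k<n. coeff Q k * (\<Sum>i\<le>k. (\<beta> i * (fact k * pochhammer ?s k / (fact (k - i) * pochhammer ?s (k - i)))) *
        (y ^ (k - i) * \<sigma> y)))" for y
      by (simp add: poly_sum sum_distrib_right sum_distrib_left mult.assoc)
    thus ?thesis by simp
  qed
  finally show "(LINT y:{0<..}|lborel. poly Q y * conv \<nu> \<omega> \<sigma> y) =
         (LINT y:{0<..}|lborel. poly (bessel_op_series ?s n \<beta> Q) y * \<sigma> y)" .
qed

lemma fun_spanI: "f = (\<lambda>y\<in>{0<..}. \<Sum>j<n. c j * F j y) \<Longrightarrow> f \<in> fun_span n F"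
  unfolding fun_span_def by blast

theorem mainTheorem6:
  fixes n :: nat and M :: matrix_space and \<nu> :: real
    and P :: "'s measure" and X1 X2 :: "'s \<Rightarrow> complex mat"
    and \<omega> :: "real \<Rightarrow> real" and w ptilde p q :: "nat \<Rightarrow> real \<Rightarrow> real"
    and Ktilde K :: "real \<Rightarrow> real \<Rightarrow> real"
  assumes n: "n \<ge> 1"
    and nu: "\<nu> = msp_nu M"
    and P: "prob_space P"
    and X1: "polya_ensemble P n M \<omega> X1"
    and X2: "polynomial_ensemble P n M w X2"
    and indep: "prob_space.indep_var P (msp_borel n M) X1 (msp_borel n M) X2"
    and biorth: "described_by n w ptilde (\<lambda>j. w (j + 1))"
    and Ktilde: "Ktilde = biorth_kernel n ptilde (\<lambda>j. w (j + 1))"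
    and Y: "has_ssv_density P n M (\<lambda>s. X1 s + X2 s)
              (\<lambda>y. norm_const n w / (fact n * hankel \<nu> \<omega> 0 ^ n) * Vandermonde n y *
                    weight_det n (\<lambda>b. conv \<nu> \<omega> (w b)) y)"
    and p: "\<And>j y'. j < n \<Longrightarrow> y' > 0 \<Longrightarrow>
              p j y' = (LINT r:{0<..}|lborel. exp (- r) *
                ((mixed_op \<nu> r ^^ (n - 1)) (\<lambda>t y. ptilde j y / hankel \<nu> \<omega> t) 0 y'
                   / fact (n - 1)))"
    and q: "\<And>j y. j < n \<Longrightarrow> y > 0 \<Longrightarrow> q j y = conv \<nu> \<omega> (w (j + 1)) y"
    and K: "K = biorth_kernel n p q"
  shows "described_by n (\<lambda>b. conv \<nu> \<omega> (w b)) p q \<and>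
    (\<nu> > - 1 / 2 \<longrightarrow>
      (AE y in lborel. y > 0 \<longrightarrow> (\<forall>y'>0.
        K y' y = y powr \<nu> *
          (LINT x:{0<..}|lborel. LINT r:{0<..}|lborel. exp (- r) *
             (Gamma (\<nu> + 1) / (sqrt pi * Gamma (\<nu> + 1 / 2)) *
              (LINT t:{-1..1}|lborel.
                 \<omega> (x + y - 2 * sqrt (x * y) * t) / (x + y - 2 * sqrt (x * y) * t) powr \<nu>
                   * (1 - t\<^sup>2) powr (\<nu> - 1 / 2))) *
             ((mixed_op \<nu> r ^^ (n - 1)) (\<lambda>t z. Ktilde z x / hankel \<nu> \<omega> t) 0 y'
                / fact (n - 1)))))) \<and>
    (\<nu> = - 1 / 2 \<longrightarrow>
      (AE y in lborel. y > 0 \<longrightarrow> (\<forall>y'>0.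
        K y' y = 1 / (2 * sqrt y) *
          (LINT x:{0<..}|lborel. LINT r:{0<..}|lborel. exp (- r) *
             (\<bar>sqrt x - sqrt y\<bar> * \<omega> ((sqrt x - sqrt y)\<^sup>2)
                + \<bar>sqrt x + sqrt y\<bar> * \<omega> ((sqrt x + sqrt y)\<^sup>2)) *
             ((mixed_op \<nu> r ^^ (n - 1)) (\<lambda>t z. Ktilde z x / hankel \<nu> \<omega> t) 0 y'
                / fact (n - 1))))))"
proof -
  have \<nu>: "\<nu> \<ge> - 1 / 2" unfolding nu by (cases M) auto
  hence s: "\<nu> + 1 > 0" by simp
  have L1: "\<omega> \<in> L1_nu n \<nu>" using X1 by (simp add: polya_ensemble_def nu)
  have \<omega>int: "set_integrable lborel {0<..} (\<lambda>x. x ^ k * \<omega> x)" if "k < n" for k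
  proof (rule moments_from_powr[OF _ that])
    have "\<forall>j<n. \<forall>\<kappa>\<in>{1..real n}. set_integrable lborel {0<..} (\<lambda>x. x powr (\<kappa> - 1) * (weight_op \<nu> ^^ j) \<omega> x)"
      using L1 unfolding L1_nu_def mem_Collect_eq by (elim conjE)
    from spec[OF this, of 0] n
    have "\<forall>\<kappa>\<in>{1..real n}. set_integrable lborel {0<..} (\<lambda>x. x powr (\<kappa> - 1) * (weight_op \<nu> ^^ 0) \<omega> x)" by simp
    thus "\<forall>\<kappa>\<in>{1..real n}. set_integrable lborel {0<..} (\<lambda>x. x powr (\<kappa> - 1) * \<omega> x)" by simp
  qed
  have wint: "set_integrable lborel {0<..} (\<lambda>x. x ^ k * w (Suc j) x)" if "k < n" "j < n" for k j
  proof (rule moments_from_powr[OF _ that(1)])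
    have "w (Suc j) \<in> L1_moments n" using X2 that by (auto simp: polynomial_ensemble_def)
    thus "\<forall>\<kappa>\<in>{1..real n}. set_integrable lborel {0<..} (\<lambda>x. x powr (\<kappa> - 1) * w (Suc j) x)"
      by (simp add: L1_moments_def)
  qed
  have mass: "(LINT x:{0<..}|lborel. \<omega> x) > 0"
  proof (rule mass_pos)
    show "set_integrable lborel {0<..} \<omega>" using \<omega>int[of 0] n by simp
    show "\<forall>x>0. 0 \<le> \<omega> x" using L1 unfolding L1_nu_def mem_Collect_eq by (elim conjE)
    have "0 < norm_const n (\<lambda>j. (weight_op (msp_nu M) ^^ (j - 1)) \<omega>)"
      using X1 by (simp add: polya_ensemble_def polynomial_ensemble_def)
    from weight_not_null[OF n this] show "\<not> (AE x in lborel. x > 0 \<longrightarrow> \<omega> x = 0)" by simp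
  qed

  obtain \<delta> g where \<delta>: "\<delta> > 0" and g0: "\<forall>t\<in>{0..<\<delta>}. g 0 t = 1 / hankel \<nu> \<omega> t"
    and gd: "\<forall>k<n - 1. \<forall>t\<in>{0..<\<delta>}. (g k has_field_derivative g (Suc k) t) (at t within {0..})"
    and gl: "\<forall>k. (\<Sum>i\<le>k. ((- 1) ^ i * g i 0 / fact i) *
        ((LINT x:{0<..}|lborel. x ^ (k - i) * \<omega> x) / (pochhammer (\<nu> + 1) (k - i) * fact (k - i)))) = (if k = 0 then 1 else 0 :: real)"
    by (rule hankel_reciprocal_derivs[OF \<nu> n \<omega>int mass])
  define \<alpha> where "\<alpha> i = (- 1) ^ i * g i 0 / fact i" for i
  define \<beta> where "\<beta> = (\<lambda>k. (LINT x:{0<..}|lborel. x ^ k * \<omega> x) / (pochhammer (\<nu> + 1) k * fact k))"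
  have \<alpha>\<beta>: "(\<Sum>i\<le>k. \<alpha> i * \<beta> (k - i)) = (if k = 0 then 1 else 0)" for k
    using spec[OF gl, of k] by (simp add: \<alpha>_def \<beta>_def)
  have \<beta>\<alpha>: "(\<Sum>i\<le>k. \<beta> i * \<alpha> (k - i)) = (if k = 0 then 1 else 0)" for k
  proof -
    have "(\<Sum>i\<le>k. \<beta> i * \<alpha> (k - i)) = (\<Sum>i\<le>k. \<alpha> i * \<beta> (k - i))"
      by (rule sum.reindex_bij_witness[of _ "\<lambda>i. k - i" "\<lambda>i. k - i"]) auto
    thus ?thesis by (simp add: \<alpha>\<beta>)
  qed
  define A where "A = bessel_op_series (\<nu> + 1) n \<alpha>"
  define B where "B = bessel_op_series (\<nu> + 1) n \<beta>"
  have AB: "A (B Q) = Q" and BA: "B (A Q) = Q" if "degree Q < n" for Q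
    unfolding A_def B_def using \<alpha>\<beta> \<beta>\<alpha> by (intro bessel_op_series_inverse s that; simp)+
  have degA: "degree (A Q) < n" and degB: "degree (B Q) < n" if "degree Q < n" for Q
    unfolding A_def B_def using degree_bessel_op_series that by (meson le_less_trans)+

  \<comment> \<open>The factor \<open>a\<close> is \<open>1\<close> for \<open>p\<^sub>j\<close> and the averaged weight, which is constant in \<open>r\<close>, for the kernel.\<close>
  have operator: "(LINT r:{0<..}|lborel. exp (- r) * (a * ((mixed_op \<nu> r ^^ (n - 1)) F 0 y / fact (n - 1)))) = a * poly (A Q) y"
    if F: "\<And>t z. z > 0 \<Longrightarrow> F t z = poly Q z / hankel \<nu> \<omega> t" and y: "y > 0" for F a Q y
  proof -
    have "(mixed_op \<nu> r ^^ (n - 1)) F 0 y =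
      (\<Sum>k\<le>n - 1. real (n - 1 choose k) * (r ^ (n - 1 - k) * ((- 1) ^ k * g k 0 * poly ((bessel_op (\<nu> + 1) ^^ k) Q) y)))" for r
      by (subst mixed_op_pow[where \<delta>=\<delta> and N="n - 1" and g=g and P=Q])
         (use F g0 gd \<delta> y in \<open>auto simp: mult.assoc\<close>)
    hence "(LINT r:{0<..}|lborel. exp (- r) * (a * ((mixed_op \<nu> r ^^ (n - 1)) F 0 y / fact (n - 1)))) =
      a * (\<Sum>k\<le>n - 1. ((- 1) ^ k * g k 0 * poly ((bessel_op (\<nu> + 1) ^^ k) Q) y) / fact k)"
      by (simp only: exp_binomial_integral)
    also have "{..n - 1} = {..<n}" using n by auto
    finally show ?thesis by (simp add: A_def bessel_op_series_def poly_sum \<alpha>_def)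
  qed

  have "\<exists>Q. degree Q < n \<and> (\<forall>y>0. ptilde j y = poly Q y)" if "j < n" for j
  proof -
    have "(\<lambda>y\<in>{0<..}. ptilde j y) = (\<lambda>y\<in>{0<..}. \<Sum>i<n. (if i = j then 1 else 0) * ptilde i y)"
      using that by (simp add: if_distrib[of "\<lambda>c. c * _"] cong: if_cong)
    hence "(\<lambda>y\<in>{0<..}. ptilde j y) \<in> fun_span n ptilde" by (rule fun_spanI)
    also have "\<dots> = {\<lambda>y\<in>{0<..}. poly Q y |Q. degree Q < n}"
      using biorth fun_span_monomials[OF n] by (simp add: described_by_def)
    finally obtain Q where "degree Q < n" "(\<lambda>y\<in>{0<..}. ptilde j y) = (\<lambda>y\<in>{0<..}. poly Q y)" by blast
    hence "degree Q < n \<and> (\<forall>y>0. ptilde j y = poly Q y)" by (metis greaterThan_iff restrict_apply')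
    thus ?thesis ..
  qed
  then obtain R where R: "\<And>j. j < n \<Longrightarrow> degree (R j) < n" "\<And>j y. j < n \<Longrightarrow> y > 0 \<Longrightarrow> ptilde j y = poly (R j) y"
    by metis
  have pA: "p j y = poly (A (R j)) y" if "j < n" "y > 0" for j y
    using operator[of "\<lambda>t y. ptilde j y / hankel \<nu> \<omega> t" "R j" y 1] that by (simp add: p R(2))

  have "described_by n (\<lambda>b. conv \<nu> \<omega> (w b)) p q"
    unfolding described_by_def
  proof (intro conjI allI impI)
    fix l m assume lm: "l < n" "m < n"
    have eq: "p l y * q m y = poly (A (R l)) y * conv \<nu> \<omega> (w (Suc m)) y" if "y \<in> {0<..}" for y
      using that lm pA q by simp
    note cmf = conv_moment_functional[OF \<nu> degA[OF R(1)[OF lm(1)]] \<omega>int wint[OF _ lm(2)]]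
    show "set_integrable lborel {0<..} (\<lambda>y. p l y * q m y)"
      using cmf(1)
      by (subst set_integrable_cong[OF refl refl eq]) auto
    have "(LINT y:{0<..}|lborel. p l y * q m y) = (LINT y:{0<..}|lborel. poly (A (R l)) y * conv \<nu> \<omega> (w (Suc m)) y)"
      using eq by (intro set_lebesgue_integral_cong) auto
    also have "\<dots> = (LINT y:{0<..}|lborel. poly (B (A (R l))) y * w (Suc m) y)"
      unfolding B_def \<beta>_def by (rule cmf(2))
    also have "\<dots> = (LINT y:{0<..}|lborel. ptilde l y * w (m + 1) y)"
      using R lm BA by (intro set_lebesgue_integral_cong) auto
    also have "\<dots> = (if l = m then 1 else 0)" using biorth lm by (simp add: described_by_def)
    finally show "(LINT y:{0<..}|lborel. p l y * q m y) = (if l = m then 1 else 0)" .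
  next
    show "fun_span n q = fun_span n (\<lambda>j. conv \<nu> \<omega> (w (j + 1)))"
      by (rule fun_span_eq_restrict) (use q in auto)
  next
    have comb: "(\<Sum>j<n. c j * p j y) = poly (A (\<Sum>j<n. Polynomial.smult (c j) (R j))) y" if "y > 0" for c :: "nat \<Rightarrow> real" and y
      using that by (simp add: A_def bessel_op_series_sum bessel_op_series_smult poly_sum pA)
    have degc: "degree (\<Sum>j<n. Polynomial.smult (c j) (R j)) < n" for c
    proof -
      have "degree (\<Sum>j<n. Polynomial.smult (c j) (R j)) \<le> n - 1"
        using R(1) by (intro degree_sum_le) (fastforce intro: le_trans[OF degree_smult_le])+
      thus ?thesis using n by simp
    qed
    show "fun_span n p = fun_span n (\<lambda>j y. y ^ j)"
      unfolding fun_span_monomials[OF n]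
    proof (intro equalityI subsetI)
      fix f assume "f \<in> fun_span n p"
      then obtain c where f: "f = (\<lambda>y\<in>{0<..}. \<Sum>j<n. c j * p j y)" by (auto simp: fun_span_def)
      have "f = (\<lambda>y\<in>{0<..}. poly (A (\<Sum>j<n. Polynomial.smult (c j) (R j))) y)"
        unfolding f using comb by (intro restrict_ext) auto
      thus "f \<in> {\<lambda>y\<in>{0<..}. poly Q y |Q. degree Q < n}" using degA[OF degc] by blast
    next
      fix f :: "real \<Rightarrow> real" assume "f \<in> {\<lambda>y\<in>{0<..}. poly Q y |Q. degree Q < n}"
      then obtain Q where Q: "degree Q < n" "f = (\<lambda>y\<in>{0<..}. poly Q y)" by blast
      have "(\<lambda>y\<in>{0<..}. poly (B Q) y) \<in> fun_span n ptilde"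
        using biorth degB[OF Q(1)] unfolding described_by_def fun_span_monomials[OF n] by blast
      then obtain c where c: "(\<lambda>y\<in>{0<..}. poly (B Q) y) = (\<lambda>y\<in>{0<..}. \<Sum>j<n. c j * ptilde j y)"
        by (auto simp: fun_span_def)
      have "B Q = (\<Sum>j<n. Polynomial.smult (c j) (R j))"
      proof (rule poly_eqI_pos_reals)
        fix y :: real assume y: "y > 0"
        have "poly (B Q) y = (\<Sum>j<n. c j * ptilde j y)" using fun_cong[OF c, of y] y by simp
        thus "poly (B Q) y = poly (\<Sum>j<n. Polynomial.smult (c j) (R j)) y" using y R(2) by (simp add: poly_sum)
      qed
      hence "Q = A (\<Sum>j<n. Polynomial.smult (c j) (R j))" using AB[OF Q(1)] by simp
      hence "f = (\<lambda>y\<in>{0<..}. \<Sum>j<n. c j * p j y)" unfolding Q(2) using comb by (intro restrict_ext) auto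
      thus "f \<in> fun_span n p" by (rule fun_spanI)
    qed
  qed

  \<comment> \<open>Both kernel formulas at once; \<open>c\<close> is the prefactor and \<open>\<Lambda>\<close> the average of \<open>\<omega>\<close>. The integrand in
      \<open>x\<close> is \<open>\<Sum>\<^sub>j p\<^sub>j(y') w\<^sub>j\<^sub>+\<^sub>1(x)\<close> times the translate of \<open>\<omega>\<close>, that is, \<open>w\<^sub>j\<^sub>+\<^sub>1 * \<omega>\<close> instead of
      \<open>\<omega> * w\<^sub>j\<^sub>+\<^sub>1\<close>.\<close>
  moreover have kernel: "AE y in lborel. y > 0 \<longrightarrow> (\<forall>y'>0. K y' y = c y *
      (LINT x:{0<..}|lborel. LINT r:{0<..}|lborel. exp (- r) * \<Lambda> x y *
         ((mixed_op \<nu> r ^^ (n - 1)) (\<lambda>t z. Ktilde z x / hankel \<nu> \<omega> t) 0 y' / fact (n - 1))))"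
    if \<Lambda>: "\<And>x y. x > 0 \<Longrightarrow> y > 0 \<Longrightarrow> c y * \<Lambda> x y = translate \<nu> \<omega> y x" for c :: "real \<Rightarrow> real" and \<Lambda>
  proof -
    have "AE y in lborel. \<forall>j\<in>{..<n}. y > 0 \<longrightarrow> set_integrable lborel {0<..} (\<lambda>x. w (Suc j) x * translate \<nu> \<omega> y x) \<and>
        conv \<nu> (w (Suc j)) \<omega> y = conv \<nu> \<omega> (w (Suc j)) y"
    proof (rule AE_finite_allI)
      fix j assume j: "j \<in> {..<n}"
      show "AE y in lborel. y > 0 \<longrightarrow> set_integrable lborel {0<..} (\<lambda>x. w (Suc j) x * translate \<nu> \<omega> y x) \<and>
        conv \<nu> (w (Suc j)) \<omega> y = conv \<nu> \<omega> (w (Suc j)) y"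
        by (rule conv_Fubini(1)[where m=0]) (use \<nu> j \<omega>int[of 0] wint[of 0 j] n in auto)
    qed simp
    thus ?thesis
    proof eventually_elim
      case (elim y)
      show ?case
      proof (intro impI allI)
        fix y' :: real assume y: "y > 0" and y': "y' > 0"
        have inner: "(LINT r:{0<..}|lborel. exp (- r) * \<Lambda> x y *
         ((mixed_op \<nu> r ^^ (n - 1)) (\<lambda>t z. Ktilde z x / hankel \<nu> \<omega> t) 0 y' / fact (n - 1))) =
         \<Lambda> x y * (\<Sum>j<n. w (Suc j) x * p j y')" if x: "x > 0" for x
        proof -
          define Q where "Q = (\<Sum>j<n. Polynomial.smult (w (Suc j) x) (R j))"
          have "Ktilde z x / hankel \<nu> \<omega> t = poly Q z / hankel \<nu> \<omega> t" if "z > 0" for t z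
            using that by (simp add: Ktilde biorth_kernel_def Q_def poly_sum R(2) mult.commute)
          from operator[of "\<lambda>t z. Ktilde z x / hankel \<nu> \<omega> t", OF this y', of "\<Lambda> x y"]
          have "(LINT r:{0<..}|lborel. exp (- r) * (\<Lambda> x y *
            ((mixed_op \<nu> r ^^ (n - 1)) (\<lambda>t z. Ktilde z x / hankel \<nu> \<omega> t) 0 y' / fact (n - 1)))) = \<Lambda> x y * poly (A Q) y'" .
          moreover have "poly (A Q) y' = (\<Sum>j<n. w (Suc j) x * p j y')"
            using y' by (simp add: Q_def A_def bessel_op_series_sum bessel_op_series_smult poly_sum pA)
          ultimately show ?thesis by (simp only: mult.assoc)
        qed
        have "c y * (LINT x:{0<..}|lborel. LINT r:{0<..}|lborel. exp (- r) * \<Lambda> x y *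
         ((mixed_op \<nu> r ^^ (n - 1)) (\<lambda>t z. Ktilde z x / hankel \<nu> \<omega> t) 0 y' / fact (n - 1))) =
         c y * (LINT x:{0<..}|lborel. \<Lambda> x y * (\<Sum>j<n. w (Suc j) x * p j y'))"
          using inner by (intro arg_cong2[where f="(*)"] set_lebesgue_integral_cong refl) auto
        also have "\<dots> = (LINT x:{0<..}|lborel. c y * (\<Lambda> x y * (\<Sum>j<n. w (Suc j) x * p j y')))"
          by (rule set_integral_mult_right[symmetric])
        also have "\<dots> = (LINT x:{0<..}|lborel. (\<Sum>j<n. p j y' * (w (Suc j) x * translate \<nu> \<omega> y x)))"
        proof (intro set_lebesgue_integral_cong allI impI)
          fix x :: real assume "x \<in> {0<..}"
          hence "c y * (\<Lambda> x y * (\<Sum>j<n. w (Suc j) x * p j y')) = translate \<nu> \<omega> y x * (\<Sum>j<n. w (Suc j) x * p j y')"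
            using \<Lambda>[of x y] y by (simp add: mult.assoc[symmetric])
          thus "c y * (\<Lambda> x y * (\<Sum>j<n. w (Suc j) x * p j y')) = (\<Sum>j<n. p j y' * (w (Suc j) x * translate \<nu> \<omega> y x))"
            by (simp add: sum_distrib_left mult_ac)
        qed auto
        also have "\<dots> = (\<Sum>j<n. p j y' * (LINT x:{0<..}|lborel. w (Suc j) x * translate \<nu> \<omega> y x))"
          using elim y by (intro set_integral_lincomb) auto
        also have "\<dots> = (\<Sum>j<n. p j y' * q j y)"
          using elim y q by (intro sum.cong refl) (simp add: conv_eq_translate[symmetric])
        finally show "K y' y = c y * (LINT x:{0<..}|lborel. LINT r:{0<..}|lborel. exp (- r) * \<Lambda> x y *
         ((mixed_op \<nu> r ^^ (n - 1)) (\<lambda>t z. Ktilde z x / hankel \<nu> \<omega> t) 0 y' / fact (n - 1)))"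
          by (simp add: K biorth_kernel_def)
      qed
    qed
  qed

  moreover have "AE y in lborel. y > 0 \<longrightarrow> (\<forall>y'>0.
        K y' y = y powr \<nu> *
          (LINT x:{0<..}|lborel. LINT r:{0<..}|lborel. exp (- r) *
             (Gamma (\<nu> + 1) / (sqrt pi * Gamma (\<nu> + 1 / 2)) *
              (LINT t:{-1..1}|lborel.
                 \<omega> (x + y - 2 * sqrt (x * y) * t) / (x + y - 2 * sqrt (x * y) * t) powr \<nu>
                   * (1 - t\<^sup>2) powr (\<nu> - 1 / 2))) *
             ((mixed_op \<nu> r ^^ (n - 1)) (\<lambda>t z. Ktilde z x / hankel \<nu> \<omega> t) 0 y'
                / fact (n - 1))))" if "\<nu> > - 1 / 2"
  proof (rule kernel)
    fix x y :: real
    have "\<nu> \<noteq> - 1 / 2" using that by simp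
    thus "y powr \<nu> * (Gamma (\<nu> + 1) / (sqrt pi * Gamma (\<nu> + 1 / 2)) *
              (LINT t:{-1..1}|lborel.
                 \<omega> (x + y - 2 * sqrt (x * y) * t) / (x + y - 2 * sqrt (x * y) * t) powr \<nu>
                   * (1 - t\<^sup>2) powr (\<nu> - 1 / 2))) = translate \<nu> \<omega> y x"
      unfolding translate_def gegenbauer_const_def add.commute[of y x] mult.commute[of y x]
      by (simp only: if_False mult_ac)
  qed
  moreover have "AE y in lborel. y > 0 \<longrightarrow> (\<forall>y'>0.
        K y' y = 1 / (2 * sqrt y) *
          (LINT x:{0<..}|lborel. LINT r:{0<..}|lborel. exp (- r) *
             (\<bar>sqrt x - sqrt y\<bar> * \<omega> ((sqrt x - sqrt y)\<^sup>2)
                + \<bar>sqrt x + sqrt y\<bar> * \<omega> ((sqrt x + sqrt y)\<^sup>2)) *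
             ((mixed_op \<nu> r ^^ (n - 1)) (\<lambda>t z. Ktilde z x / hankel \<nu> \<omega> t) 0 y'
                / fact (n - 1))))" if "\<nu> = - 1 / 2"
    by (rule kernel) (simp add: translate_def that)
  ultimately show ?thesis by blast
qed

end
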